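(* Let $n$ be a positive integer and let $f:[n]\to[n]$ be a Hessenberg function such that a longest chain in the poset $P(f)$ has exactly $3$ elements. Write $\omega X_{G(f)}(\mathbf{x})=\sum_{\lambda\vdash n} c_\lambda h_\lambda(\mathbf{x})$. Then every coefficient $c_\lambda$ is a nonnegative integer; that is, $\omega X_{G(f)}(\mathbf{x})$ is $h$-positive.
   Context: $[n]=\{1,\dots,n\}$. A Hessenberg function is a non-decreasing function $f:[n]\to[n]$ with $i\le f(i)$ for all $i\in[n]$. The natural unit interval order $P(f)$ is the poset on $[n]$ with $i\prec_f j$ if and only if $f(i)<j$. The graph $G(f)$ has vertex set $[n]$, and for $i<j$, $\{i,j\}$ is an edge if and only if $f(i)\ge j$ (it is the incomparability graph of $P(f)$). For a graph $G$ on vertex set $V$, a proper coloring is a map $\kappa:V\to\mathbb{P}$ (positive integers) with $\kappa(u)\neq\kappa(v)$ whenever $\{u,v\}$ is an edge, and Stanley's chromatic symmetric function is $X_G(\mathbf{x})=\sum_\kappa\prod_{v\in V}x_{\kappa(v)}$, summed over all proper colorings, in infinitely many variables $\mathbf{x}=(x_1,x_2,\dots)$. For a partition $\lambda=(\lambda_1,\dots,\lambda_\ell)$, $h_\lambda=h_{\lambda_1}\cdots h_{\lambda_\ell}$ where $h_k$ is the complete homogeneous symmetric function of degree $k$. $\omega$ is the standard involution on symmetric functions with $\omega(e_k)=h_k$ (equivalently $\omega(s_\lambda)=s_{\lambda'}$). *)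

theory Defs
  imports Complex_Main "HOL-Library.Multiset" "HOL-Library.FuncSet"
begin

section \<open>Formal power series in countably many variables\<close>

text \<open>
  The variables are indexed by \<^typ>\<open>nat\<close>, so index \<open>i\<close> stands for the variable usually written
  with subscript \<open>i + 1\<close>. A monomial is the multiset of the indices of its variables;
  multiplication of monomials is multiset addition.
\<close>

typedef 'a mfps = "UNIV :: (nat multiset \<Rightarrow> 'a) set"
  morphisms mcoeff Abs_mfps
  by simp

lemma mcoeff_Abs [simp]: "mcoeff (Abs_mfps F) = F"
  by (simp add: Abs_mfps_inverse)

lemma mfps_eq_iff: "F = G \<longleftrightarrow> (\<forall>m. mcoeff F m = mcoeff G m)"
  by (metis mcoeff_inject ext)

lemma finite_submultisets [simp]: "finite {a. a \<subseteq># (m :: 'b multiset)}"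
proof (induction m)
  case empty
  then show ?case by simp
next
  case (add x m)
  have "{a. a \<subseteq># add_mset x m} \<subseteq> {a. a \<subseteq># m} \<union> add_mset x ` {a. a \<subseteq># m}"
  proof
    fix a assume "a \<in> {a. a \<subseteq># add_mset x m}"
    then have a: "a \<subseteq># add_mset x m" by simp
    show "a \<in> {a. a \<subseteq># m} \<union> add_mset x ` {a. a \<subseteq># m}"
    proof (cases "x \<in># a")
      case True
      then obtain b where b: "a = add_mset x b" by (metis mset_add)
      with a have "b \<subseteq># m" by simp
      with b show ?thesis by blast
    next
      case False
      with a have "a \<subseteq># m"
        by (metis add_mset_remove_trivial diff_single_trivial mset_subset_eq_add_mset_cancel
            subset_eq_diff_conv union_mset_add_mset_right add_0_right)
      then show ?thesis by blast
    qed
  qed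
  with add show ?case by (meson finite_UnI finite_imageI finite_subset)
qed

instantiation mfps :: (comm_ring_1) comm_ring_1
begin

definition zero_mfps :: "'a mfps" where "0 = Abs_mfps (\<lambda>_. 0)"
definition one_mfps :: "'a mfps" where "1 = Abs_mfps (\<lambda>m. if m = {#} then 1 else 0)"
definition plus_mfps :: "'a mfps \<Rightarrow> 'a mfps \<Rightarrow> 'a mfps"
  where "F + G = Abs_mfps (\<lambda>m. mcoeff F m + mcoeff G m)"
definition minus_mfps :: "'a mfps \<Rightarrow> 'a mfps \<Rightarrow> 'a mfps"
  where "F - G = Abs_mfps (\<lambda>m. mcoeff F m - mcoeff G m)"
definition uminus_mfps :: "'a mfps \<Rightarrow> 'a mfps"
  where "- F = Abs_mfps (\<lambda>m. - mcoeff F m)"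
definition times_mfps :: "'a mfps \<Rightarrow> 'a mfps \<Rightarrow> 'a mfps"
  where "F * G = Abs_mfps (\<lambda>m. \<Sum>a | a \<subseteq># m. mcoeff F a * mcoeff G (m - a))"

lemma mcoeff_simps:
  shows mcoeff_0 [simp]: "mcoeff (0 :: 'a mfps) m = 0"
    and mcoeff_1: "mcoeff (1 :: 'a mfps) m = (if m = {#} then 1 else 0)"
    and mcoeff_add [simp]: "mcoeff (F + G) m = mcoeff F m + mcoeff (G :: 'a mfps) m"
    and mcoeff_diff [simp]: "mcoeff (F - G) m = mcoeff F m - mcoeff (G :: 'a mfps) m"
    and mcoeff_uminus [simp]: "mcoeff (- F) m = - mcoeff (F :: 'a mfps) m"
    and mcoeff_mult:
      "mcoeff (F * G) m = (\<Sum>a | a \<subseteq># m. mcoeff F a * mcoeff (G :: 'a mfps) (m - a))"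
  by (simp_all add: zero_mfps_def one_mfps_def plus_mfps_def minus_mfps_def uminus_mfps_def
      times_mfps_def)

instance
proof
  fix F G H :: "'a mfps"
  show "F + G + H = F + (G + H)" "F + G = G + F" "0 + F = F" "- F + F = 0" "F - G = F + - G"
    by (simp_all add: mfps_eq_iff)
  show "(0 :: 'a mfps) \<noteq> 1"
    by (auto simp: mfps_eq_iff mcoeff_1 intro!: exI[of _ "{#}"])
  show "(F + G) * H = F * H + G * H"
    by (simp add: mfps_eq_iff mcoeff_mult algebra_simps sum.distrib)
  show "F * G = G * F"
    unfolding mfps_eq_iff mcoeff_mult
  proof (intro allI)
    fix m :: "nat multiset"
    have 1: "m - (m - a) = a" if "a \<subseteq># m" for a
      using that by (metis add_diff_cancel_right' subset_mset.diff_add subset_mset.le_iff_add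
          add_diff_cancel_left')
    show "(\<Sum>a | a \<subseteq># m. mcoeff F a * mcoeff G (m - a)) =
        (\<Sum>a | a \<subseteq># m. mcoeff G a * mcoeff F (m - a))"
      by (rule sum.reindex_bij_witness[of _ "\<lambda>a. m - a" "\<lambda>a. m - a"])
        (auto simp: mult.commute 1)
  qed
  show "1 * F = F"
    unfolding mfps_eq_iff mcoeff_mult
  proof (intro allI)
    fix m
    have "(\<Sum>a | a \<subseteq># m. mcoeff 1 a * mcoeff F (m - a)) =
        (\<Sum>a\<in>{{#}}. mcoeff 1 a * mcoeff F (m - a))"
      by (rule sum.mono_neutral_right) (auto simp: mcoeff_1)
    then show "(\<Sum>a | a \<subseteq># m. mcoeff 1 a * mcoeff F (m - a)) = mcoeff F m"
      by (simp add: mcoeff_1)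
  qed
  show "F * G * H = F * (G * H)"
    unfolding mfps_eq_iff
  proof (intro allI)
    fix m
    have "mcoeff (F * G * H) m = (\<Sum>(a, b)\<in>(SIGMA a:{a. a \<subseteq># m}. {b. b \<subseteq># a}).
        mcoeff F b * mcoeff G (a - b) * mcoeff H (m - a))"
      by (simp add: mcoeff_mult sum_distrib_right sum.Sigma)
    also have "\<dots> = (\<Sum>(b, c)\<in>(SIGMA b:{b. b \<subseteq># m}. {c. c \<subseteq># m - b}).
        mcoeff F b * (mcoeff G c * mcoeff H (m - b - c)))"
    proof -
      have 1: "a - b \<subseteq># m - b \<and> b \<subseteq># m \<and> b + (a - b) = a \<and> m - b - (a - b) = m - a"
        if "a \<subseteq># m" "b \<subseteq># a" for a b
      proof -
        from that obtain c d where "a = b + c" "m = b + c + d"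
          by (metis subset_mset.le_iff_add)
        then show ?thesis by (simp add: add.assoc)
      qed
      have 2: "b + c \<subseteq># m" if "b \<subseteq># m" "c \<subseteq># m - b" for b c
        using that by (metis add.commute subset_mset.le_diff_conv2)
      show ?thesis
        by (rule sum.reindex_bij_witness[of _ "\<lambda>(b, c). (b + c, b)" "\<lambda>(a, b). (b, a - b)"])
          (auto simp: 1 2 mult.assoc)
    qed
    also have "\<dots> = mcoeff (F * (G * H)) m"
      by (simp add: mcoeff_mult sum_distrib_left sum.Sigma)
    finally show "mcoeff (F * G * H) m = mcoeff (F * (G * H)) m" .
  qed
qed

end

definition mconst :: "'a::zero \<Rightarrow> 'a mfps"
  where "mconst c = Abs_mfps (\<lambda>m. if m = {#} then c else 0)"

text \<open>
  The formal sum, over \<open>i \<in> I\<close>, of the monomials \<open>w i\<close>. It is only meaningful if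
  every monomial arises from finitely many \<open>i\<close>.
\<close>

definition monomial_sum :: "'i set \<Rightarrow> ('i \<Rightarrow> nat multiset) \<Rightarrow> 'a::comm_ring_1 mfps"
  where "monomial_sum I w = Abs_mfps (\<lambda>m. of_nat (card {i \<in> I. w i = m}))"


section \<open>Symmetric functions\<close>

definition symmetric_functions :: "'a::comm_ring_1 mfps set"
  where "symmetric_functions =
    {F. (\<exists>d. \<forall>m. mcoeff F m \<noteq> 0 \<longrightarrow> size m \<le> d) \<and>
        (\<forall>\<pi> m. bij \<pi> \<longrightarrow> mcoeff F (image_mset \<pi> m) = mcoeff F m)}"

definition elementary_sf :: "nat \<Rightarrow> 'a::comm_ring_1 mfps"
  where "elementary_sf k = monomial_sum {S. finite S \<and> card S = k} mset_set"

definition homogeneous_sf :: "nat \<Rightarrow> 'a::comm_ring_1 mfps"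
  where "homogeneous_sf k = monomial_sum {m. size m = k} id"

definition partitions_of :: "nat \<Rightarrow> nat multiset set"
  where "partitions_of n = {\<mu>. 0 \<notin># \<mu> \<and> sum_mset \<mu> = n}"

lemma finite_partitions_of: "finite (partitions_of n)"
proof (rule finite_subset)
  have "size \<mu> \<le> sum_mset \<mu>" if "0 \<notin># \<mu>" for \<mu> :: "nat multiset"
    using that by (induction \<mu>) (auto simp: Suc_le_eq)
  have "k \<le> sum_mset \<mu>" if "k \<in># \<mu>" for k and \<mu> :: "nat multiset"
    using that by (metis le_add1 sum_mset.remove)
  have "\<mu> \<in> mset ` {xs. set xs \<subseteq> {..n} \<and> length xs \<le> n}"
    if "\<mu> \<in> partitions_of n" for \<mu>
  proof -
    obtain xs where xs: "mset xs = \<mu>" using ex_mset by blast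
    have "length xs \<le> n" using \<open>\<And>\<mu>. 0 \<notin># \<mu> \<Longrightarrow> size \<mu> \<le> sum_mset \<mu>\<close>[of \<mu>] that
      by (simp add: partitions_of_def flip: xs)
    moreover have "set xs \<subseteq> {..n}" using \<open>\<And>k \<mu>. k \<in># \<mu> \<Longrightarrow> k \<le> sum_mset \<mu>\<close>[of _ \<mu>] that
      by (auto simp: partitions_of_def simp flip: xs)
    ultimately show ?thesis using xs by blast
  qed
  then show "partitions_of n \<subseteq> mset ` {xs. set xs \<subseteq> {..n} \<and> length xs \<le> n}"
    by blast
  show "finite (mset ` {xs. set xs \<subseteq> {..n} \<and> length xs \<le> n})"
    by (intro finite_imageI finite_lists_length_le) simp
qed

definition homogeneous_prod :: "nat multiset \<Rightarrow> 'a::comm_ring_1 mfps"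
  where "homogeneous_prod \<mu> = (\<Prod>k\<in>#\<mu>. homogeneous_sf k)"

definition h_expansion :: "nat \<Rightarrow> (nat multiset \<Rightarrow> 'a) \<Rightarrow> 'a::comm_ring_1 mfps"
  where "h_expansion n c = (\<Sum>\<mu>\<in>partitions_of n. mconst (c \<mu>) * homogeneous_prod \<mu>)"

text \<open>
  The algebra endomorphism of the ring of symmetric functions that maps every elementary
  function to the complete homogeneous one. Since the elementary functions generate this
  algebra freely, it exists and is unique; its values on other power series are irrelevant.
\<close>

definition is_omega :: "('a::comm_ring_1 mfps \<Rightarrow> 'a mfps) \<Rightarrow> bool"
  where "is_omega w \<longleftrightarrow>
    w ` symmetric_functions \<subseteq> symmetric_functions \<and>
    w 1 = 1 \<and>
    (\<forall>F\<in>symmetric_functions. \<forall>G\<in>symmetric_functions. w (F + G) = w F + w G) \<and>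
    (\<forall>F\<in>symmetric_functions. \<forall>G\<in>symmetric_functions. w (F * G) = w F * w G) \<and>
    (\<forall>c. \<forall>F\<in>symmetric_functions. w (mconst c * F) = mconst c * w F) \<and>
    (\<forall>k. w (elementary_sf k) = homogeneous_sf k)"

definition omega :: "'a::comm_ring_1 mfps \<Rightarrow> 'a mfps"
  where "omega = (SOME w. is_omega w)"


section \<open>Chromatic symmetric functions\<close>

text \<open>
  A graph is given by its vertex set \<open>V\<close> and a set \<open>E\<close> of two-element subsets of \<open>V\<close>.
  Colors are variable indices. Colorings are extensional, so that maps on \<open>V\<close> are
  counted once.
\<close>

definition proper_colorings :: "'v set \<Rightarrow> 'v set set \<Rightarrow> ('v \<Rightarrow> nat) set"
  where "proper_colorings V E =
    {\<kappa> \<in> V \<rightarrow>\<^sub>E UNIV. \<forall>u\<in>V. \<forall>v\<in>V. {u, v} \<in> E \<longrightarrow> \<kappa> u \<noteq> \<kappa> v}"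

definition chromatic_sf :: "'v set \<Rightarrow> 'v set set \<Rightarrow> 'a::comm_ring_1 mfps"
  where "chromatic_sf V E =
    monomial_sum (proper_colorings V E) (\<lambda>\<kappa>. image_mset \<kappa> (mset_set V))"


section \<open>Hessenberg functions\<close>

text \<open>Only the values of \<open>f\<close> on \<open>{1..n}\<close> matter.\<close>

definition hessenberg :: "nat \<Rightarrow> (nat \<Rightarrow> nat) \<Rightarrow> bool"
  where "hessenberg n f \<longleftrightarrow>
    f \<in> {1..n} \<rightarrow> {1..n} \<and> mono_on {1..n} f \<and> (\<forall>i\<in>{1..n}. i \<le> f i)"

definition hess_less :: "nat \<Rightarrow> (nat \<Rightarrow> nat) \<Rightarrow> nat \<Rightarrow> nat \<Rightarrow> bool"
  where "hess_less n f i j \<longleftrightarrow> i \<in> {1..n} \<and> j \<in> {1..n} \<and> f i < j"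

text \<open>\<^const>\<open>pred_on.chain\<close> compares elements with the reflexive closure of the given relation.\<close>

definition longest_chain :: "nat \<Rightarrow> (nat \<Rightarrow> nat) \<Rightarrow> nat"
  where "longest_chain n f = Max (card ` {C. pred_on.chain {1..n} (hess_less n f) C})"

definition hess_edges :: "nat \<Rightarrow> (nat \<Rightarrow> nat) \<Rightarrow> nat set set"
  where "hess_edges n f = {{i, j} |i j. i \<in> {1..n} \<and> j \<in> {1..n} \<and> i < j \<and> j \<le> f i}"

end

theory Submission
  imports Defs "HOL-Combinatorics.Transposition" "HOL-Library.Infinite_Set"
    "HOL-Computational_Algebra.Polynomial"
begin

text \<open>
  Order the vertices \<open>0, \<dots>, n - 1\<close>, so that vertex \<open>j\<close> is adjacent to a final segment
  \<open>r j, \<dots>, j - 1\<close> of its predecessors, which is a clique. Following Hikita, let every vertex in turn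
  choose a column \<open>c j\<close>, at random, such that the distribution depends only on the set of columns
  chosen by its earlier neighbors; for a set \<open>C\<close> the probability of \<open>q\<close> is the residue at \<open>z = q\<close> of
  \<open>1 / z * \<Prod>\<^bsub>c\<in>C\<^esub> (z - c) / (z - c - 1)\<close>, which is nonnegative. The numbers of vertices in the
  columns form a partition, whose conjugate we call \<open>\<lambda>\<close>, and
  \<open>X\<^sub>G = \<Sum>\<^sub>c Pr(c) (\<Prod>\<^sub>i \<lambda>\<^sub>i!) e\<^sub>\<lambda>\<close>. Since \<open>(\<Prod>\<^sub>i \<lambda>\<^sub>i!) e\<^sub>\<lambda> = \<Prod>\<^sub>j a (c j)\<close> with
  \<open>a k = (k + 1) e\<^bsub>k+1\<^esub> / e\<^sub>k\<close>, both sides are built up vertex by vertex by two kinds of linear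
  operators: adding a vertex, and deactivating the earliest vertex that is still relevant for later
  ones. On the side of colorings, these act on functions of the colors of the active vertices, which
  are spanned by monomials; the operators satisfy simple commutation relations with each other and
  with the symmetric group permuting the active vertices. On the side of columns, the same relations
  hold when the symmetric group acts by the operators of a degenerate affine Hecke algebra. The
  relations determine the result, so both sides agree.

  The coefficients of the expansion are nonnegative rationals by construction, and they are integers
  because the elementary symmetric functions form a basis over the integers.
\<close>

section \<open>Transition probabilities of columns\<close>

text \<open>Plain permutations cannot exchange two vertices on the column side: the orders
  \<open>p, q\<close> and \<open>q, p\<close> of two successive choices usually have different
  probabilities. With w = q - p, the two probabilities stand in the ratio of 1 + 1/w to 1 - 1/w, and
  the coefficients 1/w and 1 - 1/w of \<open>hecke_op\<close> compensate exactly for this. The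
  formulas need distinct active columns, which holds because an occupied neighboring column gets
  probability 0. Adding and dropping do not commute. On colors, their commutator isolates the event
  that the new vertex takes the color just deactivated, so adding together with this commutator
  produces every monomial. What remains is the effect of dropping, and the relations reduce it to a
  single active vertex, where it yields a power sum. The weights divide by e_k, so the two sides are
  compared at positive rational points of a finite alphabet with at least n variables, not inside
  the ring of power series.\<close>

definition trans_prob :: "nat set \<Rightarrow> nat \<Rightarrow> rat" where
  "trans_prob A q = (case q of 0 \<Rightarrow> \<Prod>c\<in>A. of_nat c / (of_nat c + 1)
    | Suc d \<Rightarrow> if d \<in> A
        then 1 / (of_nat d + 1) * (\<Prod>c\<in>A - {d}. (of_nat d + 1 - of_nat c) / (of_nat d - of_nat c))
        else 0)"

text \<open>The value at z = q of the rational function whose residues are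
  \<open>trans_prob\<close>; it is meant for a q that is not a pole. If a new element x creates a
  pole at x + 1, this value is the residue there, since the numerator z - x equals 1.\<close>

definition trans_gen :: "nat set \<Rightarrow> nat \<Rightarrow> rat" where
  "trans_gen A q = 1 / of_nat q * (\<Prod>c\<in>A. (of_nat q - of_nat c) / (of_nat q - of_nat c - 1))"

text \<open>The candidate poles: z = 0 and the zeros of the denominators z - c - 1.\<close>

definition next_cols :: "nat set \<Rightarrow> nat set" where
  "next_cols A = insert 0 (Suc ` A)"

lemma finite_next_cols [simp]: "finite A \<Longrightarrow> finite (next_cols A)"
  by (simp add: next_cols_def)

lemma next_cols_mono: "A \<subseteq> B \<Longrightarrow> next_cols A \<subseteq> next_cols B"
  by (auto simp: next_cols_def)

lemma trans_prob_outside: "q \<notin> next_cols A \<Longrightarrow> trans_prob A q = 0"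
  by (cases q) (auto simp: next_cols_def trans_prob_def)

text \<open>For q in A the numerator z - q cancels the pole at q. Hence a vertex never chooses the
  column of an active neighbor.\<close>

lemma trans_prob_mem: "finite A \<Longrightarrow> q \<in> A \<Longrightarrow> trans_prob A q = 0"
  by (cases q) (auto simp: trans_prob_def intro!: bexI[of _ q])

text \<open>No integer c lies strictly between d and d + 1, so d + 1 - c and d - c never have
  opposite signs.\<close>

lemma trans_prob_nonneg: "trans_prob A q \<ge> 0"
proof -
  have "(of_nat d + 1 - of_nat c) / (of_nat d - of_nat c :: rat) \<ge> 0" for c d :: nat
  proof (cases "c \<le> d")
    case True
    then show ?thesis by simp
  next
    case False
    then have "(of_nat d + 1 :: rat) \<le> of_nat c" by (metis Suc_leI not_le of_nat_Suc of_nat_le_iff add.commute)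
    then show ?thesis by (intro divide_nonpos_nonpos) auto
  qed
  then have "(\<Prod>c\<in>A - {d}. (of_nat d + 1 - of_nat c) / (of_nat d - of_nat c) :: rat) \<ge> 0" for d
    by (intro prod_nonneg) blast
  then show ?thesis
    by (cases q) (auto simp: trans_prob_def intro!: prod_nonneg)
qed

text \<open>A factor that is regular at q multiplies the residue by its value there; the excluded q
  = x + 1 is the pole of the new factor.\<close>

lemma trans_prob_insert:
  assumes "finite A" "x \<notin> A" "q \<noteq> Suc x"
  shows "trans_prob (insert x A) q =
    trans_prob A q * ((of_nat q - of_nat x) / (of_nat q - of_nat x - 1))"
proof (cases q)
  case 0
  have "of_nat x / (of_nat x + 1 :: rat) = (- of_nat x) / (- (of_nat x + 1))"
    by (simp only: minus_divide_divide)
  then have "of_nat x / (of_nat x + 1 :: rat) = (- of_nat x) / (- of_nat x - 1)"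
    by simp
  with 0 assms show ?thesis by (simp add: trans_prob_def)
next
  case (Suc d)
  with assms have "d \<noteq> x" by simp
  then have "insert x A - {d} = insert x (A - {d})" by auto
  with assms Suc \<open>d \<noteq> x\<close> show ?thesis by (simp add: trans_prob_def add.commute)
qed

lemma trans_prob_insert_Suc:
  "finite A \<Longrightarrow> x \<notin> A \<Longrightarrow> trans_prob (insert x A) (Suc x) = trans_gen A (Suc x)"
  by (simp add: trans_prob_def trans_gen_def add.commute)

lemma trans_gen_insert:
  "finite A \<Longrightarrow> x \<notin> A \<Longrightarrow>
    trans_gen (insert x A) q = trans_gen A q * ((of_nat q - of_nat x) / (of_nat q - of_nat x - 1))"
  by (simp add: trans_gen_def)

lemma trans_prob_Suc_outside: "x \<notin> A \<Longrightarrow> trans_prob A (Suc x) = 0"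
  by (simp add: trans_prob_def)

lemma of_nat_eq_add_1_iff: "of_nat a = (of_nat b + 1 :: rat) \<longleftrightarrow> a = Suc b"
  by (metis of_nat_Suc of_nat_eq_iff add.commute)

text \<open>Inserting p contributes w/(w - 1) and inserting q contributes w/(w + 1), and the
  prefactors turn both into 1. For adjacent columns one side has prefactor 0 and the other has
  probability 0. This is the symmetry behind adding two vertices in succession.\<close>

lemma trans_prob_exchange:
  assumes "finite A" "p \<noteq> q"
  defines "w \<equiv> (of_nat q - of_nat p :: rat)"
  shows "(1 - 1 / w) * (trans_prob A p * trans_prob (insert p A) q) =
    (1 + 1 / w) * (trans_prob A q * trans_prob (insert q A) p)"
proof (cases "p \<in> A \<or> q \<in> A")
  case True
  then show ?thesis using assms(1) by (auto simp: trans_prob_mem)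
next
  case False
  then have A: "p \<notin> A" "q \<notin> A" by auto
  have w: "w \<noteq> 0" using assms(2) by (simp add: w_def)
  consider "q = Suc p" | "p = Suc q" | "q \<noteq> Suc p" "p \<noteq> Suc q" by blast
  then show ?thesis
  proof cases
    case 1
    with A have "trans_prob A q = 0" by (simp add: trans_prob_Suc_outside)
    with 1 show ?thesis by (simp add: w_def)
  next
    case 2
    with A have "trans_prob A p = 0" by (simp add: trans_prob_Suc_outside)
    with 2 show ?thesis by (simp add: w_def)
  next
    case 3
    have w1: "w - 1 \<noteq> 0" "w + 1 \<noteq> 0"
      using 3 of_nat_eq_add_1_iff[of q p] of_nat_eq_add_1_iff[of p q] by (auto simp: w_def algebra_simps)
    have e: "of_nat p - of_nat q = - w" by (simp add: w_def)
    have "trans_prob (insert p A) q = trans_prob A q * (w / (w - 1))"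
      "trans_prob (insert q A) p = trans_prob A p * (- w / (- w - 1))"
      using trans_prob_insert[of A p q] trans_prob_insert[of A q p] assms(1) A 3
      by (simp_all add: e flip: w_def)
    note eqs = this
    have "(1 - 1 / w) * (w / (w - 1)) = (1 + 1 / w) * (- w / (- w - 1))"
    proof -
      have "- w / (- w - 1) = w / (w + 1)" using minus_divide_divide[of w "w + 1"] by simp
      then show ?thesis using w w1 by (simp add: divide_simps)
    qed
    then have "trans_prob A p * trans_prob A q * ((1 - 1 / w) * (w / (w - 1))) =
      trans_prob A p * trans_prob A q * ((1 + 1 / w) * (- w / (- w - 1)))"
      by (simp only:)
    then show ?thesis unfolding eqs by (simp only: mult_ac)
  qed
qed

text \<open>The generic case of the modular law below, with u = p - c and w = q - p, after the
  common factors \<open>trans_prob A p\<close> and \<open>trans_prob A q\<close> are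
  removed.\<close>

lemma modular_identity:
  fixes u w :: rat
  assumes "w \<noteq> 0" "w - 1 \<noteq> 0" "w + 1 \<noteq> 0" "u - 1 \<noteq> 0" "w + u - 1 \<noteq> 0"
  shows "(1 + 1 / w) * (u / (u - 1) * (w / (w - 1)) + (w + u) / (w + u - 1) * (w / (w + 1))) =
    w / (w - 1) + u / (u - 1) * ((w + u) / (w + u - 1) * (w / (w - 1)))"
proof -
  define a b c where "a = u - 1" and "b = w - 1" and "c = w + u - 1"
  have w: "1 + 1 / w = (w + 1) / w" using assms by (simp add: divide_simps)
  have "(1 + 1 / w) * (u / a * (w / b) + (w + u) / c * (w / (w + 1))) =
      (w + 1) * u / (a * b) + (w + u) / c"
    unfolding w using assms by (simp add: divide_simps) (simp add: algebra_simps)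
  also have "\<dots> = ((w + 1) * u * c + (w + u) * a * b) / (a * b * c)"
    using assms unfolding a_def b_def c_def by (simp add: divide_simps)
  also have "(w + 1) * u * c + (w + u) * a * b = w * (a * c + u * (w + u))"
    unfolding a_def b_def c_def by (simp add: algebra_simps)
  also have "w * (a * c + u * (w + u)) / (a * b * c) = w / b + u / a * ((w + u) / c * (w / b))"
    using assms unfolding a_def b_def c_def by (simp add: divide_simps) (simp add: algebra_simps)
  finally show ?thesis unfolding a_def b_def c_def .
qed

text \<open>
  This identity is the modular law \<open>2 X\<^sub>1 = X\<^sub>0 + X\<^sub>2\<close> of chromatic symmetric functions,
  expressed for a single column.
\<close>

lemma trans_prob_modular:
  assumes "finite A" "c \<notin> A" "p \<noteq> q"
  defines "w \<equiv> (of_nat q - of_nat p :: rat)" and "\<phi> \<equiv> trans_prob"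
  shows "(1 + 1 / w) * (\<phi> (insert c A) p * \<phi> (insert p A) q + \<phi> (insert c A) q * \<phi> (insert q A) p) =
    \<phi> A p * \<phi> (insert p A) q + \<phi> (insert c A) p * \<phi> (insert p (insert c A)) q"
proof (cases "p \<in> A \<or> q \<in> A")
  case True
  then show ?thesis using assms(1) by (auto simp: trans_prob_mem \<phi>_def)
next
  case False
  then have A: "p \<notin> A" "q \<notin> A" by auto
  define P Q where "P = \<phi> A p" and "Q = \<phi> A q"
  define u where "u = (of_nat p - of_nat c :: rat)"
  have wu: "of_nat q - of_nat c = w + u" "of_nat p - of_nat q = - w"
    "of_nat q - of_nat p = w"
    by (simp_all add: w_def u_def)
  note defs = \<phi>_def P_def Q_def
  have w: "w \<noteq> 0" using assms(3) by (simp add: w_def)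
  have w1: "w = 1 \<longleftrightarrow> q = Suc p" "w = -1 \<longleftrightarrow> p = Suc q" "u = 1 \<longleftrightarrow> p = Suc c" "u = 0 \<longleftrightarrow> p = c"
    "w + u = 1 \<longleftrightarrow> q = Suc c"
    unfolding w_def u_def of_nat_eq_add_1_iff[symmetric] of_nat_eq_iff[symmetric, where ?'a = rat]
    by linarith+
  have s1: "(1 + 1 / w) * (w / (w + 1)) = 1" if "p \<noteq> Suc q"
  proof -
    from that w1 have "w \<noteq> -1" by simp
    then have "w + 1 \<noteq> 0" by linarith
    with w show ?thesis by (simp add: divide_simps)
  qed
  have i1: "\<phi> (insert q A) p = P * (w / (w + 1))" if "p \<noteq> Suc q"
  proof -
    have "\<phi> (insert q A) p = P * ((- w) / (- (w + 1)))"
      using trans_prob_insert[of A q p] assms(1-3) A that by (simp add: defs wu)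
    then show ?thesis by (simp only: minus_divide_divide)
  qed
  have i2: "\<phi> (insert p A) q = Q * (w / (w - 1))" if "q \<noteq> Suc p"
    using trans_prob_insert[of A p q] assms(1-3) A that by (simp add: defs wu)
  have i3: "\<phi> (insert c A) p = P * (u / (u - 1))" if "p \<noteq> Suc c"
    using trans_prob_insert[of A c p] assms(1-3) that by (simp add: defs u_def)
  have i4: "\<phi> (insert c A) q = Q * ((w + u) / (w + u - 1))" if "q \<noteq> Suc c"
    using trans_prob_insert[of A c q] assms(1-3) that by (simp add: defs wu(1))
  have i5: "\<phi> (insert p (insert c A)) q = \<phi> (insert c A) q * (w / (w - 1))" if "q \<noteq> Suc p" "p \<noteq> c"
    using trans_prob_insert[of "insert c A" p q] assms(1-3) A that by (simp add: defs wu)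
  show ?thesis
  \<comment> \<open>The insertion formulas fail where one column is the successor of another,
    because a pole appears or a residue vanishes. These coincidences, and p = c, are treated one by
    one; only the last case is \<open>modular_identity\<close>.\<close>
  proof (cases "p = Suc q")
    case True
    then have "w = -1" using w1 by simp
    moreover have "\<phi> A p = 0" using A True by (simp add: \<phi>_def trans_prob_Suc_outside)
    moreover have "\<phi> (insert c A) p * \<phi> (insert p (insert c A)) q = 0"
    proof (cases "q = c")
      case True
      then show ?thesis using assms(1-3) by (simp add: \<phi>_def trans_prob_mem)
    next
      case False
      then have "\<phi> (insert c A) p = 0" using A True by (simp add: \<phi>_def trans_prob_Suc_outside)
      then show ?thesis by simp
    qed
    ultimately show ?thesis by simp
  next
    case pq: False
    note s1 = s1[OF pq] and i1 = i1[OF pq]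
    have s1': "(1 + 1 / w) * (X * (Y * (w / (w + 1)))) = Y * X" for X Y
    proof -
      have "(1 + 1 / w) * (X * (Y * (w / (w + 1)))) = ((1 + 1 / w) * (w / (w + 1))) * (Y * X)"
        by (simp only: mult_ac)
      then show ?thesis by (simp only: s1 mult_1)
    qed
    show ?thesis
    proof (cases "p = c")
      case True
      have c0: "\<phi> (insert c A) p = 0" using True assms(1-3) by (simp add: \<phi>_def trans_prob_mem)
      have "\<phi> (insert c A) q = \<phi> (insert p A) q" by (simp add: True)
      then show ?thesis unfolding c0 i1 by (simp only: s1' mult_zero_left add_0_left add_0_right P_def)
    next
      case pc: False
      show ?thesis
      proof (cases "p = Suc c")
        case True
        have u: "u = 1" using w1 True by simp
        have P: "\<phi> A p = 0" using assms(1-3) True by (simp add: \<phi>_def trans_prob_Suc_outside)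
        have z: "\<phi> (insert q A) p = 0" using i1 P by (simp add: P_def)
        have qc: "q \<noteq> Suc c" using True assms(1-3) by auto
        show ?thesis
        proof (cases "q = Suc p")
          case True2: True
          \<comment> \<open>Here q = c + 2, so the factor of c at z = q is 2/1; it matches 1 + 1/w =
            2.\<close>
          have "\<phi> (insert p A) q = trans_gen A q" "\<phi> (insert p (insert c A)) q = 2 * trans_gen A q" "w = 1"
            using assms(1-3) A True True2 pc w1
            by (simp_all add: \<phi>_def trans_prob_insert_Suc trans_gen_insert)
          then show ?thesis using P z by simp
        next
          case False
          have w': "w - 1 \<noteq> 0" using w1 False by simp
          have s: "1 + 1 / w = (w + 1) / w" using w by (simp add: divide_simps)
          have "\<phi> (insert p (insert c A)) q = Q * ((w + 1) / w) * (w / (w - 1))"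
            unfolding i5[OF False pc] i4[OF qc] u by simp
          then show ?thesis unfolding P z i2[OF False] s by simp
        qed
      next
        case False
        have u1: "u - 1 \<noteq> 0" "u \<noteq> 0" using w1 False pc by auto
        show ?thesis
        proof (cases "q = Suc c")
          case True
          then have wu': "u = 1 - w" using w1 by linarith
          have "\<phi> (insert p A) q = 0" and g: "\<phi> (insert c A) q = trans_gen A q"
            using trans_prob_insert[of A p q] assms(1-3) A True pc
            by (simp_all add: \<phi>_def trans_prob_insert_Suc trans_prob_Suc_outside)
          moreover have "\<phi> (insert p (insert c A)) q = trans_gen A q * (w / (w - 1))"
            using trans_prob_insert_Suc[of "insert p A" c] trans_gen_insert[of A p q] assms(1-3) A True pc
            by (simp add: \<phi>_def insert_commute w_def)
          moreover have "u / (u - 1) * (w / (w - 1)) = 1"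
            using w u1 unfolding wu' by (simp add: divide_simps)
          then have "P * trans_gen A q * (u / (u - 1) * (w / (w - 1))) = P * trans_gen A q"
            by (simp only: mult_1_right)
          then have "P * (u / (u - 1)) * (trans_gen A q * (w / (w - 1))) = P * trans_gen A q"
            by (simp only: mult_ac)
          ultimately show ?thesis unfolding i1 i3[OF False] by (simp only: s1' mult_zero_right add_0_left)
        next
          case qc: False
          have wu1: "w + u - 1 \<noteq> 0" using w1 qc by simp
          show ?thesis
          proof (cases "q = Suc p")
            case True
            have eqs: "\<phi> (insert p A) q = trans_gen A q"
              "\<phi> (insert p (insert c A)) q = trans_gen A q * ((w + u) / (w + u - 1))"
              "\<phi> (insert c A) q = 0"
              using assms(1-3) A True pc qc
              by (simp_all add: \<phi>_def trans_prob_insert_Suc trans_gen_insert trans_prob_Suc_outside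
                  flip: wu(1))
            have w: "w = 1" using w1 True by simp
            define \<alpha> \<beta> where "\<alpha> = u / (u - 1)" and "\<beta> = (1 + u) / (1 + u - 1)"
            have "2 * \<alpha> = 1 + \<alpha> * \<beta>"
              using u1 unfolding \<alpha>_def \<beta>_def by (simp add: divide_simps)
            then have "2 * \<alpha> * (P * trans_gen A q) = (1 + \<alpha> * \<beta>) * (P * trans_gen A q)"
              by (simp only:)
            then show ?thesis
              unfolding eqs i3[OF False] w P_def[symmetric] \<alpha>_def[symmetric] \<beta>_def[symmetric]
              by (simp add: algebra_simps)
          next
            case q: False
            have "w \<noteq> 1" "w \<noteq> -1" using w1 q pq by simp_all
            then have "w - 1 \<noteq> 0" "w + 1 \<noteq> 0" by linarith+
            note modular_identity[OF w this u1(1) wu1]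
            moreover have "k * (P * a * (Q * b) + Q * c * (P * d)) = P * (Q * b) + P * a * (Q * c * b)"
              if "k * (a * b + c * d) = b + a * (c * b)" for k a b c d
            proof -
              have "k * (P * a * (Q * b) + Q * c * (P * d)) = P * Q * (k * (a * b + c * d))"
                by (simp add: algebra_simps)
              then show ?thesis unfolding that by (simp add: algebra_simps)
            qed
            ultimately show ?thesis
              unfolding i1 i2[OF q] i3[OF False] i5[OF q pc] i4[OF qc] P_def[symmetric] Q_def[symmetric]
              by blast
          qed
        qed
      qed
    qed
  qed
qed

text \<open>In the generic case this is the partial fraction 1/(k b) = (1/u)(1/k - 1/b) with k = p -
  d - 1, b = p - c - 1 and b - k = u. It lets a deactivation pass a rotation.\<close>

lemma trans_prob_two:
  assumes "finite A" "c \<notin> A" "d \<notin> A" "c \<noteq> d"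
  defines "u \<equiv> (of_nat d - of_nat c :: rat)" and "\<phi> \<equiv> trans_prob"
  shows "\<phi> (insert d A) p - \<phi> (insert c (insert d A)) p =
    1 / u * (\<phi> A p - \<phi> (insert d A) p) + (1 - 1 / u) * (\<phi> A p - \<phi> (insert c A) p)"
proof -
  have u: "u \<noteq> 0" using assms by (simp add: u_def)
  have ed: "of_nat d = of_nat c + u" by (simp add: u_def)
  consider "p = Suc c" | "p = Suc d" | "p \<noteq> Suc c" "p \<noteq> Suc d" by blast
  then show ?thesis
  proof cases
    case 1
    have "\<phi> (insert d A) p = 0" "\<phi> A p = 0" "\<phi> (insert c A) p = trans_gen A p"
      "\<phi> (insert c (insert d A)) p = trans_gen A p * ((1 - u) / (- u))"
      using assms 1 by (simp_all add: trans_prob_insert_Suc trans_prob_Suc_outside trans_gen_insert)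
    then show ?thesis using u by (simp add: divide_simps) (simp add: algebra_simps)
  next
    case 2
    have "\<phi> (insert c A) p = 0" "\<phi> A p = 0" "\<phi> (insert d A) p = trans_gen A p"
      using assms 2 by (simp_all add: trans_prob_insert_Suc trans_prob_Suc_outside)
    moreover have "\<phi> (insert c (insert d A)) p = trans_gen A p * ((u + 1) / u)"
      using assms 2 trans_prob_insert_Suc[of "insert c A" d] trans_gen_insert[of A c p]
      by (simp add: insert_commute ed algebra_simps)
    ultimately show ?thesis using u by (simp add: divide_simps) (simp add: algebra_simps)
  next
    case 3
    define v where "v = (of_nat p - of_nat c :: rat)"
    have ep: "of_nat p = of_nat c + v" by (simp add: v_def)
    have v: "v \<noteq> 1" "v \<noteq> u + 1" using 3 of_nat_eq_add_1_iff[of p c] of_nat_eq_add_1_iff[of p d]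
      by (auto simp: v_def u_def algebra_simps)
    have eqs: "\<phi> (insert d A) p = \<phi> A p * ((v - u) / (v - u - 1))"
      "\<phi> (insert c A) p = \<phi> A p * (v / (v - 1))"
      "\<phi> (insert c (insert d A)) p = \<phi> A p * ((v - u) / (v - u - 1)) * (v / (v - 1))"
      using assms 3 by (simp_all add: trans_prob_insert ed ep algebra_simps)
    define k b where "k = v - u - 1" and "b = v - 1"
    have kb: "k \<noteq> 0" "b \<noteq> 0" "v - u = k + 1" "v = b + 1" "b = k + u"
      using v by (auto simp: k_def b_def)
    have "(k + 1) / k - (k + 1) / k * ((b + 1) / b) = 1 / u * (1 - (k + 1) / k) + (1 - 1 / u) * (1 - (b + 1) / b)"
    proof -
      have 1: "1 - (k + 1) / k = - 1 / k" "1 - (b + 1) / b = - 1 / b"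
        using kb by (simp_all add: divide_simps)
      have "(k + 1) / k - (k + 1) / k * ((b + 1) / b) = (k + 1) / k * (1 - (b + 1) / b)"
        by (simp only: right_diff_distrib mult_1_right)
      also have "\<dots> = 1 / u * (- 1 / k) + (1 - 1 / u) * (- 1 / b)"
        unfolding 1 using kb(1,2) u by (simp add: divide_simps) (simp add: kb(5) algebra_simps)
      finally show ?thesis unfolding 1 .
    qed
    then have "(v - u) / (v - u - 1) - (v - u) / (v - u - 1) * (v / (v - 1)) =
      1 / u * (1 - (v - u) / (v - u - 1)) + (1 - 1 / u) * (1 - v / (v - 1))"
      unfolding k_def[symmetric] b_def[symmetric] unfolding kb(3) unfolding kb(4) .
    then have "\<phi> A p * ((v - u) / (v - u - 1) - (v - u) / (v - u - 1) * (v / (v - 1))) =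
      \<phi> A p * (1 / u * (1 - (v - u) / (v - u - 1)) + (1 - 1 / u) * (1 - v / (v - 1)))"
      by simp
    then show ?thesis unfolding eqs by (simp only: algebra_simps)
  qed
qed

section \<open>Operators on functions of column sequences\<close>

definition add_op :: "(nat list \<Rightarrow> rat) \<Rightarrow> nat list \<Rightarrow> rat" where
  "add_op F cs = (\<Sum>q\<in>next_cols (set cs). trans_prob (set cs) q * F (cs @ [q]))"

text \<open>The column side pays the weight of a vertex when the vertex is deactivated, whereas the
  color side pays its variable when the vertex is added.\<close>

definition drop_op :: "(nat \<Rightarrow> rat) \<Rightarrow> (nat list \<Rightarrow> rat) \<Rightarrow> nat list \<Rightarrow> rat" where
  "drop_op a F cs = a (hd cs) * F (tl cs)"

text \<open>The arguments are test functions, so the outer operator acts first on states: this is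
  "drop, then add" minus "add, then drop". On colors the difference keeps the case where the new
  vertex reuses the dropped color, so the first exponent moves to the end and grows by one.\<close>

definition rot_op :: "(nat \<Rightarrow> rat) \<Rightarrow> (nat list \<Rightarrow> rat) \<Rightarrow> nat list \<Rightarrow> rat" where
  "rot_op a F cs = drop_op a (add_op F) cs - add_op (drop_op a F) cs"

definition swap_at :: "nat \<Rightarrow> 'a list \<Rightarrow> 'a list" where
  "swap_at i xs = xs[i := xs ! Suc i, Suc i := xs ! i]"

definition col_diff :: "nat list \<Rightarrow> nat \<Rightarrow> rat" where
  "col_diff cs i = of_nat (cs ! Suc i) - of_nat (cs ! i)"

text \<open>Only distinct columns matter below; for equal ones the divisor is \<open>0\<close>.\<close>

definition hecke_op :: "nat \<Rightarrow> (nat list \<Rightarrow> rat) \<Rightarrow> nat list \<Rightarrow> rat" where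
  "hecke_op i F cs = F cs / col_diff cs i + (1 - 1 / col_diff cs i) * F (swap_at i cs)"

lemma length_swap_at [simp]: "length (swap_at i xs) = length xs"
  by (simp add: swap_at_def)

lemma swap_at_append: "Suc i < length xs \<Longrightarrow> swap_at i (xs @ ys) = swap_at i xs @ ys"
  by (simp add: swap_at_def nth_append list_update_append)

lemma swap_at_Cons: "swap_at (Suc i) (x # xs) = x # swap_at i xs"
  by (simp add: swap_at_def)

lemma swap_at_last: "swap_at (length xs) (xs @ [p, q]) = xs @ [q, p]"
  by (simp add: swap_at_def nth_append list_update_append)

lemma swap_at_first: "swap_at 0 (p # q # xs) = q # p # xs"
  by (simp add: swap_at_def)

lemma mset_swap_at [simp]: "Suc i < length xs \<Longrightarrow> mset (swap_at i xs) = mset xs"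
  by (simp add: swap_at_def mset_swap)

lemma set_swap_at [simp]: "Suc i < length xs \<Longrightarrow> set (swap_at i xs) = set xs"
  by (metis mset_swap_at set_mset_mset)

lemma distinct_swap_at [simp]: "Suc i < length xs \<Longrightarrow> distinct (swap_at i xs) = distinct xs"
  by (metis mset_eq_imp_distinct_iff mset_swap_at)

lemma swap_at_swap_at [simp]: "Suc i < length xs \<Longrightarrow> swap_at i (swap_at i xs) = xs"
  by (intro nth_equalityI) (auto simp: swap_at_def nth_list_update)

lemma col_diff_swap_at: "Suc i < length cs \<Longrightarrow> col_diff (swap_at i cs) i = - col_diff cs i"
  by (simp add: swap_at_def col_diff_def)

lemma col_diff_append: "Suc i < length cs \<Longrightarrow> col_diff (cs @ ds) i = col_diff cs i"
  by (simp add: col_diff_def nth_append)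

lemma col_diff_Cons: "col_diff (c # cs) (Suc i) = col_diff cs i"
  by (simp add: col_diff_def)

lemma col_diff_last: "col_diff (cs @ [p, q]) (length cs) = of_nat q - of_nat p"
  by (simp add: col_diff_def nth_append)

lemma col_diff_first: "col_diff (p # q # cs) 0 = of_nat q - of_nat p"
  by (simp add: col_diff_def)

text \<open>The swap negates w, and (1/w)^2 + (1 - 1/w)(1 + 1/w) = 1 while the mixed terms
  cancel.\<close>

lemma hecke_op_involution:
  assumes "Suc i < length cs" "distinct cs"
  shows "hecke_op i (hecke_op i F) cs = F cs"
proof -
  define w where "w = col_diff cs i"
  have "w \<noteq> 0" using assms by (simp add: w_def col_diff_def nth_eq_iff_index_eq)
  then show ?thesis using assms(1)
    by (simp add: hecke_op_def col_diff_swap_at flip: w_def) (simp add: field_simps)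
qed

lemma add_op_eq:
  assumes "finite S" "next_cols (set cs) \<subseteq> S"
  shows "add_op F cs = (\<Sum>q\<in>S. trans_prob (set cs) q * F (cs @ [q]))"
  unfolding add_op_def using assms
  by (intro sum.mono_neutral_left) (auto simp: trans_prob_outside)

text \<open>A repeated column has probability 0, so values on lists with repetitions are never seen.
  Relations valid only for distinct columns can therefore be used under the operators.\<close>

lemma add_op_cong:
  assumes "distinct cs" "\<And>ds. distinct ds \<Longrightarrow> length ds = Suc (length cs) \<Longrightarrow> F ds = G ds"
  shows "add_op F cs = add_op G cs"
  unfolding add_op_def
proof (intro sum.cong refl)
  fix q
  show "trans_prob (set cs) q * F (cs @ [q]) = trans_prob (set cs) q * G (cs @ [q])"
    using assms by (cases "q \<in> set cs") (auto simp: trans_prob_mem)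
qed

lemma drop_op_cong:
  assumes "distinct cs" "cs \<noteq> []"
    "\<And>ds. distinct ds \<Longrightarrow> length ds = length cs - 1 \<Longrightarrow> F ds = G ds"
  shows "drop_op a F cs = drop_op a G cs"
  using assms by (simp add: drop_op_def distinct_tl)

lemma rot_op_cong:
  assumes "distinct cs" "cs \<noteq> []"
    "\<And>ds. distinct ds \<Longrightarrow> length ds = length cs \<Longrightarrow> F ds = G ds"
  shows "rot_op a F cs = rot_op a G cs"
proof -
  have "drop_op a (add_op F) cs = drop_op a (add_op G) cs"
    using assms by (intro drop_op_cong add_op_cong) auto
  moreover have "add_op (drop_op a F) cs = add_op (drop_op a G) cs"
    using assms by (intro add_op_cong drop_op_cong) auto
  ultimately show ?thesis by (simp add: rot_op_def)
qed

lemma hecke_op_cong: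
  assumes "distinct cs" "Suc i < length cs"
    "\<And>ds. distinct ds \<Longrightarrow> length ds = length cs \<Longrightarrow> F ds = G ds"
  shows "hecke_op i F cs = hecke_op i G cs"
  using assms by (simp add: hecke_op_def)

lemma add_op_linear:
  "add_op (\<lambda>cs. x * F cs + y * G cs) cs = x * add_op F cs + y * add_op G cs"
  by (simp add: add_op_def sum.distrib sum_distrib_left algebra_simps)

lemma drop_op_linear:
  "drop_op a (\<lambda>cs. x * F cs + y * G cs) cs = x * drop_op a F cs + y * drop_op a G cs"
  by (simp add: drop_op_def algebra_simps)

lemma rot_op_linear:
  "rot_op a (\<lambda>cs. x * F cs + y * G cs) = (\<lambda>cs. x * rot_op a F cs + y * rot_op a G cs)"
proof
  fix cs
  have 1: "add_op (\<lambda>cs. x * F cs + y * G cs) = (\<lambda>cs. x * add_op F cs + y * add_op G cs)"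
    and 2: "drop_op a (\<lambda>cs. x * F cs + y * G cs) = (\<lambda>cs. x * drop_op a F cs + y * drop_op a G cs)"
    for F G
    by (rule ext add_op_linear drop_op_linear)+
  show "rot_op a (\<lambda>cs. x * F cs + y * G cs) cs = x * rot_op a F cs + y * rot_op a G cs"
    unfolding rot_op_def 1 2 by (simp add: algebra_simps)
qed

text \<open>The distribution of the new column depends only on the set of active columns, which a
  swap preserves.\<close>

lemma add_op_hecke_op:
  assumes "Suc i < length cs" "distinct cs"
  shows "add_op (hecke_op i F) cs = hecke_op i (add_op F) cs"
  unfolding hecke_op_def add_op_def using assms
  by (simp add: col_diff_append swap_at_append sum.distrib sum_subtractf sum_distrib_left sum_divide_distrib algebra_simps)

lemma drop_op_hecke_op:
  assumes "Suc (Suc i) < length cs"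
  shows "drop_op a (hecke_op i F) cs = hecke_op (Suc i) (drop_op a F) cs"
  using assms by (cases cs) (auto simp: drop_op_def hecke_op_def col_diff_Cons swap_at_Cons algebra_simps)

lemma rot_op_hecke_op:
  assumes "Suc (Suc i) < length cs" "distinct cs"
  shows "rot_op a (hecke_op i F) cs = hecke_op (Suc i) (rot_op a F) cs"
proof -
  have "drop_op a (add_op (hecke_op i F)) cs = drop_op a (hecke_op i (add_op F)) cs"
    using assms by (intro drop_op_cong add_op_hecke_op) auto
  also have "\<dots> = hecke_op (Suc i) (drop_op a (add_op F)) cs"
    using assms by (intro drop_op_hecke_op)
  finally have 1: "drop_op a (add_op (hecke_op i F)) cs = \<dots>" .
  have "add_op (drop_op a (hecke_op i F)) cs = add_op (hecke_op (Suc i) (drop_op a F)) cs"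
    using assms by (intro add_op_cong drop_op_hecke_op) auto
  also have "\<dots> = hecke_op (Suc i) (add_op (drop_op a F)) cs"
    using assms by (intro add_op_hecke_op)
  finally show ?thesis using 1 by (simp add: rot_op_def hecke_op_def diff_divide_distrib algebra_simps)
qed

text \<open>Transposing the operator: the swapped term is renamed, so that \<open>hecke_op\<close>
  acts on the kernel K instead of on F.\<close>

lemma sum_hecke_op_last:
  assumes "finite S" "\<And>p. K p p = 0"
  shows "(\<Sum>p\<in>S. \<Sum>q\<in>S. K p q * hecke_op (length cs) F (cs @ [p, q])) =
    (\<Sum>p\<in>S. \<Sum>q\<in>S. (K p q / (of_nat q - of_nat p) + K q p * (1 + 1 / (of_nat q - of_nat p))) *
      F (cs @ [p, q]))"
proof -
  have "(\<Sum>p\<in>S. \<Sum>q\<in>S. K p q * ((1 - 1 / (of_nat q - of_nat p)) * F (cs @ [q, p]))) =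
    (\<Sum>p\<in>S. \<Sum>q\<in>S. K q p * ((1 - 1 / (of_nat p - of_nat q)) * F (cs @ [p, q])))"
    by (rule sum.swap)
  also have "\<dots> = (\<Sum>p\<in>S. \<Sum>q\<in>S. K q p * (1 + 1 / (of_nat q - of_nat p)) * F (cs @ [p, q]))"
  proof (intro sum.cong refl)
    fix p q
    have "1 / (of_nat p - of_nat q) = - (1 / (of_nat q - of_nat p :: rat))"
      by (metis minus_diff_eq minus_divide_right)
    then show "K q p * ((1 - 1 / (of_nat p - of_nat q)) * F (cs @ [p, q])) =
      K q p * (1 + 1 / (of_nat q - of_nat p)) * F (cs @ [p, q])"
      by simp
  qed
  finally show ?thesis
    unfolding hecke_op_def col_diff_last swap_at_last
    by (simp add: sum.distrib distrib_left distrib_right sum_divide_distrib)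
qed

lemma add_op_add_op:
  assumes "finite S" "next_cols (next_cols (set cs)) \<subseteq> S" "set cs \<subseteq> S" "next_cols (set cs) \<subseteq> S"
  shows "add_op (add_op F) cs =
    (\<Sum>p\<in>S. \<Sum>q\<in>S. trans_prob (set cs) p * trans_prob (insert p (set cs)) q * F (cs @ [p, q]))"
proof -
  have "trans_prob (set cs) p * add_op F (cs @ [p]) =
      (\<Sum>q\<in>S. trans_prob (set cs) p * trans_prob (insert p (set cs)) q * F (cs @ [p, q]))" for p
  proof (cases "p \<in> next_cols (set cs)")
    case True
    with assms have "add_op F (cs @ [p]) =
        (\<Sum>q\<in>S. trans_prob (set (cs @ [p])) q * F ((cs @ [p]) @ [q]))"
      by (intro add_op_eq) (auto simp: next_cols_def)
    then show ?thesis by (simp add: sum_distrib_left mult.assoc)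
  qed (simp add: trans_prob_outside)
  with assms show ?thesis by (subst add_op_eq[of S]) auto
qed

text \<open>Two vertices just added both have exponent 1, so exchanging them must change
  nothing.\<close>

lemma add_op_add_op_hecke_op:
  assumes "distinct cs"
  shows "add_op (add_op (hecke_op (length cs) F)) cs = add_op (add_op F) cs"
proof -
  define A where "A = set cs"
  define S where "S = A \<union> next_cols A \<union> next_cols (next_cols A)"
  define K where "K p q = trans_prob A p * trans_prob (insert p A) q" for p q
  have S: "finite S" "next_cols (next_cols (set cs)) \<subseteq> S" "set cs \<subseteq> S" "next_cols (set cs) \<subseteq> S"
    by (auto simp: S_def A_def)
  have K0: "K p p = 0" for p by (simp add: K_def trans_prob_mem A_def)
  have "K p q / (of_nat q - of_nat p) + K q p * (1 + 1 / (of_nat q - of_nat p)) = K p q" for p q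
  proof (cases "p = q")
    case False
    with trans_prob_exchange[of A p q] show ?thesis by (simp add: K_def A_def algebra_simps)
  qed (simp add: K0)
  with sum_hecke_op_last[OF S(1), of K, OF K0] show ?thesis
    unfolding add_op_add_op[OF S] by (simp flip: A_def K_def)
qed

text \<open>On exponents both sides turn \<open>l # \<alpha>\<close> into
  \<open>\<alpha> @ [1, Suc l]\<close>: rotate, add and swap the last two, or add and rotate. This
  is where the modular law enters.\<close>

lemma add_op_rot_op:
  assumes "distinct (c # cs)"
  shows "rot_op a (add_op (hecke_op (length cs) F)) (c # cs) = add_op (rot_op a F) (c # cs)"
proof -
  define A where "A = set cs"
  define B where "B = insert c A"
  define S where "S = B \<union> next_cols B \<union> next_cols (next_cols B)"
  have c: "c \<notin> A" "finite A" using assms by (auto simp: A_def)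
  have AB: "A \<subseteq> B" by (auto simp: B_def)
  have SA: "finite S" "next_cols (next_cols (set cs)) \<subseteq> S" "set cs \<subseteq> S" "next_cols (set cs) \<subseteq> S"
    using next_cols_mono[OF AB] next_cols_mono[OF next_cols_mono[OF AB]]
    by (auto simp: S_def A_def B_def)
  have SB: "finite S" "next_cols (next_cols (set (c # cs))) \<subseteq> S" "set (c # cs) \<subseteq> S" "next_cols (set (c # cs)) \<subseteq> S"
    by (auto simp: S_def B_def A_def)
  \<comment> \<open>X, Y and Z are the probabilities of adding p and then q when c is deactivated
    before both, between them, and after both.\<close>
  define X where "X p q = trans_prob A p * trans_prob (insert p A) q" for p q
  define Y where "Y p q = trans_prob B p * trans_prob (insert p A) q" for p q
  define Z where "Z p q = trans_prob B p * trans_prob (insert p B) q" for p q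
  have x0: "X p p = 0" "Y p p = 0" "Z p p = 0" for p
    using c by (simp_all add: X_def Y_def Z_def trans_prob_mem B_def)
  have "drop_op a (add_op (add_op G)) (c # cs) = a c * (\<Sum>p\<in>S. \<Sum>q\<in>S. X p q * G (cs @ [p, q]))" for G
    by (simp add: drop_op_def add_op_add_op[OF SA] X_def A_def)
  note DX = this
  have DY: "add_op (drop_op a (add_op G)) (c # cs) = a c * (\<Sum>p\<in>S. \<Sum>q\<in>S. Y p q * G (cs @ [p, q]))" for G
  proof -
    have "trans_prob B p * drop_op a (add_op G) (c # cs @ [p]) =
        a c * (\<Sum>q\<in>S. Y p q * G (cs @ [p, q]))" for p
    proof (cases "p \<in> next_cols B")
      case True
      with SB SA have "add_op G (cs @ [p]) =
          (\<Sum>q\<in>S. trans_prob (set (cs @ [p])) q * G ((cs @ [p]) @ [q]))"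
        by (intro add_op_eq) (auto simp: next_cols_def A_def B_def)
      then show ?thesis by (simp add: drop_op_def Y_def A_def sum_distrib_left mult_ac)
    qed (simp add: trans_prob_outside Y_def)
    then have "(\<Sum>p\<in>S. trans_prob B p * drop_op a (add_op G) (c # cs @ [p])) =
        a c * (\<Sum>p\<in>S. \<Sum>q\<in>S. Y p q * G (cs @ [p, q]))"
      by (simp add: sum_distrib_left)
    then show ?thesis
      using SB by (subst add_op_eq[of S]) (auto simp: B_def A_def)
  qed
  have DZ: "add_op (add_op (drop_op a G)) (c # cs) = a c * (\<Sum>p\<in>S. \<Sum>q\<in>S. Z p q * G (cs @ [p, q]))" for G
    by (simp add: add_op_add_op[OF SB] drop_op_def Z_def B_def A_def sum_distrib_left mult_ac)
  have key: "(1 + 1 / w) * (Y p q + Y q p) = X p q + Z p q" if "w = of_nat q - of_nat p" "p \<noteq> q" for p q w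
    using trans_prob_modular[OF c(2) c(1) that(2)] that(1) by (simp add: X_def Y_def Z_def B_def)
  define K where "K p q = X p q - Y p q" for p q
  have K0: "K p p = 0" for p by (simp add: K_def x0)
  have *: "K p q / (of_nat q - of_nat p) + K q p * (1 + 1 / (of_nat q - of_nat p)) = Y p q - Z p q" for p q
  proof (cases "p = q")
    case False
    define i where "i = 1 / (of_nat q - of_nat p :: rat)"
    have "(1 - i) * X p q = (1 + i) * X q p"
      using trans_prob_exchange[OF c(2) False] by (simp add: X_def i_def)
    moreover have "(1 + i) * (Y p q + Y q p) = X p q + Z p q"
      using key[OF refl False] by (simp add: i_def)
    moreover have "K p q / (of_nat q - of_nat p) = i * K p q" by (simp add: i_def)
    ultimately show ?thesis unfolding i_def[symmetric] K_def by (simp add: algebra_simps)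
  qed (simp add: x0 K_def)
  have "rot_op a (add_op (hecke_op (length cs) F)) (c # cs) =
      a c * (\<Sum>p\<in>S. \<Sum>q\<in>S. K p q * hecke_op (length cs) F (cs @ [p, q]))"
    unfolding rot_op_def DX DY K_def by (simp add: left_diff_distrib sum_subtractf right_diff_distrib)
  also have "\<dots> = a c * (\<Sum>p\<in>S. \<Sum>q\<in>S. (Y p q - Z p q) * F (cs @ [p, q]))"
    by (simp only: sum_hecke_op_last[OF SA(1), of K, OF K0] *)
  also have "\<dots> = add_op (drop_op a (add_op F)) (c # cs) - add_op (add_op (drop_op a F)) (c # cs)"
    unfolding DY DZ by (simp add: left_diff_distrib sum_subtractf right_diff_distrib)
  also have "\<dots> = add_op (rot_op a F) (c # cs)"
    using add_op_linear[of 1 "drop_op a (add_op F)" "-1" "add_op (drop_op a F)"]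
    by (simp add: rot_op_def[abs_def])
  finally show ?thesis .
qed

text \<open>Rotating the first vertex and then dropping the second is the same as swapping them,
  dropping, and rotating the other. Coefficientwise this is \<open>trans_prob_two\<close>.\<close>

lemma rot_op_drop_op:
  assumes "distinct (c # d # cs)"
  shows "rot_op a (drop_op a F) (c # d # cs) = hecke_op 0 (drop_op a (rot_op a F)) (c # d # cs)"
proof -
  define A where "A = set cs"
  define S where "S = next_cols (insert c (insert d A))"
  have A: "finite A" "c \<notin> A" "d \<notin> A" "c \<noteq> d" using assms by (auto simp: A_def)
  have S: "finite S" "next_cols A \<subseteq> S" "next_cols (insert d A) \<subseteq> S"
      "next_cols (insert c A) \<subseteq> S" "next_cols (insert c (insert d A)) \<subseteq> S"
    by (auto simp: S_def A_def next_cols_def)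
  have eq: "add_op G ds = (\<Sum>q\<in>S. trans_prob (set ds) q * G (ds @ [q]))" if "next_cols (set ds) \<subseteq> S" for G ds
    using add_op_eq[OF S(1) that] .
  have 1: "rot_op a (drop_op a F) (c # d # cs) =
    a c * a d * (\<Sum>p\<in>S. (trans_prob (insert d A) p - trans_prob (insert c (insert d A)) p) * F (cs @ [p]))"
    using S by (simp add: rot_op_def drop_op_def eq A_def left_diff_distrib right_diff_distrib
        sum_subtractf sum_distrib_left mult_ac)
  have 2: "drop_op a (rot_op a F) (x # y # cs) =
    a x * a y * (\<Sum>p\<in>S. (trans_prob A p - trans_prob (insert y A) p) * F (cs @ [p]))"
    if "y = c \<or> y = d" for x y
    using S that by (auto simp: rot_op_def drop_op_def eq A_def left_diff_distrib right_diff_distrib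
        sum_subtractf sum_distrib_left mult_ac)
  define i where "i = 1 / (of_nat d - of_nat c :: rat)"
  have "hecke_op 0 (drop_op a (rot_op a F)) (c # d # cs) =
    i * (a c * a d * (\<Sum>p\<in>S. (trans_prob A p - trans_prob (insert d A) p) * F (cs @ [p]))) +
    (1 - i) * (a d * a c * (\<Sum>p\<in>S. (trans_prob A p - trans_prob (insert c A) p) * F (cs @ [p])))"
    by (simp add: hecke_op_def swap_at_first col_diff_first 2 i_def)
  also have "\<dots> = a c * a d * (\<Sum>p\<in>S. (i * (trans_prob A p - trans_prob (insert d A) p) +
      (1 - i) * (trans_prob A p - trans_prob (insert c A) p)) * F (cs @ [p]))"
    by (simp add: distrib_left distrib_right sum.distrib sum_distrib_left mult_ac)
  finally show ?thesis
    unfolding 1 using trans_prob_two[OF A] by (simp add: i_def)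
qed

lemma drop_op_rot_op:
  assumes "distinct cs" "length cs \<ge> 2"
  shows "drop_op a (rot_op a F) cs = hecke_op 0 (rot_op a (drop_op a F)) cs"
proof -
  from assms obtain c d ds where cs: "cs = c # d # ds"
    by (metis Suc_le_length_iff numeral_2_eq_2)
  have "hecke_op 0 (rot_op a (drop_op a F)) cs = hecke_op 0 (hecke_op 0 (drop_op a (rot_op a F))) cs"
  proof (rule hecke_op_cong)
    fix es :: "nat list" assume es: "distinct es" "length es = length cs"
    then obtain c' d' ds' where "es = c' # d' # ds'" using cs by (auto simp: length_Suc_conv)
    with es show "rot_op a (drop_op a F) es = hecke_op 0 (drop_op a (rot_op a F)) es"
      using rot_op_drop_op by blast
  qed (use assms cs in auto)
  with assms show ?thesis by (simp add: hecke_op_involution)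
qed

lemma add_op_rot_op_hecke_op:
  assumes "distinct cs" "cs \<noteq> []"
  shows "add_op (rot_op a (hecke_op (length cs - 1) F)) cs = rot_op a (add_op F) cs"
proof -
  from assms obtain c ds where cs: "cs = c # ds" by (cases cs) auto
  have "add_op (rot_op a (hecke_op (length ds) F)) cs = rot_op a (add_op (hecke_op (length ds) (hecke_op (length ds) F))) cs"
    using add_op_rot_op[of c ds a "hecke_op (length ds) F"] assms(1) cs by simp
  also have "\<dots> = rot_op a (add_op F) cs"
    using assms cs by (intro rot_op_cong add_op_cong hecke_op_involution) auto
  finally show ?thesis by (simp add: cs)
qed

text \<open>No further computation with probabilities: one of the two rotations is expanded as a
  commutator, and the swap is carried through with the relations for add, drop and rotate already
  shown.\<close>

lemma rot_op_rot_op_hecke_op: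
  assumes "distinct cs" "length cs = Suc (Suc k)"
  shows "rot_op a (rot_op a (hecke_op k F)) cs = hecke_op 0 (rot_op a (rot_op a F)) cs"
proof -
  have "drop_op a (add_op (rot_op a (hecke_op k F))) cs = drop_op a (rot_op a (add_op F)) cs"
  proof (rule drop_op_cong)
    fix ds :: "nat list" assume "distinct ds" "length ds = length cs - 1"
    with assms add_op_rot_op_hecke_op[of ds a F] show "add_op (rot_op a (hecke_op k F)) ds = rot_op a (add_op F) ds"
      by (cases ds) auto
  qed (use assms in auto)
  also have "\<dots> = hecke_op 0 (rot_op a (drop_op a (add_op F))) cs"
    using assms by (intro drop_op_rot_op) auto
  finally have 1: "drop_op a (add_op (rot_op a (hecke_op k F))) cs = \<dots>" .
  have "add_op (drop_op a (rot_op a (hecke_op k F))) cs =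
      add_op (hecke_op 0 (rot_op a (hecke_op (Suc k) (drop_op a F)))) cs"
  proof (rule add_op_cong)
    fix ds :: "nat list" assume ds: "distinct ds" "length ds = Suc (length cs)"
    then have "drop_op a (rot_op a (hecke_op k F)) ds = hecke_op 0 (rot_op a (drop_op a (hecke_op k F))) ds"
      using assms by (intro drop_op_rot_op) auto
    also have "\<dots> = hecke_op 0 (rot_op a (hecke_op (Suc k) (drop_op a F))) ds"
      using assms ds by (intro hecke_op_cong rot_op_cong drop_op_hecke_op) auto
    finally show "drop_op a (rot_op a (hecke_op k F)) ds = \<dots>" .
  qed (use assms in auto)
  also have "\<dots> = hecke_op 0 (add_op (rot_op a (hecke_op (Suc k) (drop_op a F)))) cs"
    using assms by (intro add_op_hecke_op) auto
  also have "\<dots> = hecke_op 0 (rot_op a (add_op (drop_op a F))) cs"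
  proof (rule hecke_op_cong)
    fix ds :: "nat list" assume "distinct ds" "length ds = length cs"
    with assms add_op_rot_op_hecke_op[of ds a "drop_op a F"]
    show "add_op (rot_op a (hecke_op (Suc k) (drop_op a F))) ds = rot_op a (add_op (drop_op a F)) ds"
      by (cases ds) auto
  qed (use assms in auto)
  finally have 2: "add_op (drop_op a (rot_op a (hecke_op k F))) cs = \<dots>" .
  have 3: "rot_op a (rot_op a F) = (\<lambda>cs. rot_op a (drop_op a (add_op F)) cs - rot_op a (add_op (drop_op a F)) cs)"
    using rot_op_linear[of a 1 "drop_op a (add_op F)" "-1" "add_op (drop_op a F)"]
    by (simp add: rot_op_def[of a F, abs_def])
  show ?thesis
    unfolding 3 using 1 2 by (simp add: rot_op_def[of a "rot_op a (hecke_op k F)"] hecke_op_def diff_divide_distrib algebra_simps)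
qed

section \<open>Column states\<close>

text \<open>
  \<open>col_state a \<alpha>\<close> is the image, on the side of column sequences, of the monomial with exponents
  \<open>\<alpha>\<close> in the colors of the active vertices. Every composition \<open>\<alpha>\<close> arises in a unique way from
  the empty one by appending a part \<open>1\<close> (\<^const>\<open>add_op\<close>) and by moving the first part to
  the end and increasing it by one (\<^const>\<open>rot_op\<close>).
\<close>

function col_state :: "(nat \<Rightarrow> rat) \<Rightarrow> nat list \<Rightarrow> (nat list \<Rightarrow> rat) \<Rightarrow> rat" where
  "col_state a \<alpha> F = (if \<alpha> = [] then F []
    else if last \<alpha> \<le> 1 then col_state a (butlast \<alpha>) (add_op F)
    else col_state a ((last \<alpha> - 1) # butlast \<alpha>) (rot_op a F))"
  by pat_completeness auto
termination
proof (relation "measure (\<lambda>(a, \<alpha>, F). sum_list \<alpha> + length \<alpha>)", goal_cases)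
  case (2 a \<alpha> F)
  then have "sum_list \<alpha> = sum_list (butlast \<alpha>) + last \<alpha>"
    by (metis append_butlast_last_id sum_list_append sum_list.Cons sum_list.Nil add.right_neutral)
  with 2 show ?case by (cases \<alpha>) auto
next
  case (3 a \<alpha> F)
  then have "sum_list \<alpha> = sum_list (butlast \<alpha>) + last \<alpha>"
    by (metis append_butlast_last_id sum_list_append sum_list.Cons sum_list.Nil add.right_neutral)
  with 3 show ?case by (cases \<alpha>) auto
qed auto

declare col_state.simps [simp del]

lemma col_state_Nil [simp]: "col_state a [] F = F []"
  by (simp add: col_state.simps)

lemma col_state_snoc_1 [simp]: "col_state a (\<alpha> @ [Suc 0]) F = col_state a \<alpha> (add_op F)"
  by (subst col_state.simps) simp

lemma col_state_snoc_Suc: "l > 0 \<Longrightarrow> col_state a (\<alpha> @ [Suc l]) F = col_state a (l # \<alpha>) (rot_op a F)"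
  by (subst col_state.simps) simp

text \<open>Induction along the recursion of \<open>col_state\<close>.\<close>

lemma pos_snoc_induct [consumes 1, case_names Nil one Suc]:
  assumes "0 \<notin> set \<alpha>"
    and "P []"
    and "\<And>\<alpha>. 0 \<notin> set \<alpha> \<Longrightarrow> P \<alpha> \<Longrightarrow> P (\<alpha> @ [Suc 0])"
    and "\<And>\<alpha> l. 0 \<notin> set \<alpha> \<Longrightarrow> l > 0 \<Longrightarrow> P (l # \<alpha>) \<Longrightarrow> P (\<alpha> @ [Suc l])"
  shows "P \<alpha>"
  using assms(1)
proof (induction "sum_list \<alpha> + length \<alpha>" arbitrary: \<alpha> rule: less_induct)
  case less
  show ?case
  proof (cases \<alpha> rule: rev_cases)
    case (snoc \<beta> k)
    with less.prems obtain l where k: "k = Suc l" by (cases k) auto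
    show ?thesis
    proof (cases "l = 0")
      case True
      have "P \<beta>" using less.prems snoc k by (intro less.hyps) auto
      with assms(3)[of \<beta>] less.prems snoc k True show ?thesis by auto
    next
      case False
      have "P (l # \<beta>)" using less.prems snoc k False by (intro less.hyps) auto
      with assms(4)[of \<beta> l] less.prems snoc k False show ?thesis by auto
    qed
  qed (use assms in simp)
qed

lemma col_state_cong:
  assumes "0 \<notin> set \<alpha>" "\<And>cs. distinct cs \<Longrightarrow> length cs = length \<alpha> \<Longrightarrow> F cs = G cs"
  shows "col_state a \<alpha> F = col_state a \<alpha> G"
  using assms
proof (induction \<alpha> arbitrary: F G rule: pos_snoc_induct)
  case (one \<alpha>)
  have "col_state a \<alpha> (add_op F) = col_state a \<alpha> (add_op G)"
  proof (rule one.IH)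
    fix cs :: "nat list" assume "distinct cs" "length cs = length \<alpha>"
    then show "add_op F cs = add_op G cs" by (intro add_op_cong one.prems) simp_all
  qed
  then show ?case by simp
next
  case (Suc \<alpha> l)
  have "col_state a (l # \<alpha>) (rot_op a F) = col_state a (l # \<alpha>) (rot_op a G)"
  proof (rule Suc.IH)
    fix cs :: "nat list" assume "distinct cs" "length cs = length (l # \<alpha>)"
    then show "rot_op a F cs = rot_op a G cs" by (intro rot_op_cong Suc.prems) auto
  qed
  with Suc.hyps show ?case by (simp add: col_state_snoc_Suc)
qed simp

lemma col_state_linear:
  assumes "0 \<notin> set \<alpha>"
  shows "col_state a \<alpha> (\<lambda>cs. x * F cs + y * G cs) = x * col_state a \<alpha> F + y * col_state a \<alpha> G"
  using assms
proof (induction \<alpha> arbitrary: F G rule: pos_snoc_induct)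
  case (one \<alpha>)
  have "add_op (\<lambda>cs. x * F cs + y * G cs) = (\<lambda>cs. x * add_op F cs + y * add_op G cs)"
    by (rule ext) (rule add_op_linear)
  with one.IH show ?case by simp
next
  case (Suc \<alpha> l)
  with Suc.IH show ?case by (simp add: col_state_snoc_Suc rot_op_linear)
qed simp

text \<open>A swap away from the end commutes with the last building step. A swap of the last two
  parts is one of the relations for add-add, add-rotate or rotate-rotate, according to which of the
  two parts equal 1.\<close>

lemma col_state_hecke_op:
  assumes "0 \<notin> set \<alpha>" "Suc i < length \<alpha>"
  shows "col_state a \<alpha> (hecke_op i F) = col_state a (swap_at i \<alpha>) F"
  using assms
proof (induction "sum_list \<alpha> + length \<alpha>" arbitrary: \<alpha> i F rule: less_induct)
  case less
  obtain \<beta> k where \<alpha>: "\<alpha> = \<beta> @ [k]" using less.prems by (cases \<alpha> rule: rev_cases) auto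
  with less.prems obtain l where k: "k = Suc l" by (cases k) auto
  have pos: "0 \<notin> set \<beta>" using less.prems \<alpha> by simp
  show ?case
  proof (cases "Suc i < length \<beta>")
    case True
    note i = this
    have pos': "0 \<notin> set (swap_at i \<beta>)" using pos True by simp
    show ?thesis
    proof (cases "l = 0")
      case True
      have "col_state a \<alpha> (hecke_op i F) = col_state a \<beta> (hecke_op i (add_op F))"
        unfolding \<alpha> k True col_state_snoc_1 using i
        by (intro col_state_cong[OF pos] add_op_hecke_op) auto
      also have "\<dots> = col_state a (swap_at i \<beta>) (add_op F)"
        using \<alpha> pos i by (intro less.hyps) auto
      finally show ?thesis using i by (simp add: \<alpha> k True swap_at_append)
    next
      case False
      have "col_state a \<alpha> (hecke_op i F) = col_state a (l # \<beta>) (hecke_op (Suc i) (rot_op a F))"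
        unfolding \<alpha> k using False i pos
        by (subst col_state_snoc_Suc) (auto intro!: col_state_cong rot_op_hecke_op)
      also have "\<dots> = col_state a (swap_at (Suc i) (l # \<beta>)) (rot_op a F)"
        using \<alpha> k pos i False by (intro less.hyps) auto
      finally show ?thesis using i False by (simp add: \<alpha> k swap_at_append swap_at_Cons col_state_snoc_Suc)
    qed
  next
    case False
    with less.prems \<alpha> have i: "length \<beta> = Suc i" by simp
    then obtain \<gamma> m where \<beta>: "\<beta> = \<gamma> @ [m]" by (cases \<beta> rule: rev_cases) auto
    with pos obtain j where m: "m = Suc j" by (cases m) auto
    have i': "i = length \<gamma>" using i \<beta> by simp
    have pos: "0 \<notin> set \<gamma>" using pos \<beta> by simp
    have sw: "swap_at i \<alpha> = \<gamma> @ [k, m]" using swap_at_last[of \<gamma> m k] by (simp add: \<alpha> \<beta> i')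
    have 1: "col_state a (\<gamma> @ [Suc x, Suc 0]) (hecke_op i G) = col_state a (\<gamma> @ [Suc 0, Suc x]) G"
      if "x > 0" for x G
    proof -
      have "col_state a (\<gamma> @ [Suc x, Suc 0]) (hecke_op i G) =
          col_state a (x # \<gamma>) (rot_op a (add_op (hecke_op i G)))"
        using col_state_snoc_1[of a "\<gamma> @ [Suc x]"] that by (simp add: col_state_snoc_Suc)
      also have "\<dots> = col_state a (x # \<gamma>) (add_op (rot_op a G))"
      proof (rule col_state_cong)
        fix cs :: "nat list" assume cs: "distinct cs" "length cs = length (x # \<gamma>)"
        then obtain c ds where "cs = c # ds" by (cases cs) auto
        with cs add_op_rot_op[of c ds a G] i' show
          "rot_op a (add_op (hecke_op i G)) cs = add_op (rot_op a G) cs" by simp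
      qed (use that pos in auto)
      also have "\<dots> = col_state a ((\<gamma> @ [Suc 0]) @ [Suc x]) G"
        using that col_state_snoc_1[of a "x # \<gamma>"] by (subst col_state_snoc_Suc) auto
      finally show ?thesis by simp
    qed
    consider "l = 0" "j = 0" | "l = 0" "j > 0" | "l > 0" "j = 0" | "l > 0" "j > 0" by blast
    then show ?thesis
    proof cases
      case 1
      have "col_state a (\<gamma> @ [Suc 0, Suc 0]) G = col_state a \<gamma> (add_op (add_op G))" for G
        using col_state_snoc_1[of a "\<gamma> @ [Suc 0]" G] by simp
      moreover have "col_state a \<gamma> (add_op (add_op (hecke_op i F))) = col_state a \<gamma> (add_op (add_op F))"
        by (intro col_state_cong[OF pos]) (metis add_op_add_op_hecke_op i')
      ultimately show ?thesis unfolding sw using 1 by (simp add: \<alpha> \<beta> m k)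
    next
      case 2
      then show ?thesis unfolding sw using 1 by (simp add: \<alpha> \<beta> m k)
    next
      case 3
      \<comment> \<open>The mirrored case follows from the one just shown, by inserting the
        involution twice.\<close>
      have "col_state a (\<gamma> @ [Suc l, Suc 0]) F =
          col_state a (\<gamma> @ [Suc l, Suc 0]) (hecke_op i (hecke_op i F))"
        using i' pos by (intro col_state_cong hecke_op_involution[symmetric]) auto
      also have "\<dots> = col_state a (\<gamma> @ [Suc 0, Suc l]) (hecke_op i F)"
        using 1 3 by blast
      finally show ?thesis unfolding sw using 3 by (simp add: \<alpha> \<beta> m k)
    next
      case 4
      have 2: "col_state a (\<gamma> @ [Suc x, Suc y]) G = col_state a (x # y # \<gamma>) (rot_op a (rot_op a G))"
        if "x > 0" "y > 0" for x y G
        using that col_state_snoc_Suc[of y a "\<gamma> @ [Suc x]" G] col_state_snoc_Suc[of x a "y # \<gamma>" "rot_op a G"]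
        by simp
      have "col_state a \<alpha> (hecke_op i F) = col_state a (j # l # \<gamma>) (rot_op a (rot_op a (hecke_op i F)))"
        using 2 4 by (simp add: \<alpha> \<beta> m k)
      also have "\<dots> = col_state a (j # l # \<gamma>) (hecke_op 0 (rot_op a (rot_op a F)))"
        using 4 pos i' by (intro col_state_cong rot_op_rot_op_hecke_op) auto
      also have "\<dots> = col_state a (swap_at 0 (j # l # \<gamma>)) (rot_op a (rot_op a F))"
        using 4 pos by (intro less.hyps) (auto simp: \<alpha> \<beta> m k)
      also have "\<dots> = col_state a (swap_at i \<alpha>) F"
        unfolding sw using 2 4 by (simp add: swap_at_first m k)
      finally show ?thesis .
    qed
  qed
qed

text \<open>
  The deactivation of a vertex whose block has size \<open>b\<close>: its color either differs from all active
  colors, or it coincides with the color of an active vertex, whose block it joins.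
\<close>

lemma col_state_drop_op:
  fixes p :: "nat \<Rightarrow> rat"
  assumes "0 \<notin> set (b # \<alpha>)"
    and base: "\<And>b F. b > 0 \<Longrightarrow> col_state a [b] (drop_op a F) = p b * F []"
  shows "col_state a (b # \<alpha>) (drop_op a F) =
    p b * col_state a \<alpha> F - (\<Sum>j<length \<alpha>. col_state a (\<alpha>[j := \<alpha> ! j + b]) F)"
  using assms(1)
proof (induction "sum_list (b # \<alpha>) + length (b # \<alpha>)" arbitrary: b \<alpha> F rule: less_induct)
  case less
  then have b: "b > 0" by auto
  show ?case
  proof (cases \<alpha> rule: rev_cases)
    case Nil
    with base[OF b] show ?thesis by simp
  next
    case (snoc \<beta> k)
    with less.prems obtain l where k: "k = Suc l" by (cases k) auto
    have pos: "0 \<notin> set \<beta>" using less.prems snoc by simp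
    have upd: "\<alpha>[j := \<alpha> ! j + b] = \<beta>[j := \<beta> ! j + b] @ [k]" if "j < length \<beta>" for j
      using that snoc by (simp add: list_update_append nth_append)
    have upd': "\<alpha>[length \<beta> := \<alpha> ! length \<beta> + b] = \<beta> @ [Suc (l + b)]"
      using snoc k by simp
    have pos': "0 \<notin> set (\<beta>[j := \<beta> ! j + b])" for j
      using pos b set_update_subset_insert[of \<beta> j "\<beta> ! j + b"] by auto
    have len: "(\<Sum>j<length \<alpha>. G j) = (\<Sum>j<length \<beta>. G j) + G (length \<beta>)" for G :: "nat \<Rightarrow> rat"
      using snoc by simp
    show ?thesis
    proof (cases "l = 0")
      case True
      have k1: "k = Suc 0" using True k by simp
      have "col_state a (b # \<alpha>) (drop_op a F) = col_state a (b # \<beta>) (add_op (drop_op a F))"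
        using col_state_snoc_1[of a "b # \<beta>"] snoc k1 by simp
      \<comment> \<open>Moving the drop before the addition costs a commutator, and this rotation
        gives the last part \<open>Suc b\<close>: it is the term in which the block joins the last
        vertex.\<close>
      also have "\<dots> = col_state a (b # \<beta>) (\<lambda>cs. 1 * drop_op a (add_op F) cs + (- 1) * rot_op a F cs)"
        by (simp add: rot_op_def)
      also have "\<dots> = col_state a (b # \<beta>) (drop_op a (add_op F)) - col_state a (b # \<beta>) (rot_op a F)"
        using less.prems pos by (subst col_state_linear) auto
      also have "col_state a (b # \<beta>) (drop_op a (add_op F)) =
          p b * col_state a \<beta> (add_op F) - (\<Sum>j<length \<beta>. col_state a (\<beta>[j := \<beta> ! j + b]) (add_op F))"
        using less.prems snoc k1 by (intro less.hyps) auto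
      also have "col_state a (b # \<beta>) (rot_op a F) = col_state a (\<beta> @ [Suc b]) F"
        using b by (simp add: col_state_snoc_Suc)
      finally show ?thesis
        using upd upd' True unfolding len by (simp add: snoc k1)
    next
      case False
      have "col_state a (b # \<alpha>) (drop_op a F) = col_state a (l # b # \<beta>) (rot_op a (drop_op a F))"
        using col_state_snoc_Suc[of l a "b # \<beta>"] snoc k False by simp
      \<comment> \<open>The drop is moved before the rotation, so the induction hypothesis applies
        to \<open>b # l # \<beta>\<close>. Its term merging b into l becomes, after the rotation,
        the merge into the last part.\<close>
      also have "\<dots> = col_state a (l # b # \<beta>) (hecke_op 0 (drop_op a (rot_op a F)))"
      proof (rule col_state_cong)
        fix cs :: "nat list" assume cs: "distinct cs" "length cs = length (l # b # \<beta>)"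
        then obtain c d ds where "cs = c # d # ds" by (auto simp: length_Suc_conv)
        with cs show "rot_op a (drop_op a F) cs = hecke_op 0 (drop_op a (rot_op a F)) cs"
          using rot_op_drop_op by blast
      qed (use False b pos in auto)
      also have "\<dots> = col_state a (b # l # \<beta>) (drop_op a (rot_op a F))"
        using False b pos by (subst col_state_hecke_op) (auto simp: swap_at_first)
      also have "\<dots> = p b * col_state a (l # \<beta>) (rot_op a F) -
          (\<Sum>j<length (l # \<beta>). col_state a ((l # \<beta>)[j := (l # \<beta>) ! j + b]) (rot_op a F))"
        using False b pos snoc k by (intro less.hyps) auto
      also have "(\<Sum>j<length (l # \<beta>). col_state a ((l # \<beta>)[j := (l # \<beta>) ! j + b]) (rot_op a F)) =
          col_state a ((l + b) # \<beta>) (rot_op a F) +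
          (\<Sum>j<length \<beta>. col_state a (l # \<beta>[j := \<beta> ! j + b]) (rot_op a F))"
        by (simp add: sum.lessThan_Suc_shift del: sum.lessThan_Suc)
      finally show ?thesis
        using upd upd' False b unfolding len by (simp add: snoc k col_state_snoc_Suc)
    qed
  qed
qed

section \<open>Colorings and column sequences\<close>

definition esym :: "(nat \<Rightarrow> rat) \<Rightarrow> nat set \<Rightarrow> nat \<Rightarrow> rat" where
  "esym x A k = (\<Sum>S | S \<subseteq> A \<and> card S = k. \<Prod>i\<in>S. x i)"

lemma esym_0 [simp]: "finite A \<Longrightarrow> esym x A 0 = 1"
proof -
  assume "finite A"
  then have "{S. S \<subseteq> A \<and> card S = 0} = {{}}" by (auto dest: finite_subset)
  then show ?thesis by (simp add: esym_def)
qed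

lemma esym_insert:
  assumes "finite A" "y \<notin> A"
  shows "esym x (insert y A) (Suc k) = esym x A (Suc k) + x y * esym x A k"
proof -
  have fin: "finite {S. S \<subseteq> A \<and> card S = j}" for j using assms by simp
  have "{S. S \<subseteq> insert y A \<and> card S = Suc k} =
      {S. S \<subseteq> A \<and> card S = Suc k} \<union> insert y ` {S. S \<subseteq> A \<and> card S = k}" (is "?L = ?R1 \<union> ?R2")
  proof (intro equalityI subsetI)
    fix S assume S: "S \<in> ?L"
    then have "finite S" using assms(1) finite_subset[of S "insert y A"] by auto
    show "S \<in> ?R1 \<union> ?R2"
    proof (cases "y \<in> S")
      case True
      then have "S - {y} \<in> {S. S \<subseteq> A \<and> card S = k}" using S \<open>finite S\<close> by auto
      with insert_Diff[OF True, symmetric] show ?thesis by (intro UnI2 image_eqI)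
    qed (use S in auto)
  next
    fix S assume "S \<in> ?R1 \<union> ?R2"
    then show "S \<in> ?L"
    proof
      assume "S \<in> ?R2"
      then obtain T where T: "S = insert y T" "T \<subseteq> A" "card T = k" by blast
      then have "finite T" "y \<notin> T" using assms finite_subset by auto
      with T show ?thesis by auto
    qed auto
  qed
  moreover have "?R1 \<inter> ?R2 = {}" using assms by auto
  ultimately have "esym x (insert y A) (Suc k) =
      esym x A (Suc k) + (\<Sum>S\<in>?R2. \<Prod>i\<in>S. x i)"
    using fin by (simp add: esym_def sum.union_disjoint)
  also have "(\<Sum>S\<in>?R2. \<Prod>i\<in>S. x i) = (\<Sum>S | S \<subseteq> A \<and> card S = k. \<Prod>i\<in>insert y S. x i)"
    using assms by (intro sum.reindex_cong[where l = "insert y"] inj_onI) auto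
  also have "\<dots> = x y * esym x A k"
  proof -
    have "(\<Prod>i\<in>insert y S. x i) = x y * (\<Prod>i\<in>S. x i)" if "S \<subseteq> A" for S
      using that assms finite_subset by (subst prod.insert) auto
    then show ?thesis by (simp add: esym_def sum_distrib_left)
  qed
  finally show ?thesis .
qed

text \<open>Double counting of pairs of a (k+1)-subset T and an element y of T. It splits
  \<open>col_weight\<close> into one summand for each color y.\<close>

lemma sum_esym_remove:
  assumes "finite A"
  shows "(\<Sum>y\<in>A. x y * esym x (A - {y}) k) = of_nat (Suc k) * esym x A (Suc k)"
proof -
  have "(\<Sum>y\<in>A. x y * esym x (A - {y}) k) =
      (\<Sum>(y, S)\<in>(SIGMA y:A. {S. S \<subseteq> A - {y} \<and> card S = k}). x y * (\<Prod>i\<in>S. x i))"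
    using assms by (simp add: esym_def sum_distrib_left sum.Sigma)
  also have "\<dots> = (\<Sum>(T, y)\<in>(SIGMA T:{T. T \<subseteq> A \<and> card T = Suc k}. T). \<Prod>i\<in>T. x i)"
  proof (rule sum.reindex_bij_witness[of _ "\<lambda>(T, y). (y, T - {y})" "\<lambda>(y, S). (insert y S, y)"], goal_cases)
    case (1 p)
    then show ?case by auto
  next
    case (2 p)
    then obtain y S where p: "p = (y, S)" "y \<in> A" "S \<subseteq> A - {y}" "card S = k" by auto
    then have "finite S" "y \<notin> S" using assms finite_subset by auto
    with p show ?case by auto
  next
    case (3 q)
    then show ?case by auto
  next
    case (4 q)
    then obtain T y where q: "q = (T, y)" "T \<subseteq> A" "card T = Suc k" "y \<in> T" by auto
    then have "finite T" using assms finite_subset by auto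
    with q show ?case by auto
  next
    case (5 p)
    then obtain y S where p: "p = (y, S)" "y \<in> A" "S \<subseteq> A - {y}" "card S = k" by auto
    then have "finite S" "y \<notin> S" using assms finite_subset by auto
    with p show ?case by simp
  qed
  also have "\<dots> = (\<Sum>T | T \<subseteq> A \<and> card T = Suc k. \<Sum>y\<in>T. \<Prod>i\<in>T. x i)"
    using assms by (subst sum.Sigma) (auto dest: finite_subset)
  also have "\<dots> = of_nat (Suc k) * esym x A (Suc k)"
    by (simp add: esym_def sum_distrib_left)
  finally show ?thesis .
qed

lemma esym_pos:
  assumes "finite A" "\<And>i. i \<in> A \<Longrightarrow> x i > 0" "k \<le> card A"
  shows "esym x A k > 0"
proof -
  obtain S where S: "S \<subseteq> A" "card S = k" using assms(3) by (meson obtain_subset_with_card_n)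
  have "(\<Prod>i\<in>S. x i) > 0" if "S \<subseteq> A" for S using that assms by (intro prod_pos) auto
  with S assms(1) show ?thesis unfolding esym_def
    by (intro sum_pos2[of _ S]) (auto simp: less_imp_le)
qed

lemma esym_nonneg: "(\<And>i. i \<in> A \<Longrightarrow> x i > 0) \<Longrightarrow> esym x A k \<ge> 0"
  unfolding esym_def by (intro sum_nonneg prod_nonneg) (auto intro: less_imp_le)

definition col_weight :: "(nat \<Rightarrow> rat) \<Rightarrow> nat set \<Rightarrow> nat \<Rightarrow> rat" where
  "col_weight x A c = of_nat (Suc c) * esym x A (Suc c) / esym x A c"

definition power_sum :: "(nat \<Rightarrow> rat) \<Rightarrow> nat set \<Rightarrow> nat \<Rightarrow> rat" where
  "power_sum x A b = (\<Sum>y\<in>A. x y ^ b)"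

lemma col_state_add: "0 \<notin> set \<alpha> \<Longrightarrow>
    col_state a \<alpha> (\<lambda>cs. F cs + G cs) = col_state a \<alpha> F + col_state a \<alpha> G"
  using col_state_linear[of \<alpha> a 1 F 1 G] by simp

lemma col_state_scale: "0 \<notin> set \<alpha> \<Longrightarrow> col_state a \<alpha> (\<lambda>cs. r * F cs) = r * col_state a \<alpha> F"
  using col_state_linear[of \<alpha> a r F 0 F] by simp

lemma col_state_sum:
  "finite I \<Longrightarrow> 0 \<notin> set \<alpha> \<Longrightarrow> col_state a \<alpha> (\<lambda>cs. \<Sum>i\<in>I. F i cs) = (\<Sum>i\<in>I. col_state a \<alpha> (F i))"
proof (induction I rule: finite_induct)
  case empty
  then show ?case using col_state_scale[of \<alpha> a 0] by simp
qed (simp add: col_state_add)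

lemma rot_op_single: "rot_op a F [c] = a c / of_nat (Suc c) * (F [0] - F [Suc c])"
proof -
  have n: "next_cols {c} = {0, Suc c}" "next_cols {} = {0}" by (auto simp: next_cols_def)
  have t: "trans_prob {} 0 = 1" "trans_prob {c} 0 = of_nat c / (of_nat c + 1)"
    "trans_prob {c} (Suc c) = 1 / (of_nat c + 1)"
    by (simp_all add: trans_prob_def)
  have "1 - of_nat c / (of_nat c + 1) = (1 / (of_nat c + 1) :: rat)"
    by (simp add: divide_simps add_pos_nonneg add_eq_0_iff2 flip: of_nat_Suc)
  then have "a c * F [0] - of_nat c / (of_nat c + 1) * (a c * F [0]) = 1 / (of_nat c + 1) * (a c * F [0])"
    by (metis left_diff_distrib mult_1)
  then show ?thesis
    by (simp add: rot_op_def drop_op_def add_op_def n t algebra_simps add_divide_distrib diff_divide_distrib)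
qed

text \<open>On one active vertex the given function of the column is an eigenfunction of
  \<open>rot_op\<close> with eigenvalue \<open>x y\<close>, by e_{c+1}(A) = e_{c+1}(A - y) + x_y
  e_c(A - y). Its value at column 0 is also \<open>x y\<close>.\<close>

lemma col_state_single_power:
  assumes "finite A" "\<And>i. i \<in> A \<Longrightarrow> x i > 0" "y \<in> A" "b > 0"
  shows "col_state (col_weight x A) [b] (\<lambda>cs. x y * esym x (A - {y}) (hd cs) / esym x A (hd cs)) = x y ^ b"
    (is "col_state ?a [b] ?F = _")
  using assms(4)
proof (induction b)
  case (Suc b)
  show ?case
  proof (cases "b = 0")
    case True
    have "next_cols {} = {0}" by (auto simp: next_cols_def)
    then show ?thesis
      using col_state_snoc_1[of ?a "[]" ?F] assms(1) True by (simp add: add_op_def trans_prob_def)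
  next
    case False
    have "col_state ?a [Suc b] ?F = col_state ?a [b] (rot_op ?a ?F)"
      using col_state_snoc_Suc[of b ?a "[]"] False by simp
    also have "\<dots> = col_state ?a [b] (\<lambda>cs. x y * ?F cs)"
    proof (rule col_state_cong)
      fix cs :: "nat list" assume "length cs = length [b]"
      then obtain c where cs: "cs = [c]" by (auto simp: length_Suc_conv)
      have ins: "esym x A (Suc c) = esym x (A - {y}) (Suc c) + x y * esym x (A - {y}) c"
        using esym_insert[of "A - {y}" y x c] assms by (simp add: insert_absorb)
      have nn: "esym x (A - {y}) j \<ge> 0" for j using assms by (intro esym_nonneg) auto
      \<comment> \<open>The denominator vanishes for columns beyond the alphabet. Then both
        nonnegative summands of \<open>ins\<close> vanish, so the cancellation survives division by
        0.\<close>
      have "esym x A (Suc c) * (esym x (A - {y}) (Suc c) / esym x A (Suc c)) = esym x (A - {y}) (Suc c)"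
      proof (cases "esym x A (Suc c) = 0")
        case True
        have "x y * esym x (A - {y}) c \<ge> 0" using nn assms by (simp add: less_imp_le)
        with True ins nn[of "Suc c"] have "esym x (A - {y}) (Suc c) = 0" by linarith
        then show ?thesis by simp
      qed simp
      note h = this
      have "esym x A (Suc c) * (x y - x y * esym x (A - {y}) (Suc c) / esym x A (Suc c)) =
          x y * esym x A (Suc c) - x y * (esym x A (Suc c) * (esym x (A - {y}) (Suc c) / esym x A (Suc c)))"
        by (simp only: right_diff_distrib mult_ac times_divide_eq_right)
      also have "\<dots> = x y * (esym x A (Suc c) - esym x (A - {y}) (Suc c))"
        unfolding h by (simp only: right_diff_distrib)
      also have "esym x A (Suc c) - esym x (A - {y}) (Suc c) = x y * esym x (A - {y}) c"
        by (simp add: ins)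
      finally have "esym x A (Suc c) * (x y - x y * esym x (A - {y}) (Suc c) / esym x A (Suc c)) =
          x y * (x y * esym x (A - {y}) c)" .
      then show "rot_op ?a ?F cs = x y * ?F cs"
        unfolding cs rot_op_single using assms(1) by (simp add: col_weight_def)
    qed (use False in simp)
    also have "\<dots> = x y ^ Suc b" using False Suc.IH by (subst col_state_scale) simp_all
    finally show ?thesis .
  qed
qed simp

text \<open>The weight a c is the sum over y of these eigenfunctions, so the powers add up to a
  power sum. This is the base hypothesis of \<open>col_state_drop_op\<close>.\<close>

lemma col_state_single_drop:
  assumes "finite A" "\<And>i. i \<in> A \<Longrightarrow> x i > 0" "b > 0"
  shows "col_state (col_weight x A) [b] (drop_op (col_weight x A) F) = power_sum x A b * F []"
proof -
  define B where "B y cs = x y * esym x (A - {y}) (hd cs) / esym x A (hd cs)" for y and cs :: "nat list"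
  have "col_state (col_weight x A) [b] (drop_op (col_weight x A) F) =
      col_state (col_weight x A) [b] (\<lambda>cs. F [] * (\<Sum>y\<in>A. B y cs))"
  proof (rule col_state_cong)
    fix cs :: "nat list" assume "length cs = length [b]"
    then obtain c where "cs = [c]" by (auto simp: length_Suc_conv)
    then show "drop_op (col_weight x A) F cs = F [] * (\<Sum>y\<in>A. B y cs)"
      using sum_esym_remove[OF assms(1), of x c]
      by (simp add: drop_op_def col_weight_def B_def flip: sum_divide_distrib)
  qed (use assms in simp)
  also have "\<dots> = F [] * (\<Sum>y\<in>A. col_state (col_weight x A) [b] (B y))"
    using assms by (simp add: col_state_scale col_state_sum)
  also have "\<dots> = F [] * power_sum x A b"
    unfolding B_def using assms by (simp add: col_state_single_power power_sum_def)
  finally show ?thesis by simp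
qed

section \<open>Injective colorings and their correspondence with column sequences\<close>

definition color_state :: "(nat \<Rightarrow> rat) \<Rightarrow> nat set \<Rightarrow> nat list \<Rightarrow> (nat list \<Rightarrow> rat) \<Rightarrow> rat" where
  "color_state x A \<alpha> F = (\<Sum>ys | distinct ys \<and> set ys \<subseteq> A \<and> length ys = length \<alpha>.
    (\<Prod>i<length \<alpha>. x (ys ! i) ^ (\<alpha> ! i)) * F ys)"

lemma finite_color_lists [simp]: "finite A \<Longrightarrow> finite {ys. distinct ys \<and> set ys \<subseteq> A \<and> length ys = k}"
  by (rule finite_subset[OF _ finite_lists_length_eq[of A k]]) auto

lemma color_state_Nil [simp]: "color_state x A [] F = F []"
proof -
  have "{ys. distinct ys \<and> set ys \<subseteq> A \<and> length ys = 0} = {[]}" by auto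
  then show ?thesis by (simp add: color_state_def)
qed

definition color_add_op :: "(nat \<Rightarrow> rat) \<Rightarrow> nat set \<Rightarrow> (nat list \<Rightarrow> rat) \<Rightarrow> nat list \<Rightarrow> rat" where
  "color_add_op x A F ys = (\<Sum>c\<in>A - set ys. x c * F (ys @ [c]))"

lemma color_state_snoc_1:
  assumes "finite A"
  shows "color_state x A (\<alpha> @ [Suc 0]) F = color_state x A \<alpha> (color_add_op x A F)"
proof -
  let ?L = "\<lambda>k. {ys. distinct ys \<and> set ys \<subseteq> A \<and> length ys = k}"
  have "color_state x A \<alpha> (color_add_op x A F) =
      (\<Sum>(ys, c)\<in>(SIGMA ys:?L (length \<alpha>). A - set ys). (\<Prod>i<length \<alpha>. x (ys ! i) ^ (\<alpha> ! i)) * (x c * F (ys @ [c])))"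
    using assms by (simp add: color_state_def color_add_op_def sum_distrib_left sum.Sigma)
  also have "\<dots> = (\<Sum>ys\<in>?L (Suc (length \<alpha>)). (\<Prod>i<length (\<alpha> @ [Suc 0]). x (ys ! i) ^ ((\<alpha> @ [Suc 0]) ! i)) * F ys)"
  proof (rule sum.reindex_bij_witness[of _ "\<lambda>ys. (butlast ys, last ys)" "\<lambda>(ys, c). ys @ [c]"], goal_cases)
    case (1 p)
    then show ?case by auto
  next
    case (2 p)
    then show ?case by auto
  next
    case (3 ys)
    then show ?case by (cases ys rule: rev_cases) auto
  next
    case (4 ys)
    then show ?case by (cases ys rule: rev_cases) auto
  next
    case (5 p)
    then show ?case by (auto simp: nth_append)
  qed
  finally show ?thesis by (simp add: color_state_def)
qed

text \<open>The color of the dropped vertex ranges over all of A except the remaining active colors;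
  each excluded coincidence adds b to one exponent. The recursion is that of
  \<open>col_state_drop_op\<close>.\<close>

lemma color_state_Cons_tl:
  assumes "finite A"
  shows "color_state x A (b # \<alpha>) (\<lambda>ys. F (tl ys)) =
    power_sum x A b * color_state x A \<alpha> F - (\<Sum>j<length \<alpha>. color_state x A (\<alpha>[j := \<alpha> ! j + b]) F)"
proof -
  let ?L = "\<lambda>k. {ys. distinct ys \<and> set ys \<subseteq> A \<and> length ys = k}"
  let ?M = "\<lambda>ys. \<Prod>i<length \<alpha>. x (ys ! i) ^ (\<alpha> ! i)"
  have "color_state x A (b # \<alpha>) (\<lambda>ys. F (tl ys)) =
      (\<Sum>(ys, c)\<in>(SIGMA ys:?L (length \<alpha>). A - set ys). x c ^ b * (?M ys * F ys))"
    unfolding color_state_def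
  proof (rule sum.reindex_bij_witness[of _ "\<lambda>(ys, c). c # ys" "\<lambda>ys. (tl ys, hd ys)"], goal_cases)
    case (1 ys)
    then show ?case by (cases ys) auto
  next
    case (2 ys)
    then show ?case by (cases ys) auto
  next
    case (3 ys)
    then show ?case by auto
  next
    case (4 ys)
    then show ?case by auto
  next
    case (5 ys)
    then show ?case by (cases ys) (auto simp: prod.lessThan_Suc_shift simp del: prod.lessThan_Suc)
  qed
  also have "\<dots> = (\<Sum>ys\<in>?L (length \<alpha>). (\<Sum>c\<in>A - set ys. x c ^ b) * (?M ys * F ys))"
    using assms by (simp add: sum_distrib_right sum.Sigma)
  also have "\<dots> = (\<Sum>ys\<in>?L (length \<alpha>). power_sum x A b * (?M ys * F ys) -
      (\<Sum>j<length \<alpha>. x (ys ! j) ^ b * (?M ys * F ys)))"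
  proof (intro sum.cong refl)
    fix ys assume ys: "ys \<in> ?L (length \<alpha>)"
    then have "(\<Sum>c\<in>A - set ys. x c ^ b) = power_sum x A b - (\<Sum>c\<in>set ys. x c ^ b)"
      using assms by (simp add: power_sum_def sum_diff)
    also have "(\<Sum>c\<in>set ys. x c ^ b) = (\<Sum>j<length \<alpha>. x (ys ! j) ^ b)"
      using ys by (intro sum.reindex_bij_betw[symmetric, where h = "\<lambda>j. ys ! j", simplified] bij_betw_nth) auto
    finally show "(\<Sum>c\<in>A - set ys. x c ^ b) * (?M ys * F ys) = power_sum x A b * (?M ys * F ys) -
      (\<Sum>j<length \<alpha>. x (ys ! j) ^ b * (?M ys * F ys))"
      by (simp add: left_diff_distrib sum_distrib_right)
  qed
  also have "\<dots> = power_sum x A b * color_state x A \<alpha> F -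
      (\<Sum>j<length \<alpha>. \<Sum>ys\<in>?L (length \<alpha>). x (ys ! j) ^ b * (?M ys * F ys))"
    unfolding sum_subtractf color_state_def sum_distrib_left by (subst sum.swap) simp
  also have "(\<Sum>j<length \<alpha>. \<Sum>ys\<in>?L (length \<alpha>). x (ys ! j) ^ b * (?M ys * F ys)) =
      (\<Sum>j<length \<alpha>. color_state x A (\<alpha>[j := \<alpha> ! j + b]) F)"
  proof (intro sum.cong refl)
    fix j assume j: "j \<in> {..<length \<alpha>}"
    have "x (ys ! j) ^ b * ?M ys = (\<Prod>i<length \<alpha>. x (ys ! i) ^ (\<alpha>[j := \<alpha> ! j + b] ! i))" for ys
    proof -
      have "(\<Prod>i<length \<alpha>. x (ys ! i) ^ (\<alpha>[j := \<alpha> ! j + b] ! i)) =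
          x (ys ! j) ^ (\<alpha> ! j + b) * (\<Prod>i\<in>{..<length \<alpha>} - {j}. x (ys ! i) ^ (\<alpha>[j := \<alpha> ! j + b] ! i))"
        using j by (subst prod.remove[of _ j]) auto
      also have "(\<Prod>i\<in>{..<length \<alpha>} - {j}. x (ys ! i) ^ (\<alpha>[j := \<alpha> ! j + b] ! i)) =
          (\<Prod>i\<in>{..<length \<alpha>} - {j}. x (ys ! i) ^ (\<alpha> ! i))"
        by (intro prod.cong) auto
      also have "x (ys ! j) ^ (\<alpha> ! j + b) * \<dots> = x (ys ! j) ^ b * ?M ys"
        using j by (simp add: prod.remove[of _ j] power_add)
      finally show ?thesis by simp
    qed
    then show "(\<Sum>ys\<in>?L (length \<alpha>). x (ys ! j) ^ b * (?M ys * F ys)) = color_state x A (\<alpha>[j := \<alpha> ! j + b]) F"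
      by (simp add: color_state_def flip: mult.assoc)
  qed
  finally show ?thesis .
qed

text \<open>The two functionals come from the same formal combination of compositions of length k. A
  relation instead of a map avoids proving that the color functionals are linearly
  independent.\<close>

inductive corresp :: "(nat \<Rightarrow> rat) \<Rightarrow> nat set \<Rightarrow> nat \<Rightarrow> ((nat list \<Rightarrow> rat) \<Rightarrow> rat) \<Rightarrow>
    ((nat list \<Rightarrow> rat) \<Rightarrow> rat) \<Rightarrow> bool" for x A k where
  zero: "corresp x A k (\<lambda>_. 0) (\<lambda>_. 0)"
| add: "0 \<notin> set \<alpha> \<Longrightarrow> length \<alpha> = k \<Longrightarrow> corresp x A k U V \<Longrightarrow>
    corresp x A k (\<lambda>F. r * color_state x A \<alpha> F + U F) (\<lambda>F. r * col_state (col_weight x A) \<alpha> F + V F)"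

lemma corresp_base:
  "0 \<notin> set \<alpha> \<Longrightarrow> length \<alpha> = k \<Longrightarrow>
    corresp x A k (\<lambda>F. r * color_state x A \<alpha> F) (\<lambda>F. r * col_state (col_weight x A) \<alpha> F)"
  using corresp.add[OF _ _ corresp.zero] by simp

lemma corresp_add:
  assumes "corresp x A k U V" "corresp x A k U' V'"
  shows "corresp x A k (\<lambda>F. U F + U' F) (\<lambda>F. V F + V' F)"
  using assms by (induction rule: corresp.induct) (auto simp: add.assoc intro: corresp.add)

lemma corresp_sum:
  assumes "finite I" "\<And>i. i \<in> I \<Longrightarrow> corresp x A k (U i) (V i)"
  shows "corresp x A k (\<lambda>F. \<Sum>i\<in>I. U i F) (\<lambda>F. \<Sum>i\<in>I. V i F)"
  using assms by (induction I rule: finite_induct) (auto intro: corresp.zero corresp_add)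

lemma corresp_step_add:
  assumes "finite A" "corresp x A k U V"
  shows "corresp x A (Suc k) (\<lambda>F. U (color_add_op x A F)) (\<lambda>F. V (add_op F))"
  using assms(2)
proof (induction rule: corresp.induct)
  case (add \<alpha> U V r)
  then show ?case
    using corresp.add[of "\<alpha> @ [Suc 0]" "Suc k" x A "\<lambda>F. U (color_add_op x A F)" "\<lambda>F. V (add_op F)" r] assms(1)
    by (simp add: color_state_snoc_1)
qed (rule corresp.zero)

lemma corresp_step_drop:
  assumes "finite A" "\<And>i. i \<in> A \<Longrightarrow> x i > 0" "corresp x A (Suc k) U V"
  shows "corresp x A k (\<lambda>F. U (\<lambda>ys. F (tl ys))) (\<lambda>F. V (drop_op (col_weight x A) F))"
  using assms(3)
proof (induction rule: corresp.induct)
  case (add \<beta> U V r)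
  then obtain b \<alpha> where \<beta>: "\<beta> = b # \<alpha>" by (cases \<beta>) auto
  with add have b: "0 \<notin> set (b # \<alpha>)" "b > 0" "0 \<notin> set \<alpha>" "length \<alpha> = k" by auto
  have pos: "0 \<notin> set (\<alpha>[j := \<alpha> ! j + b])" for j
    using b set_update_subset_insert[of \<alpha> j "\<alpha> ! j + b"] by auto
  have col: "col_state (col_weight x A) (b # \<alpha>) (drop_op (col_weight x A) F) =
      power_sum x A b * col_state (col_weight x A) \<alpha> F -
      (\<Sum>j<length \<alpha>. col_state (col_weight x A) (\<alpha>[j := \<alpha> ! j + b]) F)" for F
    by (rule col_state_drop_op[OF b(1)]) (rule col_state_single_drop[OF assms(1,2)])
  have "corresp x A k
      (\<lambda>F. (r * power_sum x A b * color_state x A \<alpha> F +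
        (\<Sum>j<length \<alpha>. (- r) * color_state x A (\<alpha>[j := \<alpha> ! j + b]) F)) + U (\<lambda>ys. F (tl ys)))
      (\<lambda>F. (r * power_sum x A b * col_state (col_weight x A) \<alpha> F +
        (\<Sum>j<length \<alpha>. (- r) * col_state (col_weight x A) (\<alpha>[j := \<alpha> ! j + b]) F)) +
        V (drop_op (col_weight x A) F))"
    using b pos by (intro corresp_add corresp_sum corresp_base add.IH) auto
  then show ?case
    unfolding \<beta> color_state_Cons_tl[OF assms(1)] col
    by (simp add: sum_distrib_left sum_negf right_diff_distrib mult.assoc)
qed (rule corresp.zero)

text \<open>The only composition of length 0 is empty, and both of its states are evaluation at
  \<open>[]\<close>.\<close>

lemma corresp_0:
  assumes "corresp x A 0 U V"
  shows "\<exists>r. (\<forall>F. U F = r * F []) \<and> (\<forall>F. V F = r * F [])"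
  using assms
proof (induction rule: corresp.induct)
  case zero
  show ?case by (rule exI[of _ 0]) simp
next
  case (add \<alpha> U V r)
  then obtain s where "\<forall>F. U F = s * F []" "\<forall>F. V F = s * F []" by blast
  with add.hyps show ?case by (intro exI[of _ "r + s"]) (simp add: distrib_right)
qed

text \<open>
  Vertex \<open>j\<close> is adjacent to the vertices \<open>r j, \<dots>, j - 1\<close>; a list records the colors or columns of
  the vertices in this order.
\<close>

fun color_sum :: "(nat \<Rightarrow> rat) \<Rightarrow> nat set \<Rightarrow> (nat \<Rightarrow> nat) \<Rightarrow> nat \<Rightarrow> (nat list \<Rightarrow> rat) \<Rightarrow> rat" where
  "color_sum x A r 0 F = F []"
| "color_sum x A r (Suc j) F =
    color_sum x A r j (\<lambda>ys. \<Sum>c\<in>A - set (drop (r j) ys). x c * F (ys @ [c]))"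

fun col_sum :: "(nat \<Rightarrow> nat) \<Rightarrow> nat \<Rightarrow> (nat list \<Rightarrow> rat) \<Rightarrow> rat" where
  "col_sum r 0 F = F []"
| "col_sum r (Suc j) F = col_sum r j (\<lambda>cs. let B = set (drop (r j) cs) in
    \<Sum>q\<in>next_cols B. trans_prob B q * F (cs @ [q]))"

lemma color_sum_cong:
  "(\<And>ys. length ys = j \<Longrightarrow> F ys = G ys) \<Longrightarrow> color_sum x A r j F = color_sum x A r j G"
proof (induction j arbitrary: F G)
  case (Suc j)
  show ?case unfolding color_sum.simps by (rule Suc.IH) (simp add: Suc.prems)
qed simp

lemma col_sum_cong:
  "(\<And>ys. length ys = j \<Longrightarrow> F ys = G ys) \<Longrightarrow> col_sum r j F = col_sum r j G"
proof (induction j arbitrary: F G)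
  case (Suc j)
  show ?case unfolding col_sum.simps Let_def by (rule Suc.IH) (simp add: Suc.prems)
qed simp

text \<open>The s earliest of j vertices are inactive and have paid their weights. Before vertex j
  is added, exactly those below r j are deactivated, so the active window is its neighborhood;
  monotonicity of r ensures that none has to become active again.\<close>

lemma corresp_color_sum_col_sum:
  assumes A: "finite A" "\<And>i. i \<in> A \<Longrightarrow> x i > 0"
    and r: "mono r" "\<And>j. r j \<le> j"
    and s: "s \<le> j" "j > 0 \<Longrightarrow> r (j - 1) \<le> s"
  defines "a \<equiv> col_weight x A"
  shows "corresp x A (j - s) (\<lambda>F. color_sum x A r j (\<lambda>ys. F (drop s ys)))
    (\<lambda>F. col_sum r j (\<lambda>cs. (\<Prod>i<s. a (cs ! i)) * F (drop s cs)))"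
  using s
proof (induction j arbitrary: s)
  case 0
  then show ?case using corresp_base[of "[]" 0 x A 1] by simp
next
  case (Suc j)
  have drop: "corresp x A k (\<lambda>F. color_sum x A r i (\<lambda>ys. F (drop (Suc s) ys)))
      (\<lambda>F. col_sum r i (\<lambda>cs. (\<Prod>i<Suc s. a (cs ! i)) * F (drop (Suc s) cs)))"
    if "corresp x A (Suc k) (\<lambda>F. color_sum x A r i (\<lambda>ys. F (drop s ys)))
      (\<lambda>F. col_sum r i (\<lambda>cs. (\<Prod>i<s. a (cs ! i)) * F (drop s cs)))" "s < i" for s i k
  proof -
    have "color_sum x A r i (\<lambda>ys. F (tl (drop s ys))) = color_sum x A r i (\<lambda>ys. F (drop (Suc s) ys))" for F
      by (simp add: drop_Suc tl_drop)
    moreover have "col_sum r i (\<lambda>cs. (\<Prod>i<s. a (cs ! i)) * drop_op a F (drop s cs)) =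
        col_sum r i (\<lambda>cs. (\<Prod>i<Suc s. a (cs ! i)) * F (drop (Suc s) cs))" for F
      using that(2) by (intro col_sum_cong) (simp add: drop_op_def hd_drop_conv_nth drop_Suc tl_drop mult.assoc)
    ultimately show ?thesis
      using corresp_step_drop[OF A that(1)] by (simp add: a_def)
  qed
  have "corresp x A (j - r j) (\<lambda>F. color_sum x A r j (\<lambda>ys. F (drop (r j) ys)))
    (\<lambda>F. col_sum r j (\<lambda>cs. (\<Prod>i<r j. a (cs ! i)) * F (drop (r j) cs)))"
    using r by (intro Suc.IH) (auto intro: monoD)
  from corresp_step_add[OF A(1) this]
  have "corresp x A (Suc j - r j)
    (\<lambda>F. color_sum x A r j (\<lambda>ys. color_add_op x A F (drop (r j) ys)))
    (\<lambda>F. col_sum r j (\<lambda>cs. (\<Prod>i<r j. a (cs ! i)) * add_op F (drop (r j) cs)))"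
    using r(2)[of j] by (simp add: Suc_diff_le)
  moreover have "color_sum x A r j (\<lambda>ys. color_add_op x A F (drop (r j) ys)) =
      color_sum x A r (Suc j) (\<lambda>ys. F (drop (r j) ys))" for F
    unfolding color_sum.simps using r(2)[of j]
    by (intro color_sum_cong) (simp add: color_add_op_def)
  moreover have "col_sum r j (\<lambda>cs. (\<Prod>i<r j. a (cs ! i)) * add_op F (drop (r j) cs)) =
      col_sum r (Suc j) (\<lambda>cs. (\<Prod>i<r j. a (cs ! i)) * F (drop (r j) cs))" for F
    unfolding col_sum.simps Let_def using r(2)[of j]
    by (intro col_sum_cong) (simp add: add_op_def sum_distrib_left nth_append mult_ac)
  ultimately have start: "corresp x A (Suc j - r j) (\<lambda>F. color_sum x A r (Suc j) (\<lambda>ys. F (drop (r j) ys)))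
    (\<lambda>F. col_sum r (Suc j) (\<lambda>cs. (\<Prod>i<r j. a (cs ! i)) * F (drop (r j) cs)))"
    by (simp del: color_sum.simps col_sum.simps)
  from Suc.prems(2) have "r j \<le> s" by simp
  then show ?case using Suc.prems(1)
  proof (induction s rule: dec_induct)
    case base
    show ?case by (fact start)
  next
    case (step s)
    then have "Suc j - s = Suc (Suc j - Suc s)" by simp
    with step show ?case by (intro drop) auto
  qed
qed

text \<open>Deactivating all n vertices leaves an empty window, and both functionals become the same
  scalar.\<close>

lemma color_sum_eq_col_sum:
  assumes "finite A" "\<And>i. i \<in> A \<Longrightarrow> x i > 0" "mono r" "\<And>j. r j \<le> j"
  shows "color_sum x A r n (\<lambda>_. 1) = col_sum r n (\<lambda>cs. \<Prod>i<n. col_weight x A (cs ! i))"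
proof -
  have "corresp x A (n - n) (\<lambda>F. color_sum x A r n (\<lambda>ys. F (drop n ys)))
    (\<lambda>F. col_sum r n (\<lambda>cs. (\<Prod>i<n. col_weight x A (cs ! i)) * F (drop n cs)))"
    using assms by (intro corresp_color_sum_col_sum) (auto intro: le_trans[OF _ diff_le_self])
  then have "corresp x A 0 (\<lambda>F. color_sum x A r n (\<lambda>ys. F (drop n ys)))
    (\<lambda>F. col_sum r n (\<lambda>cs. (\<Prod>i<n. col_weight x A (cs ! i)) * F (drop n cs)))"
    by simp
  from corresp_0[OF this] obtain t where
    "\<And>F. color_sum x A r n (\<lambda>ys. F (drop n ys)) = t * F []"
    "\<And>F. col_sum r n (\<lambda>cs. (\<Prod>i<n. col_weight x A (cs ! i)) * F (drop n cs)) = t * F []"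
    by blast
  from this(1)[of "\<lambda>_. 1"] this(2)[of "\<lambda>_. 1"] show ?thesis by simp
qed

text \<open>Lattice (Yamanouchi) words: after every vertex the column occupancies form a
  partition.\<close>

definition ballot :: "nat list \<Rightarrow> bool" where
  "ballot cs \<longleftrightarrow> (\<forall>m d. count_list (take m cs) (Suc d) \<le> count_list (take m cs) d)"

lemma ballot_appendD: "ballot (cs @ ds) \<Longrightarrow> ballot cs"
  unfolding ballot_def
proof (intro allI)
  fix m d
  assume *: "\<forall>m d. count_list (take m (cs @ ds)) (Suc d) \<le> count_list (take m (cs @ ds)) d"
  show "count_list (take m cs) (Suc d) \<le> count_list (take m cs) d"
    using *[rule_format, of "min m (length cs)" d] by (simp add: min_def split: if_splits)
qed

lemma ballot_count: "ballot cs \<Longrightarrow> count_list cs (Suc d) \<le> count_list cs d"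
  unfolding ballot_def by (metis take_all_iff order_refl)

text \<open>Column d + 1 has nonzero probability only if d is active and d + 1 is not. Cutting
  before the last active d leaves a ballot prefix, followed by an extra d and no d + 1, which makes
  the inequality strict.\<close>

lemma ballot_snoc:
  assumes "ballot cs" "trans_prob (set (drop r cs)) q \<noteq> 0"
  shows "ballot (cs @ [q])"
proof -
  have main: "count_list (cs @ [q]) (Suc d) \<le> count_list (cs @ [q]) d" for d
  proof (cases "q = Suc d")
    case True
    have d: "d \<in> set (drop r cs)" "Suc d \<notin> set (drop r cs)"
      using assms(2) trans_prob_mem[of "set (drop r cs)" q] True
      by (auto simp: trans_prob_def split: if_splits)
    from split_list_last[OF d(1)] obtain us vs where uv: "drop r cs = us @ d # vs" "d \<notin> set vs" by blast
    have cs: "cs = (take r cs @ us) @ (d # vs)" by (metis append_assoc append_take_drop_id uv(1))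
    have "Suc d \<notin> set (d # vs)" using d uv by auto
    then have "count_list (d # vs) (Suc d) = 0" by (metis count_list_0_iff)
    moreover have "count_list (take r cs @ us) (Suc d) \<le> count_list (take r cs @ us) d"
      using cs assms(1) by (metis ballot_appendD ballot_count)
    ultimately have "count_list cs (Suc d) < count_list cs d"
      by (subst (1 2) cs) (simp add: uv)
    then show ?thesis using True by simp
  next
    case False
    with ballot_count[OF assms(1), of d] show ?thesis by simp
  qed
  show ?thesis unfolding ballot_def
  proof (intro allI)
    fix m d
    show "count_list (take m (cs @ [q])) (Suc d) \<le> count_list (take m (cs @ [q])) d"
    proof (cases "m \<le> length cs")
      case True
      then show ?thesis using assms(1) by (simp add: ballot_def)
    next
      case False
      then have "take m (cs @ [q]) = cs @ [q]" by simp
      then show ?thesis using main by simp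
    qed
  qed
qed

text \<open>Each extension keeps only columns of nonzero probability; this is what makes every
  sequence in S a ballot sequence.\<close>

lemma col_sum_expand:
  "\<exists>S w. finite S \<and> (\<forall>cs\<in>S. length cs = n \<and> ballot cs \<and> w cs \<ge> 0) \<and>
    (\<forall>F. col_sum r n F = (\<Sum>cs\<in>S. w cs * F cs))"
proof (induction n)
  case 0
  show ?case by (intro exI[of _ "{[]}"] exI[of _ "\<lambda>_. 1"]) (simp add: ballot_def)
next
  case (Suc n)
  then obtain S w where S: "finite S" "\<forall>cs\<in>S. length cs = n \<and> ballot cs \<and> w cs \<ge> 0"
    and w: "\<And>F. col_sum r n F = (\<Sum>cs\<in>S. w cs * F cs)" by blast
  define B where "B cs = set (drop (r n) cs)" for cs :: "nat list"
  define Q where "Q cs = {q \<in> next_cols (B cs). trans_prob (B cs) q \<noteq> 0}" for cs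
  have fQ: "finite (Q cs)" for cs by (simp add: Q_def B_def)
  define S' where "S' = (\<lambda>(cs, q). cs @ [q]) ` (SIGMA cs:S. Q cs)"
  define w' where "w' ds = w (butlast ds) * trans_prob (B (butlast ds)) (last ds)" for ds
  have "col_sum r (Suc n) F = (\<Sum>ds\<in>S'. w' ds * F ds)" for F
  proof -
    have "col_sum r (Suc n) F = (\<Sum>cs\<in>S. w cs * (\<Sum>q\<in>next_cols (B cs). trans_prob (B cs) q * F (cs @ [q])))"
      by (simp add: w Let_def B_def)
    also have "\<dots> = (\<Sum>cs\<in>S. w cs * (\<Sum>q\<in>Q cs. trans_prob (B cs) q * F (cs @ [q])))"
      by (intro sum.cong refl arg_cong2[where f = "(*)"] sum.mono_neutral_right) (auto simp: Q_def B_def)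
    also have "\<dots> = (\<Sum>(cs, q)\<in>(SIGMA cs:S. Q cs). w' (cs @ [q]) * F (cs @ [q]))"
      using S(1) fQ by (simp add: sum_distrib_left sum.Sigma w'_def mult.assoc)
    also have "\<dots> = (\<Sum>ds\<in>S'. w' ds * F ds)"
      unfolding S'_def by (subst sum.reindex) (auto simp: inj_on_def case_prod_unfold)
    finally show ?thesis .
  qed
  moreover have "finite S'" using S(1) fQ by (auto simp: S'_def)
  moreover have "length ds = Suc n \<and> ballot ds \<and> w' ds \<ge> 0" if "ds \<in> S'" for ds
    using that S(2) by (auto simp: S'_def w'_def Q_def B_def trans_prob_nonneg intro!: ballot_snoc)
  ultimately show ?case by blast
qed

text \<open>A vertex in column 0 creates a part 1, and one in column q > 0 enlarges a part q to q +
  1. The count formula with the ballot condition guarantees that such a part exists, and the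
  quotients telescope.\<close>

lemma ballot_shape:
  assumes "ballot cs"
  shows "\<exists>\<mu>. \<mu> \<in> partitions_of (length cs) \<and>
    (\<forall>d. count \<mu> (Suc d) = count_list cs d - count_list cs (Suc d)) \<and>
    (\<forall>e :: nat \<Rightarrow> rat. e 0 = 1 \<longrightarrow> (\<forall>k\<le>length cs. e k \<noteq> 0) \<longrightarrow>
      (\<Prod>i<length cs. e (Suc (cs ! i)) / e (cs ! i)) = (\<Prod>k\<in>#\<mu>. e k))"
  using assms
proof (induction cs rule: rev_induct)
  case Nil
  show ?case by (rule exI[of _ "{#}"]) (simp add: partitions_of_def)
next
  case (snoc q cs)
  from snoc.prems have b: "ballot cs" by (rule ballot_appendD)
  with snoc.IH obtain \<mu> where \<mu>: "\<mu> \<in> partitions_of (length cs)"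
    "\<And>d. count \<mu> (Suc d) = count_list cs d - count_list cs (Suc d)"
    "\<And>e :: nat \<Rightarrow> rat. e 0 = 1 \<Longrightarrow> \<forall>k\<le>length cs. e k \<noteq> 0 \<Longrightarrow>
      (\<Prod>i<length cs. e (Suc (cs ! i)) / e (cs ! i)) = (\<Prod>k\<in>#\<mu>. e k)" by blast
  have prod: "(\<Prod>i<length (cs @ [q]). e (Suc ((cs @ [q]) ! i)) / e ((cs @ [q]) ! i)) =
      (\<Prod>k\<in>#\<mu>. e k) * (e (Suc q) / e q)"
    if "e 0 = 1" "\<forall>k\<le>length (cs @ [q]). e k \<noteq> 0" for e :: "nat \<Rightarrow> rat"
    using \<mu>(3)[of e] that by (simp add: nth_append)
  show ?case
  proof (cases q)
    case 0
    have 1: "add_mset 1 \<mu> \<in> partitions_of (length (cs @ [q]))"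
      using \<mu>(1) by (auto simp: partitions_of_def)
    have 2: "count (add_mset 1 \<mu>) (Suc d) = count_list (cs @ [q]) d - count_list (cs @ [q]) (Suc d)" for d
      using \<mu>(2)[of d] ballot_count[OF b, of 0] 0 by auto
    have 3: "(\<Prod>k\<in>#\<mu>. e k) * (e (Suc q) / e q) = (\<Prod>k\<in>#add_mset 1 \<mu>. e k)" if "e 0 = 1" for e :: "nat \<Rightarrow> rat"
      using that 0 by simp
    show ?thesis
    proof (rule exI[of _ "add_mset 1 \<mu>"], intro conjI allI impI)
      fix e :: "nat \<Rightarrow> rat" assume e: "e 0 = 1" "\<forall>k\<le>length (cs @ [q]). e k \<noteq> 0"
      show "(\<Prod>i<length (cs @ [q]). e (Suc ((cs @ [q]) ! i)) / e ((cs @ [q]) ! i)) =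
          (\<Prod>k\<in>#add_mset 1 \<mu>. e k)"
        unfolding prod[of e, OF e] using 3[of e] e(1) by simp
    qed (rule 1 2)+
  next
    case (Suc d)
    have lt: "count_list cs (Suc d) < count_list cs d"
      using ballot_count[OF snoc.prems, of d] Suc by simp
    then have mem: "Suc d \<in># \<mu>" using \<mu>(2)[of d] by (simp flip: count_greater_zero_iff)
    then obtain \<nu> where \<nu>: "\<mu> = add_mset (Suc d) \<nu>" by (meson mset_add)
    define \<mu>' where "\<mu>' = add_mset (Suc q) \<nu>"
    have 1: "\<mu>' \<in> partitions_of (length (cs @ [q]))"
      using \<mu>(1) by (auto simp: partitions_of_def \<mu>'_def \<nu> Suc)
    have 2: "count \<mu>' (Suc k) = count_list (cs @ [q]) k - count_list (cs @ [q]) (Suc k)" for k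
      using \<mu>(2)[of k] lt ballot_count[OF b, of "Suc d"] by (auto simp: \<mu>'_def \<nu> Suc split: if_splits)
    have le: "Suc d \<le> length cs"
      using \<mu>(1) by (auto simp: partitions_of_def \<nu>)
    show ?thesis
    proof (rule exI[of _ \<mu>'], intro conjI allI impI)
      fix e :: "nat \<Rightarrow> rat" assume e: "e 0 = 1" "\<forall>k\<le>length (cs @ [q]). e k \<noteq> 0"
      with le have "e (Suc d) \<noteq> 0" by simp
      then show "(\<Prod>i<length (cs @ [q]). e (Suc ((cs @ [q]) ! i)) / e ((cs @ [q]) ! i)) =
          (\<Prod>k\<in>#\<mu>'. e k)"
        unfolding prod[of e, OF e] by (simp add: \<mu>'_def \<nu> Suc)
    qed (rule 1 2)+
  qed
qed

text \<open>C is fixed before x and A, so one expansion holds at all points. At least n positive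
  variables make e_0, ..., e_n nonzero, as the telescoping requires.\<close>

lemma color_sum_e_positive:
  assumes "mono r" "\<And>j. r j \<le> j"
  obtains C where "\<And>\<mu>. C \<mu> \<ge> 0"
    "\<And>x A. finite A \<Longrightarrow> (\<And>i. i \<in> A \<Longrightarrow> x i > 0) \<Longrightarrow> card A \<ge> n \<Longrightarrow>
      color_sum x A r n (\<lambda>_. 1) = (\<Sum>\<mu>\<in>partitions_of n. C \<mu> * (\<Prod>k\<in>#\<mu>. esym x A k))"
proof -
  obtain S w where S: "finite S" "\<forall>cs\<in>S. length cs = n \<and> ballot cs \<and> w cs \<ge> 0"
    and w: "\<And>F. col_sum r n F = (\<Sum>cs\<in>S. w cs * F cs)"
    using col_sum_expand[of n r] by blast
  define P where "P cs \<mu> \<longleftrightarrow> \<mu> \<in> partitions_of n \<and>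
    (\<forall>e :: nat \<Rightarrow> rat. e 0 = 1 \<longrightarrow> (\<forall>k\<le>n. e k \<noteq> 0) \<longrightarrow>
      (\<Prod>i<n. e (Suc (cs ! i)) / e (cs ! i)) = (\<Prod>k\<in>#\<mu>. e k))" for cs \<mu>
  have "\<exists>\<mu>. P cs \<mu>" if "cs \<in> S" for cs
    using ballot_shape[of cs] S(2) that unfolding P_def by auto
  then obtain sh where sh: "\<And>cs. cs \<in> S \<Longrightarrow> P cs (sh cs)"
    using bchoice[of S P] by blast
  \<comment> \<open>The factors c + 1 of the column weights are collected separately: a part k
    covers columns 0, ..., k - 1, so their product is the product of the factorials of the
    parts.\<close>
  define v where "v cs = w cs * (\<Prod>i<n. of_nat (Suc (cs ! i)))" for cs
  define C where "C \<mu> = (\<Sum>cs | cs \<in> S \<and> sh cs = \<mu>. v cs)" for \<mu>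
  have "C \<mu> \<ge> 0" for \<mu>
    unfolding C_def v_def using S(2) by (intro sum_nonneg mult_nonneg_nonneg prod_nonneg) auto
  moreover have "color_sum x A r n (\<lambda>_. 1) = (\<Sum>\<mu>\<in>partitions_of n. C \<mu> * (\<Prod>k\<in>#\<mu>. esym x A k))"
    if A: "finite A" "\<And>i. i \<in> A \<Longrightarrow> x i > 0" "card A \<ge> n" for x A
  proof -
    have nz: "\<forall>k\<le>n. esym x A k \<noteq> 0"
    proof (intro allI impI)
      fix k assume "k \<le> n"
      then have "esym x A k > 0" by (intro esym_pos A le_trans[OF _ A(3)])
      then show "esym x A k \<noteq> 0" by simp
    qed
    have "color_sum x A r n (\<lambda>_. 1) = (\<Sum>cs\<in>S. w cs * (\<Prod>i<n. col_weight x A (cs ! i)))"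
      using color_sum_eq_col_sum[OF A(1,2) assms] w by simp
    also have "\<dots> = (\<Sum>cs\<in>S. v cs * (\<Prod>k\<in>#sh cs. esym x A k))"
    proof (intro sum.cong refl)
      fix cs assume "cs \<in> S"
      with sh[of cs] nz A(1)
      have "(\<Prod>i<n. esym x A (Suc (cs ! i)) / esym x A (cs ! i)) = (\<Prod>k\<in>#sh cs. esym x A k)" unfolding P_def by simp
      then show "w cs * (\<Prod>i<n. col_weight x A (cs ! i)) = v cs * (\<Prod>k\<in>#sh cs. esym x A k)"
        unfolding v_def col_weight_def times_divide_eq_right[symmetric] prod.distrib
        by (simp only: mult.assoc)
    qed
    also have "\<dots> = (\<Sum>\<mu>\<in>partitions_of n. \<Sum>cs | cs \<in> S \<and> sh cs = \<mu>. v cs * (\<Prod>k\<in>#sh cs. esym x A k))"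
      using S(1) sh finite_partitions_of by (intro sum.group[symmetric]) (auto simp: P_def)
    also have "\<dots> = (\<Sum>\<mu>\<in>partitions_of n. C \<mu> * (\<Prod>k\<in>#\<mu>. esym x A k))"
      by (simp add: C_def sum_distrib_right)
    finally show ?thesis .
  qed
  ultimately show ?thesis by (rule that)
qed

section \<open>Products of elementary symmetric functions\<close>

lemma mcoeff_sum [simp]: "mcoeff (\<Sum>i\<in>I. F i) m = (\<Sum>i\<in>I. mcoeff (F i :: 'a::comm_ring_1 mfps) m)"
  by (induction I rule: infinite_finite_induct) auto

lemma mcoeff_mconst_mult [simp]:
  "mcoeff (mconst c * F) m = c * mcoeff (F :: 'a::comm_ring_1 mfps) m"
proof -
  have "mcoeff (mconst c * F) m = (\<Sum>a\<in>{{#}}. mcoeff (mconst c) a * mcoeff F (m - a))"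
    unfolding mcoeff_mult by (rule sum.mono_neutral_right) (auto simp: mconst_def)
  then show ?thesis by (simp add: mconst_def)
qed

lemma mcoeff_mconst: "mcoeff (mconst c) m = (if m = {#} then c else 0)"
  by (simp add: mconst_def)

lemma mconst_mult: "mconst (a * b :: 'a::comm_ring_1) = mconst a * mconst b"
  by (simp add: mfps_eq_iff) (simp add: mcoeff_mconst)

lemma mconst_1: "mconst (1 :: 'a::comm_ring_1) = 1"
  by (simp add: mfps_eq_iff mconst_def mcoeff_1)

definition homogeneous :: "nat \<Rightarrow> 'a::comm_ring_1 mfps \<Rightarrow> bool" where
  "homogeneous d F \<longleftrightarrow> (\<forall>m. mcoeff F m \<noteq> 0 \<longrightarrow> size m = d)"

definition perm_invariant :: "'a::comm_ring_1 mfps \<Rightarrow> bool" where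
  "perm_invariant F \<longleftrightarrow> (\<forall>\<pi> m. bij \<pi> \<longrightarrow> mcoeff F (image_mset \<pi> m) = mcoeff F m)"

lemma homogeneous_1: "homogeneous 0 1"
  by (auto simp: homogeneous_def mcoeff_1 split: if_splits)

lemma mcoeff_mult_nonzeroE:
  assumes "mcoeff (F * G :: 'a::comm_ring_1 mfps) m \<noteq> 0"
  obtains a where "a \<subseteq># m" "mcoeff F a \<noteq> 0" "mcoeff G (m - a) \<noteq> 0"
proof -
  from assms have "\<not> (\<forall>a. a \<subseteq># m \<longrightarrow> mcoeff F a * mcoeff G (m - a) = 0)"
    unfolding mcoeff_mult by (metis (mono_tags, lifting) mem_Collect_eq sum.neutral)
  then show ?thesis using that by fastforce
qed

lemma homogeneous_mult: "homogeneous d F \<Longrightarrow> homogeneous e G \<Longrightarrow> homogeneous (d + e) (F * G)"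
  unfolding homogeneous_def
  by (metis mcoeff_mult_nonzeroE size_union subset_mset.add_diff_inverse)

lemma perm_invariant_mult:
  assumes "perm_invariant F" "perm_invariant G"
  shows "perm_invariant (F * G)"
  unfolding perm_invariant_def
proof (intro allI impI)
  fix \<pi> :: "nat \<Rightarrow> nat" and m assume \<pi>: "bij \<pi>"
  then have inv: "image_mset (inv \<pi>) (image_mset \<pi> a) = a" "image_mset \<pi> (image_mset (inv \<pi>) a) = a" for a
    by (simp_all add: multiset.map_comp o_def bij_is_inj bij_is_surj surj_f_inv_f)
  show "mcoeff (F * G) (image_mset \<pi> m) = mcoeff (F * G) m"
    unfolding mcoeff_mult
  proof (rule sum.reindex_bij_witness[of _ "image_mset \<pi>" "image_mset (inv \<pi>)"], goal_cases)
    case (1 a)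
    then show ?case using inv by simp
  next
    case (2 a)
    then have "image_mset (inv \<pi>) a \<subseteq># image_mset (inv \<pi>) (image_mset \<pi> m)"
      using image_mset_subseteq_mono by blast
    then show ?case using inv by simp
  next
    case (3 a)
    then show ?case using inv by simp
  next
    case (4 a)
    then show ?case by (simp add: image_mset_subseteq_mono)
  next
    case (5 a)
    then have "a \<subseteq># image_mset \<pi> m" by simp
    moreover have "image_mset (inv \<pi>) (image_mset \<pi> m - a) = m - image_mset (inv \<pi>) a"
      using 5 inv by (simp add: image_mset_Diff)
    ultimately show ?case using assms \<pi> unfolding perm_invariant_def by (metis bij_imp_bij_inv)
  qed
qed

lemma symmetric_functions_iff:
  "F \<in> symmetric_functions \<longleftrightarrow> (\<exists>d. \<forall>m. mcoeff F m \<noteq> 0 \<longrightarrow> size m \<le> d) \<and> perm_invariant F"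
  by (simp add: symmetric_functions_def perm_invariant_def)

lemma homogeneous_symmetric: "homogeneous d F \<Longrightarrow> perm_invariant F \<Longrightarrow> F \<in> symmetric_functions"
  unfolding symmetric_functions_iff homogeneous_def by auto

lemma symmetric_0: "0 \<in> symmetric_functions"
  by (simp add: symmetric_functions_iff perm_invariant_def)

lemma symmetric_add:
  assumes "F \<in> symmetric_functions" "G \<in> symmetric_functions"
  shows "F + G \<in> symmetric_functions"
proof -
  from assms obtain d e where "\<forall>m. mcoeff F m \<noteq> 0 \<longrightarrow> size m \<le> d" "\<forall>m. mcoeff G m \<noteq> 0 \<longrightarrow> size m \<le> e"
    unfolding symmetric_functions_iff by blast
  then have "mcoeff (F + G) m \<noteq> 0 \<longrightarrow> size m \<le> max d e" for m
    by (cases "mcoeff F m = 0"; cases "mcoeff G m = 0") (auto simp: max_def intro: order_trans)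
  moreover have "perm_invariant (F + G)"
    using assms by (simp add: symmetric_functions_iff perm_invariant_def)
  ultimately show ?thesis unfolding symmetric_functions_iff by blast
qed

lemma symmetric_mconst_mult: "F \<in> symmetric_functions \<Longrightarrow> mconst c * F \<in> symmetric_functions"
  unfolding symmetric_functions_iff perm_invariant_def mcoeff_mconst_mult by (metis mult_zero_right)

lemma symmetric_sum:
  "(\<And>i. i \<in> I \<Longrightarrow> F i \<in> symmetric_functions) \<Longrightarrow> (\<Sum>i\<in>I. F i) \<in> symmetric_functions"
  by (induction I rule: infinite_finite_induct) (auto intro: symmetric_0 symmetric_add)

lemma mset_set_set_mset_squarefree:
  assumes "\<forall>i. count m i \<le> 1"
  shows "mset_set (set_mset m) = m"
  using assms
  by (intro multiset_eqI) (metis One_nat_def count_eq_zero_iff count_mset_set' finite_set_mset le_Suc_eq le_zero_eq)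

lemma mcoeff_elementary: "mcoeff (elementary_sf k :: 'a::comm_ring_1 mfps) m =
    (if (\<forall>i. count m i \<le> 1) \<and> size m = k then 1 else 0)"
proof (cases "(\<forall>i. count m i \<le> 1) \<and> size m = k")
  case True
  then have m: "mset_set (set_mset m) = m" by (simp add: mset_set_set_mset_squarefree)
  have "{S. finite S \<and> card S = k \<and> mset_set S = m} = {set_mset m}"
  proof (intro equalityI subsetI)
    fix S assume "S \<in> {S. finite S \<and> card S = k \<and> mset_set S = m}"
    then show "S \<in> {set_mset m}" by auto
  next
    fix S assume "S \<in> {set_mset m}"
    moreover have "card (set_mset m) = k" using True m by (metis size_mset_set)
    ultimately show "S \<in> {S. finite S \<and> card S = k \<and> mset_set S = m}" using m by simp
  qed
  then have "card {S \<in> {S. finite S \<and> card S = k}. mset_set S = m} = 1"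
    by (simp add: conj_assoc)
  with True show ?thesis by (simp add: elementary_sf_def monomial_sum_def)
next
  case False
  then have "{S \<in> {S. finite S \<and> card S = k}. mset_set S = m} = {}"
    by (auto simp: count_mset_set' split: if_splits)
  with False show ?thesis by (simp only: elementary_sf_def monomial_sum_def mcoeff_Abs) simp
qed

lemma mcoeff_homogeneous_sf:
  "mcoeff (homogeneous_sf k :: 'a::comm_ring_1 mfps) m = (if size m = k then 1 else 0)"
proof -
  have "{n \<in> {n. size n = k}. id n = m} = (if size m = k then {m} else {})" by auto
  then show ?thesis by (simp add: homogeneous_sf_def monomial_sum_def)
qed

lemma homogeneous_elementary: "homogeneous k (elementary_sf k)"
  by (simp add: homogeneous_def mcoeff_elementary)

lemma homogeneous_homogeneous_sf: "homogeneous k (homogeneous_sf k)"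
  by (simp add: homogeneous_def mcoeff_homogeneous_sf)

lemma count_image_mset_bij: "bij \<pi> \<Longrightarrow> count (image_mset \<pi> m) (\<pi> i) = count m i"
  by (induction m) (auto dest: bij_is_inj simp: inj_eq)

lemma perm_invariant_elementary: "perm_invariant (elementary_sf k)"
proof -
  have "(\<forall>i. count (image_mset \<pi> m) i \<le> 1) \<longleftrightarrow> (\<forall>i. count m i \<le> 1)"
    if "bij \<pi>" for \<pi> :: "nat \<Rightarrow> nat" and m
    using that by (metis bij_pointE count_image_mset_bij)
  then show ?thesis by (simp add: perm_invariant_def mcoeff_elementary)
qed

lemma perm_invariant_homogeneous_sf: "perm_invariant (homogeneous_sf k)"
  by (simp add: perm_invariant_def mcoeff_homogeneous_sf)

lemma elementary_0: "elementary_sf 0 = 1"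
  by (auto simp: mfps_eq_iff mcoeff_elementary mcoeff_1)

lemma homogeneous_sf_0: "homogeneous_sf 0 = 1"
  by (auto simp: mfps_eq_iff mcoeff_homogeneous_sf mcoeff_1)

definition elementary_prod :: "nat multiset \<Rightarrow> 'a::comm_ring_1 mfps" where
  "elementary_prod \<mu> = (\<Prod>k\<in>#\<mu>. elementary_sf k)"

lemma elementary_prod_simps [simp]:
  "elementary_prod {#} = 1"
  "elementary_prod (add_mset k \<mu>) = elementary_sf k * elementary_prod \<mu>"
  "elementary_prod (\<mu> + \<nu>) = elementary_prod \<mu> * elementary_prod \<nu>"
  by (simp_all add: elementary_prod_def)

lemma homogeneous_prod_simps [simp]:
  "homogeneous_prod {#} = 1"
  "homogeneous_prod (add_mset k \<mu>) = homogeneous_sf k * homogeneous_prod \<mu>"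
  "homogeneous_prod (\<mu> + \<nu>) = homogeneous_prod \<mu> * homogeneous_prod \<nu>"
  by (simp_all add: homogeneous_prod_def)

lemma perm_invariant_1: "perm_invariant 1"
  by (simp add: perm_invariant_def mcoeff_1)

lemma homogeneous_elementary_prod: "homogeneous (sum_mset \<mu>) (elementary_prod \<mu>)"
  by (induction \<mu>) (auto intro: homogeneous_1 homogeneous_mult homogeneous_elementary)

lemma perm_invariant_elementary_prod: "perm_invariant (elementary_prod \<mu>)"
  by (induction \<mu>) (auto intro: perm_invariant_1 perm_invariant_mult perm_invariant_elementary)

lemma homogeneous_homogeneous_prod: "homogeneous (sum_mset \<mu>) (homogeneous_prod \<mu>)"
  by (induction \<mu>) (auto intro: homogeneous_1 homogeneous_mult homogeneous_homogeneous_sf)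

lemma perm_invariant_homogeneous_prod: "perm_invariant (homogeneous_prod \<mu>)"
  by (induction \<mu>) (auto intro: perm_invariant_1 perm_invariant_mult perm_invariant_homogeneous_sf)

lemma symmetric_elementary_prod: "elementary_prod \<mu> \<in> symmetric_functions"
  by (rule homogeneous_symmetric[OF homogeneous_elementary_prod perm_invariant_elementary_prod])

lemma symmetric_homogeneous_prod: "homogeneous_prod \<mu> \<in> symmetric_functions"
  by (rule homogeneous_symmetric[OF homogeneous_homogeneous_prod perm_invariant_homogeneous_prod])

lemma symmetric_elementary: "elementary_sf k \<in> symmetric_functions"
  using symmetric_elementary_prod[of "{#k#}"] by simp

lemma symmetric_homogeneous_sf: "homogeneous_sf k \<in> symmetric_functions"
  using symmetric_homogeneous_prod[of "{#k#}"] by simp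

lemma elementary_prod_int: "mcoeff (elementary_prod \<mu> :: 'a::comm_ring_1 mfps) m \<in> \<int>"
proof (induction \<mu> arbitrary: m)
  case (add k \<mu>)
  then show ?case by (auto simp: mcoeff_mult mcoeff_elementary intro!: Ints_sum)
qed (simp add: mcoeff_1)

text \<open>
  The weight \<open>\<Sum>\<^sub>i m\<^sub>i B\<^bsup>N - i\<^esup>\<close> of an exponent vector orders the monomials of degree below \<open>B\<close>
  in the first \<open>N\<close> variables lexicographically.
\<close>

definition mon_weight :: "nat \<Rightarrow> nat \<Rightarrow> nat multiset \<Rightarrow> nat" where
  "mon_weight B N m = (\<Sum>i<N. count m i * B ^ (N - i))"

lemma mon_weight_add: "mon_weight B N (m + n) = mon_weight B N m + mon_weight B N n"
  by (simp add: mon_weight_def sum.distrib distrib_right)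

lemma mon_weight_Suc: "mon_weight B (Suc N) m = B * (mon_weight B N m + count m N)"
proof -
  have "(\<Sum>i<N. count m i * B ^ (Suc N - i)) = B * (\<Sum>i<N. count m i * B ^ (N - i))"
    by (simp add: sum_distrib_left Suc_diff_le mult_ac)
  then show ?thesis by (simp add: mon_weight_def distrib_left mult.commute)
qed

text \<open>All exponents N - i with i < N are at least 1. Thus, after division by B, the exponent
  of the last variable is the lowest digit of the weight.\<close>

lemma dvd_mon_weight: "B dvd mon_weight B N m"
  by (cases N) (simp_all add: mon_weight_Suc, simp add: mon_weight_def)

lemma mon_weight_inj_count:
  assumes "mon_weight B N m = mon_weight B N n" "\<And>i. count m i < B" "\<And>i. count n i < B" "i < N"
  shows "count m i = count n i"
  using assms(1,4)
proof (induction N)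
  case (Suc N)
  have "B > 0" using assms(2)[of 0] by simp
  with Suc.prems(1) have *: "mon_weight B N m + count m N = mon_weight B N n + count n N"
    by (simp add: mon_weight_Suc)
  then have "(mon_weight B N m + count m N) mod B = (mon_weight B N n + count n N) mod B" by simp
  moreover have "mon_weight B N m mod B = 0" "mon_weight B N n mod B = 0"
    using dvd_mon_weight by auto
  ultimately have "count m N = count n N"
    using assms(2,3)[of N] by (metis add_0 mod_add_left_eq mod_less)
  with * Suc show ?case by (cases "i = N") auto
qed simp

definition monomials :: "nat \<Rightarrow> nat set \<Rightarrow> nat multiset set" where
  "monomials d A = {m. set_mset m \<subseteq> A \<and> size m = d}"

lemma finite_monomials [simp]: "finite A \<Longrightarrow> finite (monomials d A)"
proof (rule finite_subset)
  show "monomials d A \<subseteq> mset ` {xs. set xs \<subseteq> A \<and> length xs = d}"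
  proof
    fix m assume "m \<in> monomials d A"
    moreover obtain xs where "mset xs = m" using ex_mset by blast
    ultimately show "m \<in> mset ` {xs. set xs \<subseteq> A \<and> length xs = d}"
      unfolding monomials_def by (intro image_eqI[of _ _ xs]) auto
  qed
qed (simp add: finite_lists_length_eq)

lemma mon_weight_inj:
  assumes "m \<in> monomials d {..<N}" "n \<in> monomials d {..<N}"
    "mon_weight (Suc d) N m = mon_weight (Suc d) N n"
  shows "m = n"
proof (rule multiset_eqI)
  fix i
  have le: "count m j < Suc d" "count n j < Suc d" for j
    using assms(1,2) count_le_size[of m j] count_le_size[of n j] by (auto simp: monomials_def)
  show "count m i = count n i"
  proof (cases "i < N")
    case True
    with mon_weight_inj_count[OF assms(3) le] show ?thesis by simp
  next
    case False
    then have "i \<notin># m" "i \<notin># n" using assms(1,2) by (auto simp: monomials_def)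
    then show ?thesis by (simp add: not_in_iff)
  qed
qed

lemma mon_weight_mset_set:
  assumes "S \<subseteq> {..<N}"
  shows "mon_weight B N (mset_set S) = (\<Sum>i\<in>S. B ^ (N - i))"
proof -
  have "finite S" using assms finite_subset by blast
  then have "mon_weight B N (mset_set S) = (\<Sum>i<N. if i \<in> S then B ^ (N - i) else 0)"
    unfolding mon_weight_def by (intro sum.cong) (auto simp: count_mset_set')
  also have "\<dots> = (\<Sum>i\<in>S. B ^ (N - i))"
    using assms by (subst sum.inter_restrict[symmetric]) (auto simp: Int_absorb1)
  finally show ?thesis .
qed

text \<open>The parts outside the intersection have equally many elements; those of S weigh at most
  B^(N - k) each, those of the initial segment strictly more.\<close>

lemma mon_weight_initial:
  assumes "S \<subseteq> {..<N}" "card S = k" "S \<noteq> {..<k}" "B > 1"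
  shows "mon_weight B N (mset_set S) < mon_weight B N (mset_set {..<k})"
proof -
  have fin: "finite S" using assms(1) finite_subset by blast
  have kN: "k \<le> N" using card_mono[OF _ assms(1)] assms(2) by simp
  let ?w = "\<lambda>i. B ^ (N - i)" and ?K = "{..<k}"
  have c: "card (S - ?K) = card (?K - S)"
    using assms(2) fin by (metis card_lessThan card_le_sym_Diff finite_lessThan le_antisym order_refl)
  have ne: "?K - S \<noteq> {}"
  proof
    assume "?K - S = {}"
    then have "?K \<subseteq> S" by blast
    with assms(2,3) fin show False by (metis card_lessThan card_subset_eq)
  qed
  have "sum ?w (S - ?K) \<le> (\<Sum>i\<in>S - ?K. ?w k)"
    using assms(4) by (intro sum_mono power_increasing) auto
  also have "\<dots> = (\<Sum>i\<in>?K - S. ?w k)" using c by simp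
  also have "\<dots> < sum ?w (?K - S)"
    using ne assms(4) kN by (intro sum_strict_mono power_strict_increasing) auto
  finally have "sum ?w (S - ?K) < sum ?w (?K - S)" .
  moreover have "sum ?w S = sum ?w (S \<inter> ?K) + sum ?w (S - ?K)" "sum ?w ?K = sum ?w (S \<inter> ?K) + sum ?w (?K - S)"
    using fin sum.Int_Diff[of S ?w ?K] sum.Int_Diff[of ?K ?w S] by (simp_all add: Int_commute)
  ultimately show ?thesis
    using assms(1) kN by (simp add: mon_weight_mset_set)
qed

text \<open>The leading monomial of a product of elementary functions is given by the conjugate partition.\<close>

definition conj_mon :: "nat multiset \<Rightarrow> nat multiset" where
  "conj_mon \<mu> = (\<Sum>k\<in>#\<mu>. mset_set {..<k})"

lemma conj_mon_simps [simp]: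
  "conj_mon {#} = {#}" "conj_mon (add_mset k \<mu>) = mset_set {..<k} + conj_mon \<mu>"
  by (simp_all add: conj_mon_def)

lemma size_conj_mon [simp]: "size (conj_mon \<mu>) = sum_mset \<mu>"
  by (induction \<mu>) auto

lemma conj_mon_mem: "i \<in># conj_mon \<mu> \<longleftrightarrow> (\<exists>k\<in>#\<mu>. i < k)"
  by (induction \<mu>) auto

lemma conj_mon_monomials:
  assumes "sum_mset \<mu> = d"
  shows "conj_mon \<mu> \<in> monomials d {..<d}"
proof -
  have "k \<le> d" if "k \<in># \<mu>" for k
    using that assms by (metis le_add1 sum_mset.remove)
  then show ?thesis using assms by (fastforce simp: monomials_def conj_mon_mem)
qed

lemma count_conj_mon: "count (conj_mon \<mu>) i = size {#k \<in># \<mu>. i < k#}"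
  by (induction \<mu>) (auto simp: count_mset_set')

lemma conj_mon_inj:
  assumes "conj_mon \<mu> = conj_mon \<nu>" "0 \<notin># \<mu>" "0 \<notin># \<nu>"
  shows "\<mu> = \<nu>"
proof (rule multiset_eqI)
  have *: "count (conj_mon \<mu>) i = count (conj_mon \<mu>) (Suc i) + count \<mu> (Suc i)" for i \<mu>
    unfolding count_conj_mon by (induction \<mu>) auto
  fix k
  show "count \<mu> k = count \<nu> k"
  proof (cases k)
    case 0
    with assms show ?thesis by (simp add: not_in_iff)
  next
    case (Suc i)
    with *[of \<mu> i] *[of \<nu> i] assms(1) show ?thesis by simp
  qed
qed

text \<open>The support of a weakly decreasing exponent vector is an initial segment {..<k};
  removing it once splits off a part k.\<close>

lemma conj_mon_exists:
  assumes "\<And>i j. i < j \<Longrightarrow> count m j \<le> count m i"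
  obtains \<mu> where "\<mu> \<in> partitions_of (size m)" "conj_mon \<mu> = m"
proof -
  have "\<exists>\<mu>. \<mu> \<in> partitions_of (size m) \<and> conj_mon \<mu> = m"
    using assms
  proof (induction "size m" arbitrary: m rule: less_induct)
    case less
    show ?case
    proof (cases "m = {#}")
      case True
      then show ?thesis by (intro exI[of _ "{#}"]) (simp add: partitions_of_def)
    next
      case False
      define k where "k = card (set_mset m)"
      have k0: "k > 0" using False by (simp add: k_def card_gt_0_iff)
      have dc: "i \<in># m" if "j \<in># m" "i < j" for i j
        using less.prems[OF that(2)] that(1) by (metis count_greater_zero_iff less_le_trans)
      have S: "set_mset m = {..<k}"
      proof -
        define M where "M = Max (set_mset m)"
        have M: "M \<in># m" "\<And>i. i \<in># m \<Longrightarrow> i \<le> M" using False by (auto simp: M_def)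
        have "set_mset m = {..M}"
        proof (intro equalityI subsetI)
          fix i assume "i \<in> {..M}"
          then show "i \<in># m" using dc[OF M(1), of i] M(1) by (cases "i = M") auto
        qed (use M in auto)
        then show ?thesis unfolding k_def by (simp add: lessThan_Suc_atMost)
      qed
      define m' where "m' = m - mset_set {..<k}"
      have sub: "mset_set {..<k} \<subseteq># m"
        unfolding S[symmetric] by (rule mset_set_set_mset_msubset)
      then have m: "m = mset_set {..<k} + m'" by (simp add: m'_def)
      have cm: "count m' i = count m i - 1" for i
        using S not_in_iff[of i m] by (auto simp: m'_def count_mset_set')
      have "\<exists>\<mu>. \<mu> \<in> partitions_of (size m') \<and> conj_mon \<mu> = m'"
        using k0 less.prems unfolding cm
        by (intro less.hyps) (subst m, simp, simp add: cm diff_le_mono)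
      then obtain \<mu> where "\<mu> \<in> partitions_of (size m')" "conj_mon \<mu> = m'" by blast
      then have "add_mset k \<mu> \<in> partitions_of (size m)" "conj_mon (add_mset k \<mu>) = m"
        using k0 m by (auto simp: partitions_of_def)
      then show ?thesis by blast
    qed
  qed
  then show ?thesis using that by blast
qed

definition has_lead :: "nat \<Rightarrow> nat \<Rightarrow> 'a::comm_ring_1 mfps \<Rightarrow> nat multiset \<Rightarrow> bool" where
  "has_lead B N F m \<longleftrightarrow> mcoeff F m = 1 \<and> set_mset m \<subseteq> {..<N} \<and>
    (\<forall>n. set_mset n \<subseteq> {..<N} \<longrightarrow> mcoeff F n \<noteq> 0 \<longrightarrow> n = m \<or> mon_weight B N n < mon_weight B N m)"

text \<open>The weight is additive, so any other pair of contributing monomials has strictly smaller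
  total weight; the leading coefficient stays 1.\<close>

lemma has_lead_mult:
  assumes "has_lead B N F m" "has_lead B N G n"
  shows "has_lead B N (F * G) (m + n)"
  unfolding has_lead_def
proof (intro conjI allI impI)
  let ?W = "mon_weight B N"
  have F: "a = m \<or> ?W a < ?W m" if "set_mset a \<subseteq> {..<N}" "mcoeff F a \<noteq> 0" for a
    using assms(1) that unfolding has_lead_def by blast
  have G: "a = n \<or> ?W a < ?W n" if "set_mset a \<subseteq> {..<N}" "mcoeff G a \<noteq> 0" for a
    using assms(2) that unfolding has_lead_def by blast
  show s: "set_mset (m + n) \<subseteq> {..<N}" using assms by (simp add: has_lead_def)
  have "mcoeff (F * G) (m + n) = (\<Sum>a\<in>{m}. mcoeff F a * mcoeff G (m + n - a))"
    unfolding mcoeff_mult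
  proof (rule sum.mono_neutral_right)
    show "\<forall>a\<in>{a. a \<subseteq># m + n} - {m}. mcoeff F a * mcoeff G (m + n - a) = 0"
    proof (rule ballI, rule ccontr)
      fix a assume a: "a \<in> {a. a \<subseteq># m + n} - {m}" and nz: "mcoeff F a * mcoeff G (m + n - a) \<noteq> 0"
      then obtain b where b: "m + n = a + b" by (auto simp: subset_mset.le_iff_add)
      have "set_mset a \<subseteq> {..<N}" "set_mset b \<subseteq> {..<N}"
        using s unfolding b by auto
      moreover have "mcoeff F a \<noteq> 0" "mcoeff G b \<noteq> 0" using nz b by auto
      ultimately have "?W a < ?W m" "?W b \<le> ?W n" using F[of a] G[of b] a by auto
      then have "?W (a + b) < ?W (m + n)" by (simp add: mon_weight_add)
      then show False by (simp add: b)
    qed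
  qed auto
  then show "mcoeff (F * G) (m + n) = 1" using assms by (simp add: has_lead_def)
  fix l assume l: "set_mset l \<subseteq> {..<N}" "mcoeff (F * G) l \<noteq> 0"
  from mcoeff_mult_nonzeroE[OF l(2)] obtain a where a: "a \<subseteq># l" "mcoeff F a \<noteq> 0" "mcoeff G (l - a) \<noteq> 0" .
  then obtain b where b: "l = a + b" by (auto simp: subset_mset.le_iff_add)
  with l a have "set_mset a \<subseteq> {..<N}" "set_mset b \<subseteq> {..<N}" "mcoeff G b \<noteq> 0" by auto
  with F[of a] G[of b] a show "l = m + n \<or> ?W l < ?W (m + n)"
    by (auto simp: b mon_weight_add)
qed

lemma has_lead_elementary:
  assumes "k \<le> N" "B > 1"
  shows "has_lead B N (elementary_sf k) (mset_set {..<k})"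
  unfolding has_lead_def
proof (intro conjI allI impI)
  show "mcoeff (elementary_sf k) (mset_set {..<k}) = 1"
    by (simp add: mcoeff_elementary count_mset_set')
  show "set_mset (mset_set {..<k}) \<subseteq> {..<N}" using assms by auto
  fix n :: "nat multiset" assume n: "set_mset n \<subseteq> {..<N}" "mcoeff (elementary_sf k :: 'a mfps) n \<noteq> 0"
  then have c: "\<forall>i. count n i \<le> 1" "size n = k" by (auto simp: mcoeff_elementary split: if_splits)
  then have e: "mset_set (set_mset n) = n" by (simp add: mset_set_set_mset_squarefree)
  then have "card (set_mset n) = k" using c by (metis size_mset_set)
  with mon_weight_initial[OF n(1) this _ assms(2)] e
  show "n = mset_set {..<k} \<or> mon_weight B N n < mon_weight B N (mset_set {..<k})" by metis
qed

lemma has_lead_elementary_prod: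
  assumes "\<And>k. k \<in># \<mu> \<Longrightarrow> k \<le> N" "B > 1"
  shows "has_lead B N (elementary_prod \<mu>) (conj_mon \<mu>)"
  using assms
proof (induction \<mu>)
  case empty
  show ?case by (auto simp: has_lead_def mcoeff_1 split: if_splits)
next
  case (add k \<mu>)
  then show ?case by (auto intro!: has_lead_mult has_lead_elementary)
qed

lemma partitions_of_le: "\<mu> \<in> partitions_of d \<Longrightarrow> k \<in># \<mu> \<Longrightarrow> k \<le> d"
  unfolding partitions_of_def by (metis (mono_tags, lifting) le_add1 mem_Collect_eq sum_mset.remove)

text \<open>A monomial of degree d involves at most d variables, so a permutation moves it into the
  first d.\<close>

lemma perm_invariant_eq_0:
  assumes "perm_invariant F" "homogeneous d F" "\<And>m. m \<in> monomials d {..<d} \<Longrightarrow> mcoeff F m = 0"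
  shows "F = 0"
  unfolding mfps_eq_iff
proof (intro allI, rule ccontr)
  fix m assume nz: "mcoeff F m \<noteq> mcoeff 0 m"
  then have sz: "size m = d" using assms(2) by (auto simp: homogeneous_def)
  define k where "k = card (set_mset m)"
  have kd: "k \<le> d" unfolding k_def sz[symmetric]
    by (metis mset_set_set_mset_msubset size_mset_mono size_mset_set)
  obtain g where g: "bij_betw g (set_mset m) {..<k}"
    using ex_bij_betw_finite_nat[of "set_mset m"] by (auto simp: k_def atLeast0LessThan)
  \<comment> \<open>The complements are countably infinite, so the bijection on the support extends
    to a permutation of all indices.\<close>
  have "infinite (- set_mset m)" "infinite (- {..<k})" by (simp_all add: Compl_eq_Diff_UNIV)
  then obtain h where h: "bij_betw h (- set_mset m) (- {..<k})"
    by (metis bij_betw_inv bij_betw_trans bij_enumerate)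
  define \<pi> where "\<pi> = (\<lambda>i. if i \<in> set_mset m then g i else h i)"
  have "bij_betw \<pi> (set_mset m \<union> - set_mset m) ({..<k} \<union> - {..<k})"
    unfolding \<pi>_def using g h by (intro bij_betw_disjoint_Un) auto
  then have "bij \<pi>" unfolding Compl_partition by simp
  moreover have "image_mset \<pi> m \<in> monomials d {..<d}"
  proof -
    have "\<pi> i < k" if "i \<in># m" for i using that g by (auto simp: \<pi>_def bij_betw_def)
    then show ?thesis using sz kd by (auto simp: monomials_def intro: less_le_trans)
  qed
  ultimately show False using assms(1,3) nz by (metis mcoeff_0 perm_invariant_def)
qed

lemma mon_weight_transpose:
  assumes "i < j" "j < N" "count m i < count m j" "B > 1"
  shows "mon_weight B N m < mon_weight B N (image_mset (transpose i j) m)"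
proof -
  have c: "count (image_mset (transpose i j) m) l = count m (transpose i j l)" for l
    using count_image_mset_bij[of "transpose i j" m "transpose i j l"] by simp
  let ?w = "\<lambda>l. B ^ (N - l)"
  have split: "sum f {..<N} = f i + f j + sum f ({..<N} - {i, j})" for f :: "nat \<Rightarrow> nat"
  proof -
    have "sum f {..<N} = sum f {i, j} + sum f ({..<N} - {i, j})"
      using assms by (subst sum.subset_diff[of "{i, j}"]) auto
    then show ?thesis using assms by simp
  qed
  have rest: "(\<Sum>l\<in>{..<N} - {i, j}. count m (transpose i j l) * ?w l) = (\<Sum>l\<in>{..<N} - {i, j}. count m l * ?w l)"
    by (intro sum.cong) auto
  define t where "t = count m j - count m i"
  have t: "count m j = count m i + t" "t > 0" using assms(3) by (simp_all add: t_def)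
  have "?w j < ?w i" using assms by (intro power_strict_increasing) auto
  then have "t * ?w j < t * ?w i" using t by simp
  then have "count m i * ?w i + count m j * ?w j < count m j * ?w i + count m i * ?w j"
    by (simp add: t algebra_simps)
  then show ?thesis
    unfolding mon_weight_def c by (simp add: split rest)
qed

text \<open>Elimination of leading monomials. The set R allows arbitrary coefficients as well as
  integers: products of elementary functions have integer coefficients, so closure under x - y z
  with integer z suffices for the remainder.\<close>

lemma elementary_span:
  fixes F :: "'a::comm_ring_1 mfps"
  assumes R: "\<And>x y z. x \<in> R \<Longrightarrow> y \<in> R \<Longrightarrow> z \<in> \<int> \<Longrightarrow> x - y * z \<in> R"
      "\<And>x y. x \<in> R \<Longrightarrow> y \<in> R \<Longrightarrow> x + y \<in> R" "0 \<in> R"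
    and F: "perm_invariant F" "homogeneous d F" "\<And>m. mcoeff F m \<in> R"
  obtains c where "\<And>\<mu>. c \<mu> \<in> R" "F = (\<Sum>\<mu>\<in>partitions_of d. mconst (c \<mu>) * elementary_prod \<mu>)"
proof -
  let ?W = "mon_weight (Suc d) d"
  have "\<exists>c. (\<forall>\<mu>. c \<mu> \<in> R) \<and> F = (\<Sum>\<mu>\<in>partitions_of d. mconst (c \<mu>) * elementary_prod \<mu>)"
    if "\<And>m. m \<in> monomials d {..<d} \<Longrightarrow> mcoeff F m \<noteq> 0 \<Longrightarrow> ?W m < b" for b
    using F that
  proof (induction b arbitrary: F)
    case 0
    then have "F = 0" by (intro perm_invariant_eq_0[of F d]) auto
    then show ?case using R(3) by (intro exI[of _ "\<lambda>_. 0"]) (simp add: mfps_eq_iff)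
  next
    case (Suc b)
    show ?case
    proof (cases "\<exists>m\<in>monomials d {..<d}. mcoeff F m \<noteq> 0 \<and> ?W m = b")
      case False
      then have "?W m < b" if "m \<in> monomials d {..<d}" "mcoeff F m \<noteq> 0" for m
        using Suc.prems(4)[OF that] that by (metis less_antisym)
      with Suc.IH Suc.prems show ?thesis by blast
    next
      case True
      then obtain m where m: "m \<in> monomials d {..<d}" "mcoeff F m \<noteq> 0" "?W m = b" by blast
      \<comment> \<open>An increasing pair of exponents could be transposed, giving a monomial of
        weight above the maximum b with the same coefficient.\<close>
      have mono: "count m j \<le> count m i" if "i < j" for i j
      proof (rule ccontr)
        assume "\<not> count m j \<le> count m i"
        then have lt: "count m i < count m j" by simp
        then have "j \<in># m" by (metis count_greater_zero_iff le_less_trans zero_le)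
        with m(1) have j: "j < d" by (auto simp: monomials_def)
        let ?n = "image_mset (transpose i j) m"
        have "?W m < ?W ?n" using mon_weight_transpose[OF that j lt] j by simp
        moreover have "?n \<in> monomials d {..<d}"
          using m(1) j that by (auto simp: monomials_def transpose_def)
        moreover have "mcoeff F ?n \<noteq> 0"
          using m(2) Suc.prems(1) by (simp add: perm_invariant_def)
        ultimately show False using Suc.prems(4)[of ?n] m(3) by simp
      qed
      have "size m = d" using m(1) by (simp add: monomials_def)
      with conj_mon_exists[of m] mono obtain \<mu> where \<mu>: "\<mu> \<in> partitions_of d" "conj_mon \<mu> = m" by metis
      define E where "E = (elementary_prod \<mu> :: 'a mfps)"
      define G where "G = F - mconst (mcoeff F m) * E"
      have E: "mcoeff E m = 1" "\<And>n. n \<in> monomials d {..<d} \<Longrightarrow> mcoeff E n \<noteq> 0 \<Longrightarrow> n = m \<or> ?W n < ?W m"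
      proof -
        have "has_lead (Suc d) d E m" if "d > 0"
          using has_lead_elementary_prod[of \<mu> d "Suc d"] partitions_of_le[OF \<mu>(1)] that
          by (simp add: E_def \<mu>(2))
        \<comment> \<open>Degree 0 is separate because the base \<open>Suc d\<close> is then 1, too
          small for the weight to separate monomials.\<close>
        moreover have "E = 1 \<and> m = {#}" if "d = 0"
        proof -
          have "x \<notin># \<mu>" for x using \<mu>(1) that partitions_of_le[OF \<mu>(1), of x] by (auto simp: partitions_of_def)
          then have "\<mu> = {#}" by (metis multiset_nonemptyE)
          then show ?thesis using \<mu>(2) by (auto simp: E_def)
        qed
        ultimately show "mcoeff E m = 1" "\<And>n. n \<in> monomials d {..<d} \<Longrightarrow> mcoeff E n \<noteq> 0 \<Longrightarrow> n = m \<or> ?W n < ?W m"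
          by (cases "d = 0"; auto simp: has_lead_def monomials_def mcoeff_1)+
      qed
      have hE: "homogeneous d E" "perm_invariant E"
        using homogeneous_elementary_prod[of \<mu>] perm_invariant_elementary_prod[of \<mu>] \<mu>(1)
        by (simp_all add: E_def partitions_of_def)
      have "\<exists>c. (\<forall>\<mu>. c \<mu> \<in> R) \<and> G = (\<Sum>\<mu>\<in>partitions_of d. mconst (c \<mu>) * elementary_prod \<mu>)"
      proof (rule Suc.IH)
        show "perm_invariant G"
          using Suc.prems(1) hE by (simp add: G_def perm_invariant_def)
        show "homogeneous d G" unfolding homogeneous_def
        proof (intro allI impI)
          fix n assume "mcoeff G n \<noteq> 0"
          then have "mcoeff F n \<noteq> 0 \<or> mcoeff E n \<noteq> 0" by (auto simp: G_def)
          then show "size n = d" using Suc.prems(2) hE(1) by (auto simp: homogeneous_def)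
        qed
        show "mcoeff G n \<in> R" for n
          using Suc.prems(3) elementary_prod_int by (auto simp: G_def E_def intro!: R(1))
        show "?W n < b" if n: "n \<in> monomials d {..<d}" "mcoeff G n \<noteq> 0" for n
        proof -
          have "n \<noteq> m" using n(2) E(1) by (auto simp: G_def)
          then have "?W n \<noteq> b" using mon_weight_inj[OF n(1) m(1)] m(3) by auto
          moreover from n(2) have "mcoeff F n \<noteq> 0 \<or> mcoeff E n \<noteq> 0" by (auto simp: G_def)
          then have "?W n < Suc b"
          proof
            assume "mcoeff E n \<noteq> 0"
            with E(2)[OF n(1)] m(3) show ?thesis by auto
          qed (rule Suc.prems(4)[OF n(1)])
          ultimately show ?thesis by simp
        qed
      qed
      then obtain c where c: "\<And>\<mu>. c \<mu> \<in> R" "G = (\<Sum>\<mu>\<in>partitions_of d. mconst (c \<mu>) * elementary_prod \<mu>)" by blast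
      define c' where "c' = c(\<mu> := c \<mu> + mcoeff F m)"
      have "F = G + mconst (mcoeff F m) * E" by (simp add: G_def)
      also have "\<dots> = (\<Sum>\<nu>\<in>partitions_of d. mconst (c' \<nu>) * elementary_prod \<nu>)"
      proof -
        have "(\<Sum>\<nu>\<in>partitions_of d. mcoeff (mconst (c' \<nu>) * elementary_prod \<nu>) n) =
            mcoeff (G + mconst (mcoeff F m) * E) n" for n
          unfolding c(2) using \<mu>(1) finite_partitions_of[of d]
          by (simp add: sum.remove[of _ \<mu>] c'_def E_def distrib_right)
        then show ?thesis by (simp add: mfps_eq_iff)
      qed
      finally have "F = (\<Sum>\<nu>\<in>partitions_of d. mconst (c' \<nu>) * elementary_prod \<nu>)" .
      moreover have "\<forall>\<nu>. c' \<nu> \<in> R" using c(1) R(2) Suc.prems(3) by (simp add: c'_def)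
      ultimately show ?thesis by blast
    qed
  qed
  note * = this
  have "?W m < Suc (Max (?W ` monomials d {..<d}))" if "m \<in> monomials d {..<d}" for m
    using that by (simp add: less_Suc_eq_le)
  from *[OF this] that show ?thesis by blast
qed

text \<open>Among the terms of one degree with nonzero coefficient, the one with the heaviest
  leading monomial cannot be cancelled, as distinct partitions have distinct conjugates. P may mix
  degrees.\<close>

lemma elementary_independent:
  fixes c :: "nat multiset \<Rightarrow> 'a::comm_ring_1"
  assumes "finite P" "\<And>\<mu>. \<mu> \<in> P \<Longrightarrow> 0 \<notin># \<mu>"
    "(\<Sum>\<mu>\<in>P. mconst (c \<mu>) * elementary_prod \<mu>) = 0" "\<mu> \<in> P"
  shows "c \<mu> = 0"
proof (rule ccontr)
  assume nz: "c \<mu> \<noteq> 0"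
  define d where "d = sum_mset \<mu>"
  let ?W = "mon_weight (Suc d) d"
  define Q where "Q = {\<nu> \<in> P. sum_mset \<nu> = d \<and> c \<nu> \<noteq> 0}"
  have Q: "finite Q" "\<mu> \<in> Q" using assms(1,4) nz by (auto simp: Q_def d_def)
  have "Max ((\<lambda>\<nu>. ?W (conj_mon \<nu>)) ` Q) \<in> (\<lambda>\<nu>. ?W (conj_mon \<nu>)) ` Q"
    using Q by (intro Max_in) auto
  then obtain \<nu> where \<nu>0: "\<nu> \<in> Q" "Max ((\<lambda>\<nu>. ?W (conj_mon \<nu>)) ` Q) = ?W (conj_mon \<nu>)" by blast
  have \<nu>: "\<nu> \<in> Q" "\<And>\<rho>. \<rho> \<in> Q \<Longrightarrow> ?W (conj_mon \<rho>) \<le> ?W (conj_mon \<nu>)"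
    using Q(1) by (auto simp: \<nu>0 simp flip: \<nu>0(2) intro!: Max_ge)
  have d: "sum_mset \<nu> = d" using \<nu>(1) by (simp add: Q_def)
  let ?m = "conj_mon \<nu>"
  have zero: "c \<rho> * mcoeff (elementary_prod \<rho>) ?m = 0" if \<rho>: "\<rho> \<in> P" "\<rho> \<noteq> \<nu>" for \<rho>
  proof (rule ccontr)
    assume a: "c \<rho> * mcoeff (elementary_prod \<rho>) ?m \<noteq> 0"
    then have nz: "mcoeff (elementary_prod \<rho> :: 'a mfps) ?m \<noteq> 0" by auto
    then have s: "sum_mset \<rho> = d"
      using homogeneous_elementary_prod[of \<rho>] d unfolding homogeneous_def by (metis size_conj_mon)
    with \<rho> a have \<rho>Q: "\<rho> \<in> Q" by (auto simp: Q_def)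
    have "d > 0"
    proof (rule ccontr)
      assume "\<not> d > 0"
      then have "\<rho> = {#}" "\<nu> = {#}" using s d assms(2)[OF \<rho>(1)] assms(2)[of \<nu>] \<nu>(1)
        by (auto simp: Q_def intro!: multiset_eqI) (metis count_inI)+
      with \<rho>(2) show False by simp
    qed
    then have "has_lead (Suc d) d (elementary_prod \<rho> :: 'a mfps) (conj_mon \<rho>)"
      using s by (intro has_lead_elementary_prod) (auto, metis le_add1 sum_mset.remove)
    moreover have "set_mset ?m \<subseteq> {..<d}" using conj_mon_monomials[OF d] by (simp add: monomials_def)
    ultimately have "?m = conj_mon \<rho> \<or> ?W ?m < ?W (conj_mon \<rho>)"
      using nz unfolding has_lead_def by blast
    moreover have "?m \<noteq> conj_mon \<rho>"
      using conj_mon_inj[of \<nu> \<rho>] assms(2) \<rho> \<nu>(1) by (auto simp: Q_def)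
    ultimately show False using \<nu>(2)[OF \<rho>Q] by simp
  qed
  have "(\<Sum>\<rho>\<in>P. c \<rho> * mcoeff (elementary_prod \<rho>) ?m) = c \<nu> * mcoeff (elementary_prod \<nu>) ?m"
    using zero \<nu>(1) assms(1) by (subst sum.remove[of _ \<nu>]) (auto simp: Q_def intro!: sum.neutral)
  moreover have "(\<Sum>\<rho>\<in>P. c \<rho> * mcoeff (elementary_prod \<rho>) ?m) = 0"
    using arg_cong[OF assms(3), of "\<lambda>F. mcoeff F ?m"] by simp
  moreover have "mcoeff (elementary_prod \<nu> :: 'a mfps) ?m = 1"
  proof -
    have "k \<le> Suc d" if "k \<in># \<nu>" for k using that d by (metis le_SucI le_add1 sum_mset.remove)
    \<comment> \<open>Only the leading coefficient is wanted, so any base above 1 will do; base 2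
      also covers d = 0.\<close>
    then have "has_lead 2 (Suc d) (elementary_prod \<nu> :: 'a mfps) ?m"
      by (intro has_lead_elementary_prod) auto
    then show ?thesis by (simp add: has_lead_def)
  qed
  ultimately show False using \<nu>(1) by (simp add: Q_def)
qed

section \<open>The involution\<close>

lemma sum_Pow_alternating:
  assumes "finite A" "A \<noteq> {}"
  shows "(\<Sum>S\<in>Pow A. (- 1) ^ card S) = (0 :: 'a::comm_ring_1)"
proof -
  from assms(2) obtain x where x: "x \<in> A" by blast
  define B where "B = A - {x}"
  have B: "A = insert x B" "x \<notin> B" "finite B" using x assms(1) by (auto simp: B_def)
  have "(\<Sum>S\<in>insert x ` Pow B. (- 1) ^ card S) = (\<Sum>S\<in>Pow B. (- 1) ^ card (insert x S) :: 'a)"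
    using B by (intro sum.reindex_cong[where l = "insert x"] inj_onI) auto
  also have "\<dots> = (\<Sum>S\<in>Pow B. - ((- 1) ^ card S))"
  proof (intro sum.cong refl)
    fix S assume "S \<in> Pow B"
    then have "finite S" "x \<notin> S" using B finite_subset by auto
    then show "(- 1) ^ card (insert x S) = - ((- 1 :: 'a) ^ card S)" by simp
  qed
  finally have "(\<Sum>S\<in>insert x ` Pow B. (- 1) ^ card S) = - (\<Sum>S\<in>Pow B. (- 1 :: 'a) ^ card S)"
    by (simp add: sum_negf)
  moreover have "Pow B \<inter> insert x ` Pow B = {}" using B by auto
  ultimately show ?thesis
    using B by (simp add: Pow_insert sum.union_disjoint)
qed

text \<open>At m of size k, the coefficient is the sum of (-1)^|a| over squarefree a dividing m,
  that is, over subsets of the nonempty support.\<close>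

lemma elementary_homogeneous_relation:
  assumes "k > 0"
  shows "(\<Sum>i\<le>k. mconst ((- 1) ^ i) * (elementary_sf i * homogeneous_sf (k - i))) =
    (0 :: 'a::comm_ring_1 mfps)"
  unfolding mfps_eq_iff
proof
  fix m :: "nat multiset"
  let ?E = "\<lambda>i. mcoeff (elementary_sf i :: 'a mfps)" and ?H = "\<lambda>i. mcoeff (homogeneous_sf i :: 'a mfps)"
  have "(\<Sum>i\<le>k. (- 1) ^ i * mcoeff (elementary_sf i * homogeneous_sf (k - i)) m) = (0 :: 'a)"
  proof (cases "size m = k")
    case False
    have "mcoeff (elementary_sf i * homogeneous_sf (k - i)) m = (0 :: 'a)" if "i \<le> k" for i
      using homogeneous_mult[OF homogeneous_elementary homogeneous_homogeneous_sf, of i "k - i", where 'a = 'a]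
        that False by (auto simp: homogeneous_def)
    then show ?thesis by simp
  next
    case True
    have "(\<Sum>i\<le>k. (- 1) ^ i * mcoeff (elementary_sf i * homogeneous_sf (k - i)) m) =
        (\<Sum>a | a \<subseteq># m. \<Sum>i\<le>k. (- 1) ^ i * (?E i a * ?H (k - i) (m - a)))"
      unfolding mcoeff_mult sum_distrib_left by (rule sum.swap)
    also have "\<dots> = (\<Sum>a | a \<subseteq># m. if \<forall>j. count a j \<le> 1 then (- 1) ^ size a else 0)"
    proof (intro sum.cong refl)
      fix a assume "a \<in> {a. a \<subseteq># m}"
      then have a: "size a \<le> k" "size (m - a) = k - size a"
        using True by (auto simp: size_Diff_submset size_mset_mono)
      have "(\<Sum>i\<le>k. (- 1) ^ i * (?E i a * ?H (k - i) (m - a))) =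
          (\<Sum>i\<in>{size a}. (- 1) ^ i * (?E i a * ?H (k - i) (m - a)))"
        using a by (intro sum.mono_neutral_right) (auto simp: mcoeff_elementary)
      then show "(\<Sum>i\<le>k. (- 1) ^ i * (?E i a * ?H (k - i) (m - a))) =
          (if \<forall>j. count a j \<le> 1 then (- 1) ^ size a else 0)"
        using a by (simp add: mcoeff_elementary mcoeff_homogeneous_sf)
    qed
    also have "\<dots> = (\<Sum>a | a \<subseteq># m \<and> (\<forall>j. count a j \<le> 1). (- 1) ^ size a)"
      by (simp add: sum.inter_filter[symmetric] conj_commute)
    also have "\<dots> = (\<Sum>S\<in>Pow (set_mset m). (- 1) ^ card S)"
    proof (rule sum.reindex_bij_witness[of _ mset_set set_mset], goal_cases)
      case (1 a)
      then show ?case by (simp add: mset_set_set_mset_squarefree)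
    next
      case (2 a)
      then show ?case by (auto dest: mset_subset_eqD)
    next
      case (3 S)
      then show ?case by (auto dest: finite_subset)
    next
      case (4 S)
      then have "finite S" "S \<subseteq> set_mset m" using finite_subset by auto
      then show ?case
        by (auto simp: subseteq_mset_def count_mset_set' Suc_le_eq)
    next
      case (5 a)
      then have "mset_set (set_mset a) = a" by (simp add: mset_set_set_mset_squarefree)
      then show ?case by (metis size_mset_set)
    qed
    also have "\<dots> = 0"
      using True assms by (intro sum_Pow_alternating) auto
    finally show ?thesis .
  qed
  then show "mcoeff (\<Sum>i\<le>k. mconst ((- 1) ^ i) * (elementary_sf i * homogeneous_sf (k - i)) :: 'a mfps) m =
      mcoeff 0 m"
    by simp
qed

section \<open>Existence of the involution, by expansion in the elementary basis\<close>

definition e_expansion :: "nat multiset set \<Rightarrow> (nat multiset \<Rightarrow> 'a) \<Rightarrow> 'a::comm_ring_1 mfps \<Rightarrow> bool" where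
  "e_expansion T c F \<longleftrightarrow> finite T \<and> (\<forall>\<mu>\<in>T. 0 \<notin># \<mu>) \<and>
    F = (\<Sum>\<mu>\<in>T. mconst (c \<mu>) * elementary_prod \<mu>)"

lemma e_expansion_exists:
  fixes F :: "'a::comm_ring_1 mfps"
  assumes "F \<in> symmetric_functions"
  shows "\<exists>T c. e_expansion T c F"
proof -
  from assms obtain D where D: "\<And>m. mcoeff F m \<noteq> 0 \<Longrightarrow> size m \<le> D" and F: "perm_invariant F"
    unfolding symmetric_functions_iff by blast
  define G where "G d = Abs_mfps (\<lambda>m. if size m = d then mcoeff F m else 0)" for d
  have "\<exists>c. G d = (\<Sum>\<mu>\<in>partitions_of d. mconst (c \<mu>) * elementary_prod \<mu>)" for d
  proof (rule elementary_span[of UNIV "G d" d])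
    show "perm_invariant (G d)" "homogeneous d (G d)"
      using F by (auto simp: G_def perm_invariant_def homogeneous_def)
  qed auto
  then obtain c where c: "\<And>d. G d = (\<Sum>\<mu>\<in>partitions_of d. mconst (c d \<mu>) * elementary_prod \<mu>)" by metis
  have "F = (\<Sum>d\<le>D. G d)"
    using D by (auto simp: mfps_eq_iff G_def)
  also have "\<dots> = (\<Sum>d\<le>D. \<Sum>\<mu>\<in>partitions_of d. mconst (c (sum_mset \<mu>) \<mu>) * elementary_prod \<mu>)"
    unfolding c by (intro sum.cong refl) (simp add: partitions_of_def)
  also have "\<dots> = (\<Sum>\<mu>\<in>(\<Union>d\<le>D. partitions_of d). mconst (c (sum_mset \<mu>) \<mu>) * elementary_prod \<mu>)"
    by (rule sum.UNION_disjoint[symmetric]) (auto simp: finite_partitions_of, auto simp: partitions_of_def)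
  finally have "e_expansion (\<Union>d\<le>D. partitions_of d) (\<lambda>\<mu>. c (sum_mset \<mu>) \<mu>) F"
    unfolding e_expansion_def by (auto simp: finite_partitions_of) (auto simp: partitions_of_def)
  then show ?thesis by blast
qed

text \<open>With arbitrary g this is well-definedness of substituting any family for the elementary
  products, in particular the homogeneous ones.\<close>

lemma e_expansion_unique:
  fixes F :: "'a::comm_ring_1 mfps"
  assumes "e_expansion T c F" "e_expansion U d F"
  shows "(\<Sum>\<mu>\<in>T. mconst (c \<mu>) * g \<mu>) = (\<Sum>\<mu>\<in>U. mconst (d \<mu>) * (g \<mu> :: 'a mfps))"
proof -
  define c' where "c' \<mu> = (if \<mu> \<in> T then c \<mu> else 0)" for \<mu>
  define d' where "d' \<mu> = (if \<mu> \<in> U then d \<mu> else 0)" for \<mu>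
  have fin: "finite (T \<union> U)" and pos: "\<And>\<mu>. \<mu> \<in> T \<union> U \<Longrightarrow> 0 \<notin># \<mu>"
    using assms by (auto simp: e_expansion_def)
  have m0: "mconst (0 :: 'a) = 0" by (simp add: mfps_eq_iff mcoeff_mconst)
  have ext: "(\<Sum>\<mu>\<in>T. mconst (c \<mu>) * h \<mu>) = (\<Sum>\<mu>\<in>T \<union> U. mconst (c' \<mu>) * h \<mu>)"
    "(\<Sum>\<mu>\<in>U. mconst (d \<mu>) * h \<mu>) = (\<Sum>\<mu>\<in>T \<union> U. mconst (d' \<mu>) * h \<mu>)" for h :: "_ \<Rightarrow> 'a mfps"
    using fin by (intro sum.mono_neutral_cong_left; auto simp: c'_def d'_def m0)+
  have "(\<Sum>\<mu>\<in>T \<union> U. mconst (c' \<mu> - d' \<mu>) * elementary_prod \<mu>) = (0 :: 'a mfps)"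
  proof -
    have "(\<Sum>\<mu>\<in>T \<union> U. mconst (c' \<mu>) * elementary_prod \<mu>) =
        (\<Sum>\<mu>\<in>T \<union> U. mconst (d' \<mu>) * (elementary_prod \<mu> :: 'a mfps))"
      using assms ext[of elementary_prod] by (simp add: e_expansion_def)
    then show ?thesis
      by (simp add: mfps_eq_iff left_diff_distrib sum_subtractf)
  qed
  from elementary_independent[OF fin pos this]
  have "c' \<mu> = d' \<mu>" if "\<mu> \<in> T \<union> U" for \<mu> using that by simp
  then show ?thesis unfolding ext by (intro sum.cong) auto
qed

definition omega_map :: "'a::comm_ring_1 mfps \<Rightarrow> 'a mfps" where
  "omega_map F = (SOME G. \<exists>T c. e_expansion T c F \<and> G = (\<Sum>\<mu>\<in>T. mconst (c \<mu>) * homogeneous_prod \<mu>))"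

lemma omega_map_expansion:
  assumes "e_expansion T c F"
  shows "omega_map F = (\<Sum>\<mu>\<in>T. mconst (c \<mu>) * homogeneous_prod \<mu>)"
proof -
  have "\<exists>T c. e_expansion T c F \<and> omega_map F = (\<Sum>\<mu>\<in>T. mconst (c \<mu>) * homogeneous_prod \<mu>)"
    unfolding omega_map_def by (rule someI_ex) (use assms in blast)
  then show ?thesis using e_expansion_unique[OF assms] by metis
qed

lemma mconst_add: "mconst (a + b :: 'a::comm_ring_1) = mconst a + mconst b"
  by (simp add: mfps_eq_iff mcoeff_mconst)

lemma mconst_sum: "mconst (\<Sum>i\<in>I. f i :: 'a::comm_ring_1) = (\<Sum>i\<in>I. mconst (f i))"
proof -
  have "mconst (0 :: 'a) = 0" by (simp add: mfps_eq_iff mcoeff_mconst)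
  then show ?thesis by (induction I rule: infinite_finite_induct) (auto simp: mconst_add)
qed

text \<open>Allowing repeated partitions \<open>\<nu> i\<close> spares collecting equal terms when
  expansions are added or multiplied.\<close>

lemma omega_map_sum:
  assumes "finite I" "\<And>i. i \<in> I \<Longrightarrow> 0 \<notin># \<nu> i" "F = (\<Sum>i\<in>I. mconst (a i) * elementary_prod (\<nu> i))"
  shows "omega_map F = (\<Sum>i\<in>I. mconst (a i) * homogeneous_prod (\<nu> i))"
proof -
  define c where "c \<mu> = (\<Sum>i | i \<in> I \<and> \<nu> i = \<mu>. a i)" for \<mu>
  have group: "(\<Sum>i\<in>I. mconst (a i) * g (\<nu> i)) = (\<Sum>\<mu>\<in>\<nu> ` I. mconst (c \<mu>) * g \<mu>)"
    for g :: "_ \<Rightarrow> 'b mfps"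
  proof -
    have "(\<Sum>i\<in>I. mconst (a i) * g (\<nu> i)) =
        (\<Sum>\<mu>\<in>\<nu> ` I. \<Sum>i | i \<in> I \<and> \<nu> i = \<mu>. mconst (a i) * g (\<nu> i))"
      by (rule sum.image_gen[OF assms(1)])
    also have "\<dots> = (\<Sum>\<mu>\<in>\<nu> ` I. mconst (c \<mu>) * g \<mu>)"
      by (simp add: c_def mconst_sum sum_distrib_right)
    finally show ?thesis .
  qed
  have "e_expansion (\<nu> ` I) c F"
    using assms unfolding e_expansion_def group by auto
  from omega_map_expansion[OF this] show ?thesis unfolding group .
qed

text \<open>\<open>omega\<close> is a choice, so its properties become available only through a
  witness.\<close>

lemma is_omega_omega_map: "is_omega (omega_map :: 'a::comm_ring_1 mfps \<Rightarrow> 'a mfps)"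
proof -
  have sym: "omega_map F \<in> symmetric_functions" if "F \<in> symmetric_functions" for F :: "'a mfps"
  proof -
    from e_expansion_exists[OF that] obtain T c where "e_expansion T c F" by blast
    then show ?thesis
      by (auto simp: omega_map_expansion intro!: symmetric_sum symmetric_mconst_mult symmetric_homogeneous_prod)
  qed
  have one: "omega_map 1 = (1 :: 'a mfps)"
    using omega_map_sum[of "{()}" "\<lambda>_. {#}" 1 "\<lambda>_. 1 :: 'a"] by (simp add: mconst_1)
  have add: "omega_map (F + G) = omega_map F + omega_map G"
    if "F \<in> symmetric_functions" "G \<in> symmetric_functions" for F G :: "'a mfps"
  proof -
    from e_expansion_exists[OF that(1)] obtain T c where T: "e_expansion T c F" by blast
    from e_expansion_exists[OF that(2)] obtain U d where U: "e_expansion U d G" by blast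
    have "omega_map (F + G) =
        (\<Sum>x\<in>T <+> U. mconst (case_sum c d x) * homogeneous_prod (case_sum id id x))"
      using T U by (intro omega_map_sum) (auto simp: e_expansion_def sum.Plus)
    moreover have "finite T" "finite U" using T U by (simp_all add: e_expansion_def)
    ultimately show ?thesis
      by (simp add: omega_map_expansion[OF T] omega_map_expansion[OF U] sum.Plus)
  qed
  have mult: "omega_map (F * G) = omega_map F * omega_map G"
    if "F \<in> symmetric_functions" "G \<in> symmetric_functions" for F G :: "'a mfps"
  proof -
    from e_expansion_exists[OF that(1)] obtain T c where T: "e_expansion T c F" by blast
    from e_expansion_exists[OF that(2)] obtain U d where U: "e_expansion U d G" by blast
    note e = T U
    have prod: "(\<Sum>\<mu>\<in>T. mconst (c \<mu>) * g \<mu>) * (\<Sum>\<nu>\<in>U. mconst (d \<nu>) * g \<nu>) =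
        (\<Sum>p\<in>T \<times> U. mconst (c (fst p) * d (snd p)) * g (fst p + snd p))"
      if "\<And>\<mu> \<nu>. g (\<mu> + \<nu>) = g \<mu> * g \<nu>" for g :: "nat multiset \<Rightarrow> 'a mfps"
      by (simp add: sum_product sum.cartesian_product mconst_mult that mult_ac case_prod_unfold)
    have "omega_map (F * G) =
        (\<Sum>p\<in>T \<times> U. mconst (c (fst p) * d (snd p)) * homogeneous_prod (fst p + snd p))"
      using e prod[of elementary_prod] by (intro omega_map_sum) (auto simp: e_expansion_def)
    also have "\<dots> = omega_map F * omega_map G"
      unfolding omega_map_expansion[OF e(1)] omega_map_expansion[OF e(2)]
      by (rule prod[symmetric]) simp
    finally show ?thesis .
  qed
  have scale: "omega_map (mconst r * F) = mconst r * omega_map F"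
    if F: "F \<in> symmetric_functions" for r and F :: "'a mfps"
  proof -
    from e_expansion_exists[OF F] obtain T c where e: "e_expansion T c F" by blast
    then have "omega_map (mconst r * F) = (\<Sum>\<mu>\<in>T. mconst (r * c \<mu>) * homogeneous_prod \<mu>)"
      by (intro omega_map_sum) (auto simp: e_expansion_def mconst_mult sum_distrib_left mult.assoc)
    with e show ?thesis
      by (simp add: omega_map_expansion mconst_mult sum_distrib_left mult.assoc)
  qed
  have "omega_map (elementary_sf k) = (homogeneous_sf k :: 'a mfps)" for k
  proof (cases "k = 0")
    case True
    with one show ?thesis by (simp add: elementary_0 homogeneous_sf_0)
  next
    case False
    then show ?thesis
      using omega_map_sum[of "{()}" "\<lambda>_. {#k#}" "elementary_sf k" "\<lambda>_. 1 :: 'a"] by (simp add: mconst_1)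
  qed
  with sym one add mult scale show ?thesis unfolding is_omega_def by blast
qed

lemma is_omega_omega: "is_omega (omega :: 'a::comm_ring_1 mfps \<Rightarrow> 'a mfps)"
  unfolding omega_def by (rule someI[of is_omega, OF is_omega_omega_map])

lemma
  shows omega_1: "omega 1 = (1 :: 'a::comm_ring_1 mfps)"
    and omega_add: "F \<in> symmetric_functions \<Longrightarrow> G \<in> symmetric_functions \<Longrightarrow>
      omega (F + G) = omega F + omega (G :: 'a mfps)"
    and omega_mult: "F \<in> symmetric_functions \<Longrightarrow> G \<in> symmetric_functions \<Longrightarrow>
      omega (F * G) = omega F * omega (G :: 'a mfps)"
    and omega_mconst_mult: "F \<in> symmetric_functions \<Longrightarrow> omega (mconst r * F) = mconst r * omega (F :: 'a mfps)"
    and omega_elementary: "omega (elementary_sf k) = (homogeneous_sf k :: 'a mfps)"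
  using is_omega_omega[where 'a = 'a] unfolding is_omega_def by blast+

lemma omega_0: "omega 0 = (0 :: 'a::comm_ring_1 mfps)"
  using omega_add[of 0 0, OF symmetric_0 symmetric_0] by (metis add_cancel_right_right add_0)

lemma omega_sum:
  "finite I \<Longrightarrow> (\<And>i. i \<in> I \<Longrightarrow> F i \<in> symmetric_functions) \<Longrightarrow>
    omega (\<Sum>i\<in>I. F i) = (\<Sum>i\<in>I. omega (F i :: 'a::comm_ring_1 mfps))"
  by (induction I rule: finite_induct) (simp_all add: omega_0 omega_add symmetric_sum)

lemma omega_elementary_prod: "omega (elementary_prod \<mu>) = (homogeneous_prod \<mu> :: 'a::comm_ring_1 mfps)"
  by (induction \<mu>)
    (simp_all add: omega_1 omega_mult omega_elementary symmetric_elementary symmetric_elementary_prod)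

lemma symmetric_mult: "F \<in> symmetric_functions \<Longrightarrow> G \<in> symmetric_functions \<Longrightarrow> F * G \<in> symmetric_functions"
proof -
  assume FG: "F \<in> symmetric_functions" "G \<in> symmetric_functions"
  then obtain d e where de: "\<forall>m. mcoeff F m \<noteq> 0 \<longrightarrow> size m \<le> d" "\<forall>m. mcoeff G m \<noteq> 0 \<longrightarrow> size m \<le> e"
    unfolding symmetric_functions_iff by blast
  have "size m \<le> d + e" if "mcoeff (F * G) m \<noteq> 0" for m
    using mcoeff_mult_nonzeroE[OF that] de
    by (metis add_mono size_union subset_mset.add_diff_inverse)
  with FG show ?thesis unfolding symmetric_functions_iff using perm_invariant_mult by blast
qed

text \<open>Applying \<open>omega\<close> to the alternating relation and inserting the induction
  hypothesis gives the equation that the same relation, read backwards, gives for e_k.\<close>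

lemma omega_homogeneous_sf: "omega (homogeneous_sf k) = (elementary_sf k :: 'a::comm_ring_1 mfps)"
proof (induction k rule: less_induct)
  case (less k)
  show ?case
  proof (cases "k = 0")
    case True
    then show ?thesis by (simp add: homogeneous_sf_0 elementary_0 omega_1)
  next
    case False
    let ?R = "\<lambda>i. mconst ((- 1) ^ i) * (elementary_sf i * homogeneous_sf (k - i)) :: 'a mfps"
    let ?S = "\<lambda>i. mconst ((- 1) ^ i) * (homogeneous_sf i * elementary_sf (k - i)) :: 'a mfps"
    have sym: "elementary_sf i * homogeneous_sf j \<in> symmetric_functions" for i j
      by (intro symmetric_mult symmetric_elementary symmetric_homogeneous_sf)
    have "omega (\<Sum>i\<le>k. ?R i) = 0"
      using elementary_homogeneous_relation[of k, where 'a = 'a] False by (simp add: omega_0)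
    then have "(\<Sum>i\<le>k. omega (?R i)) = 0"
      by (subst (asm) omega_sum) (auto intro: symmetric_mconst_mult sym)
    moreover have "omega (?R i) = mconst ((- 1) ^ i) * (homogeneous_sf i * omega (homogeneous_sf (k - i)))" for i
      by (simp add: omega_mconst_mult[OF sym] omega_mult symmetric_elementary symmetric_homogeneous_sf omega_elementary)
    ultimately have "(\<Sum>i\<le>k. mconst ((- 1) ^ i) * (homogeneous_sf i * omega (homogeneous_sf (k - i)))) = (0 :: 'a mfps)"
      by simp
    moreover have "{..k} = insert 0 {1..k}" by auto
    ultimately have 1: "omega (homogeneous_sf k) + (\<Sum>i\<in>{1..k}. ?S i) = 0"
      using less by (simp add: homogeneous_sf_0 mconst_1)
    \<comment> \<open>Reversing the summation turns ?S into (-1)^k times ?R.\<close>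
    have "(\<Sum>i\<le>k. ?S i) = (\<Sum>i\<le>k. ?S (k - i))"
      by (rule sum.nat_diff_reindex[symmetric, of _ "Suc k", simplified lessThan_Suc_atMost, simplified])
    also have "\<dots> = (\<Sum>i\<le>k. mconst ((- 1) ^ k) * ?R i)"
    proof (intro sum.cong refl)
      fix i assume i: "i \<in> {..k}"
      have "(- 1 :: 'a) ^ (k - i) = (- 1) ^ k * (- 1) ^ i"
        using i by (auto simp: minus_one_power_iff)
      then show "?S (k - i) = mconst ((- 1) ^ k) * ?R i"
        using i by (simp add: mconst_mult mult_ac)
    qed
    also have "\<dots> = 0"
      using elementary_homogeneous_relation[of k, where 'a = 'a] False
      by (simp flip: sum_distrib_left)
    finally have "elementary_sf k + (\<Sum>i\<in>{1..k}. ?S i) = 0"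
      unfolding \<open>{..k} = insert 0 {1..k}\<close> by (simp add: homogeneous_sf_0 mconst_1)
    with 1 show ?thesis by (metis add_right_cancel)
  qed
qed

lemma omega_homogeneous_prod: "omega (homogeneous_prod \<mu>) = (elementary_prod \<mu> :: 'a::comm_ring_1 mfps)"
  by (induction \<mu>)
    (simp_all add: omega_1 omega_mult omega_homogeneous_sf symmetric_homogeneous_sf symmetric_homogeneous_prod)

text \<open>\<open>omega\<close> carries both expansions to the elementary basis, where independence
  is known.\<close>

lemma homogeneous_independent:
  fixes c d :: "nat multiset \<Rightarrow> 'a::comm_ring_1"
  assumes "h_expansion n c = h_expansion n d" "\<mu> \<in> partitions_of n"
  shows "c \<mu> = d \<mu>"
proof -
  have "omega (h_expansion n c) = (\<Sum>\<mu>\<in>partitions_of n. mconst (c \<mu>) * elementary_prod \<mu>)"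
    for c :: "nat multiset \<Rightarrow> 'a"
    unfolding h_expansion_def using finite_partitions_of
    by (subst omega_sum) (auto simp: omega_mconst_mult omega_homogeneous_prod
        symmetric_homogeneous_prod intro: symmetric_mconst_mult)
  with assms(1) have "(\<Sum>\<mu>\<in>partitions_of n. mconst (c \<mu>) * elementary_prod \<mu>) =
      (\<Sum>\<mu>\<in>partitions_of n. mconst (d \<mu>) * (elementary_prod \<mu> :: 'a mfps))"
    by metis
  then have "(\<Sum>\<mu>\<in>partitions_of n. mconst (c \<mu> - d \<mu>) * elementary_prod \<mu>) = (0 :: 'a mfps)"
    by (simp add: mfps_eq_iff left_diff_distrib sum_subtractf)
  from elementary_independent[OF finite_partitions_of _ this assms(2)] show ?thesis
    by (simp add: partitions_of_def)
qed

lemma omega_elementary_sum: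
  "omega (\<Sum>\<mu>\<in>partitions_of n. mconst (c \<mu>) * elementary_prod \<mu>) = (h_expansion n c :: 'a::comm_ring_1 mfps)"
  unfolding h_expansion_def using finite_partitions_of
  by (subst omega_sum) (auto simp: omega_mconst_mult omega_elementary_prod
      symmetric_elementary_prod intro: symmetric_mconst_mult)

section \<open>Evaluation and the chromatic symmetric function\<close>

text \<open>The degree-d part at the point x, with the variables outside A set to 0.\<close>

definition mon_eval :: "(nat \<Rightarrow> rat) \<Rightarrow> nat set \<Rightarrow> nat \<Rightarrow> rat mfps \<Rightarrow> rat" where
  "mon_eval x A d F = (\<Sum>m\<in>monomials d A. mcoeff F m * (\<Prod>i\<in>#m. x i))"

lemma mon_eval_sum:
  "finite I \<Longrightarrow> mon_eval x A d (\<Sum>i\<in>I. mconst (c i) * F i) = (\<Sum>i\<in>I. c i * mon_eval x A d (F i))"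
  unfolding mon_eval_def sum_distrib_left
  by (subst sum.swap) (simp add: sum_distrib_right mult.assoc)

lemma mon_eval_mult:
  assumes "finite A" "homogeneous d F" "homogeneous e G"
  shows "mon_eval x A (d + e) (F * G) = mon_eval x A d F * mon_eval x A e G"
proof -
  let ?M = "\<lambda>m. \<Prod>i\<in>#m. x i"
  have "mon_eval x A (d + e) (F * G) =
      (\<Sum>m\<in>monomials (d + e) A. \<Sum>a | a \<subseteq># m \<and> size a = d. mcoeff F a * mcoeff G (m - a) * ?M m)"
    unfolding mon_eval_def
  proof (intro sum.cong refl)
    fix m
    have "mcoeff (F * G) m = (\<Sum>a | a \<subseteq># m \<and> size a = d. mcoeff F a * mcoeff G (m - a))"
      unfolding mcoeff_mult
      by (rule sum.mono_neutral_right) (use assms(2) in \<open>auto simp: homogeneous_def\<close>)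
    then show "mcoeff (F * G) m * ?M m =
        (\<Sum>a | a \<subseteq># m \<and> size a = d. mcoeff F a * mcoeff G (m - a) * ?M m)"
      by (simp add: sum_distrib_right)
  qed
  also have "\<dots> = (\<Sum>(m, a)\<in>(SIGMA m:monomials (d + e) A. {a. a \<subseteq># m \<and> size a = d}).
      mcoeff F a * mcoeff G (m - a) * ?M m)"
  proof -
    have "finite {a. a \<subseteq># m \<and> size a = d}" for m :: "nat multiset"
      by (rule finite_subset[OF _ finite_submultisets[of m]]) auto
    then show ?thesis using assms(1) by (simp add: sum.Sigma)
  qed
  also have "\<dots> = (\<Sum>(a, b)\<in>monomials d A \<times> monomials e A. mcoeff F a * ?M a * (mcoeff G b * ?M b))"
  proof (rule sum.reindex_bij_witness[of _ "\<lambda>(a, b). (a + b, a)" "\<lambda>(m, a). (a, m - a)"], goal_cases)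
    case (1 p)
    then show ?case by auto
  next
    case (2 p)
    then show ?case
      by (auto simp: monomials_def size_Diff_submset dest: mset_subset_eqD in_diffD)
  next
    case (3 q)
    then show ?case by auto
  next
    case (4 q)
    then show ?case by (auto simp: monomials_def)
  next
    case (5 p)
    then obtain m a where p: "p = (m, a)" "a \<subseteq># m" by auto
    then obtain b where "m = a + b" by (auto simp: subset_mset.le_iff_add)
    with p show ?case by simp
  qed
  also have "\<dots> = mon_eval x A d F * mon_eval x A e G"
    by (simp add: mon_eval_def sum_product sum.cartesian_product)
  finally show ?thesis .
qed

lemma mon_eval_elementary:
  assumes "finite A"
  shows "mon_eval x A k (elementary_sf k) = esym x A k"
proof -
  have "mon_eval x A k (elementary_sf k) =
      (\<Sum>m | m \<in> monomials k A \<and> (\<forall>i. count m i \<le> 1). \<Prod>i\<in>#m. x i)"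
    unfolding mon_eval_def
    using finite_monomials[OF assms, of k]
    by (intro sum.mono_neutral_cong_right) (auto simp: mcoeff_elementary, auto simp: monomials_def)
  also have "\<dots> = (\<Sum>S | S \<subseteq> A \<and> card S = k. \<Prod>i\<in>S. x i)"
  proof (rule sum.reindex_bij_witness[of _ mset_set set_mset], goal_cases)
    case (1 m)
    then show ?case by (simp add: mset_set_set_mset_squarefree)
  next
    case (2 m)
    then have "mset_set (set_mset m) = m" by (simp add: mset_set_set_mset_squarefree)
    with 2 show ?case by (auto simp: monomials_def) (metis size_mset_set)
  next
    case (3 S)
    then have "finite S" using assms finite_subset by auto
    then show ?case by simp
  next
    case (4 S)
    then have "finite S" using assms finite_subset by auto
    with 4 show ?case by (auto simp: monomials_def count_mset_set')
  next
    case (5 m)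
    then have "mset_set (set_mset m) = m" by (simp add: mset_set_set_mset_squarefree)
    then show ?case by (metis prod_unfold_prod_mset)
  qed
  finally show ?thesis by (simp add: esym_def)
qed

lemma mon_eval_elementary_prod:
  assumes "finite A"
  shows "mon_eval x A (sum_mset \<mu>) (elementary_prod \<mu>) = (\<Prod>k\<in>#\<mu>. esym x A k)"
proof (induction \<mu>)
  case empty
  have "monomials 0 A = {{#}}" by (auto simp: monomials_def)
  then show ?case by (simp add: mon_eval_def mcoeff_1)
next
  case (add k \<mu>)
  then show ?case
    using mon_eval_mult[OF assms homogeneous_elementary[of k] homogeneous_elementary_prod[of \<mu>], of x]
    by (simp add: mon_eval_elementary[OF assms])
qed

text \<open>Kronecker's substitution turns the polynomial identity into one in a single variable.\<close>

lemma mcoeff_eq_if_mon_eval_eq: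
  assumes "\<And>x. (\<And>i. x i > 0) \<Longrightarrow> mon_eval x {..<N} d F = mon_eval x {..<N} d G"
    and m: "m \<in> monomials d {..<N}"
  shows "mcoeff F m = mcoeff G m"
proof -
  let ?W = "mon_weight (Suc d) N" and ?M = "monomials d {..<N}"
  define p where "p = (\<Sum>m\<in>?M. monom (mcoeff F m - mcoeff G m) (?W m))"
  have single: "?W {#i#} = Suc d ^ (N - i)" if "i < N" for i
  proof -
    have "?W {#i#} = (\<Sum>j<N. if j = i then Suc d ^ (N - j) else 0)"
      unfolding mon_weight_def by (intro sum.cong) auto
    then show ?thesis using that by simp
  qed
  have pw: "(\<Prod>i\<in>#m. t ^ (Suc d ^ (N - i))) = t ^ ?W m" if "set_mset m \<subseteq> {..<N}" for m and t :: rat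
    using that
  proof (induction m)
    case empty
    show ?case by (simp add: mon_weight_def)
  next
    case (add i m)
    then show ?case
      using mon_weight_add[of "Suc d" N "{#i#}" m] single[of i] by (simp add: power_add)
  qed
  have "poly p t = 0" if "t > 0" for t
  proof -
    have "mon_eval (\<lambda>i. t ^ (Suc d ^ (N - i))) {..<N} d H = (\<Sum>m\<in>?M. mcoeff H m * t ^ ?W m)" for H
      unfolding mon_eval_def by (intro sum.cong refl) (simp add: pw monomials_def)
    with assms(1)[of "\<lambda>i. t ^ (Suc d ^ (N - i))"] that show ?thesis
      by (simp add: p_def poly_sum poly_monom left_diff_distrib sum_subtractf)
  qed
  then have "{0<..} \<subseteq> {t. poly p t = 0}" by auto
  moreover have "infinite {0 :: rat<..}" by (rule infinite_Ioi)
  ultimately have "p = 0" using poly_roots_finite finite_subset by blast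
  then have "0 = coeff p (?W m)" by simp
  also have "\<dots> = (\<Sum>n\<in>?M. if n = m then mcoeff F n - mcoeff G n else 0)"
    unfolding p_def coeff_sum using m by (intro sum.cong) (auto simp: dest: mon_weight_inj)
  also have "\<dots> = mcoeff F m - mcoeff G m" using m by simp
  finally show ?thesis by simp
qed

section \<open>Proper colorings of Hessenberg graphs, vertex by vertex\<close>

lemma color_sum_lists:
  assumes "finite A"
  shows "color_sum x A r n F = (\<Sum>ys | length ys = n \<and> set ys \<subseteq> A \<and>
      (\<forall>j<n. ys ! j \<notin> set (drop (r j) (take j ys))). (\<Prod>i<n. x (ys ! i)) * F ys)"
proof (induction n arbitrary: F)
  case 0
  have "{ys. ys = [] \<and> set ys \<subseteq> A} = {[]}" by auto
  then show ?case by simp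
next
  case (Suc n)
  let ?L = "\<lambda>n. {ys. length ys = n \<and> set ys \<subseteq> A \<and> (\<forall>j<n. ys ! j \<notin> set (drop (r j) (take j ys)))}"
  have fin: "finite (?L n)"
    by (rule finite_subset[OF _ finite_lists_length_eq[OF assms, of n]]) auto
  have "color_sum x A r (Suc n) F =
      (\<Sum>(ys, c)\<in>(SIGMA ys:?L n. A - set (drop (r n) ys)). (\<Prod>i<n. x (ys ! i)) * (x c * F (ys @ [c])))"
    using assms fin by (simp add: Suc.IH sum_distrib_left sum.Sigma)
  also have "\<dots> = (\<Sum>ys\<in>?L (Suc n). (\<Prod>i<Suc n. x (ys ! i)) * F ys)"
  proof (rule sum.reindex_bij_witness[of _ "\<lambda>ys. (butlast ys, last ys)" "\<lambda>(ys, c). ys @ [c]"], goal_cases)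
    case (1 p)
    then show ?case by auto
  next
    case (2 p)
    then show ?case by (auto simp: nth_append less_Suc_eq)
  next
    case (3 ys)
    then show ?case by (cases ys rule: rev_cases) auto
  next
    case (4 ys)
    then obtain zs c where ys: "ys = zs @ [c]" by (cases ys rule: rev_cases) auto
    have "zs ! j \<notin> set (drop (r j) (take j zs))" if "j < n" for j
      using 4 that by (auto simp: ys nth_append dest!: spec[of _ j])
    with 4 show ?case by (auto simp: ys nth_append dest!: spec[of _ n])
  next
    case (5 p)
    then show ?case by (auto simp: nth_append)
  qed
  finally show ?case .
qed

text \<open>The vertex \<open>j + 1\<close> of the graph becomes the vertex \<open>j\<close> of \<^const>\<open>color_sum\<close>.\<close>

definition hess_bound :: "nat \<Rightarrow> (nat \<Rightarrow> nat) \<Rightarrow> nat \<Rightarrow> nat" where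
  "hess_bound n f j = card {i \<in> {1..n}. f i \<le> j}"

lemma mono_hess_bound: "mono (hess_bound n f)"
  unfolding hess_bound_def by (intro monoI card_mono) auto

lemma hess_bound_le:
  assumes "hessenberg n f"
  shows "hess_bound n f j \<le> j"
proof -
  have "{i \<in> {1..n}. f i \<le> j} \<subseteq> {1..j}"
    using assms unfolding hessenberg_def by fastforce
  from card_mono[OF _ this] show ?thesis by (simp add: hess_bound_def)
qed

text \<open>By monotonicity the i with f i \<le> j form an initial segment; they are the
  predecessors of vertex j + 1 not adjacent to it.\<close>

lemma hess_bound_le_iff:
  assumes "hessenberg n f" "i < n"
  shows "hess_bound n f j \<le> i \<longleftrightarrow> j < f (Suc i)"
proof
  assume le: "hess_bound n f j \<le> i"
  show "j < f (Suc i)"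
  proof (rule ccontr)
    assume "\<not> j < f (Suc i)"
    moreover have "f k \<le> f (Suc i)" if "k \<in> {1..Suc i}" for k
      using assms that by (auto simp: hessenberg_def dest: mono_onD[of _ _ k "Suc i"])
    ultimately have "{1..Suc i} \<subseteq> {k \<in> {1..n}. f k \<le> j}" using assms(2) by force
    from card_mono[OF _ this] le show False by (simp add: hess_bound_def)
  qed
next
  assume lt: "j < f (Suc i)"
  have "{k \<in> {1..n}. f k \<le> j} \<subseteq> {1..i}"
  proof
    fix k assume k: "k \<in> {k \<in> {1..n}. f k \<le> j}"
    have "k \<le> i"
    proof (rule ccontr)
      assume "\<not> k \<le> i"
      then have "f (Suc i) \<le> f k"
        using assms k by (auto simp: hessenberg_def dest: mono_onD[of _ _ "Suc i" k])
      with lt k show False by simp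
    qed
    with k show "k \<in> {1..i}" by simp
  qed
  from card_mono[OF _ this] show "hess_bound n f j \<le> i" by (simp add: hess_bound_def)
qed

text \<open>A monomial in A comes only from colorings with values in A; listing the colors in vertex
  order turns these into the lists of \<open>color_sum_lists\<close>.\<close>

lemma mon_eval_chromatic:
  assumes "hessenberg n f" "finite A"
  shows "mon_eval x A n (chromatic_sf {1..n} (hess_edges n f)) = color_sum x A (hess_bound n f) n (\<lambda>_. 1)"
proof -
  let ?P = "proper_colorings {1..n} (hess_edges n f)" and ?r = "hess_bound n f"
  let ?im = "\<lambda>\<kappa>. image_mset \<kappa> (mset_set {1..n})"
  define K where "K = {\<kappa> \<in> ?P. \<kappa> \<in> {1..n} \<rightarrow>\<^sub>E A}"
  have fin: "finite K" unfolding K_def using assms(2)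
    by (intro finite_subset[OF _ finite_PiE[of "{1..n}" "\<lambda>_. A"]]) auto
  have "mon_eval x A n (chromatic_sf {1..n} (hess_edges n f)) =
      (\<Sum>m\<in>monomials n A. \<Sum>\<kappa> | \<kappa> \<in> K \<and> ?im \<kappa> = m. \<Prod>i\<in>#?im \<kappa>. x i)"
    unfolding mon_eval_def
  proof (intro sum.cong refl)
    fix m assume m: "m \<in> monomials n A"
    have "\<kappa> v \<in> A" if "?im \<kappa> = m" "v \<in> {1..n}" for \<kappa> v
    proof -
      have "\<kappa> v \<in># ?im \<kappa>" using that(2) by simp
      then show ?thesis using m unfolding that(1) by (auto simp: monomials_def)
    qed
    then have "{\<kappa> \<in> ?P. ?im \<kappa> = m} = {\<kappa>. \<kappa> \<in> K \<and> ?im \<kappa> = m}"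
      by (auto simp: K_def proper_colorings_def PiE_def Pi_def)
    then show "mcoeff (chromatic_sf {1..n} (hess_edges n f)) m * (\<Prod>i\<in>#m. x i) =
        (\<Sum>\<kappa> | \<kappa> \<in> K \<and> ?im \<kappa> = m. \<Prod>i\<in>#?im \<kappa>. x i)"
      by (simp add: chromatic_sf_def monomial_sum_def)
  qed
  also have "\<dots> = (\<Sum>\<kappa>\<in>K. \<Prod>i\<in>#?im \<kappa>. x i)"
    by (intro sum.group fin finite_monomials assms(2)) (auto simp: K_def monomials_def PiE_def Pi_def)
  also have "\<dots> = (\<Sum>\<kappa>\<in>K. \<Prod>i<n. x (\<kappa> (Suc i)))"
  proof (intro sum.cong refl)
    fix \<kappa>
    have "(\<Prod>i\<in>#?im \<kappa>. x i) = (\<Prod>i\<in>{1..n}. x (\<kappa> i))"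
      by (simp add: prod_unfold_prod_mset multiset.map_comp o_def)
    also have "\<dots> = (\<Prod>i<n. x (\<kappa> (Suc i)))"
      by (rule prod.reindex_bij_witness[of _ Suc "\<lambda>i. i - 1"]) auto
    finally show "(\<Prod>i\<in>#?im \<kappa>. x i) = (\<Prod>i<n. x (\<kappa> (Suc i)))" .
  qed
  also have "\<dots> = (\<Sum>ys | length ys = n \<and> set ys \<subseteq> A \<and>
      (\<forall>j<n. ys ! j \<notin> set (drop (?r j) (take j ys))). (\<Prod>i<n. x (ys ! i)) * 1)"
  proof -
    have drop_iff: "(\<forall>j<n. ys ! j \<notin> set (drop (?r j) (take j ys))) \<longleftrightarrow>
        (\<forall>i j. i < j \<longrightarrow> j < n \<longrightarrow> j < f (Suc i) \<longrightarrow> ys ! i \<noteq> ys ! j)" if "length ys = n" for ys :: "nat list"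
    proof -
      have "ys ! j \<notin> set (drop (?r j) (take j ys)) \<longleftrightarrow> (\<forall>i<j. ?r j \<le> i \<longrightarrow> ys ! i \<noteq> ys ! j)" if j: "j < n" for j
      proof -
        have "set (drop (?r j) (take j ys)) = {ys ! i |i. ?r j \<le> i \<and> i < j}" (is "?L = ?R")
        proof (intro equalityI subsetI)
          fix y assume "y \<in> ?L"
          then obtain k where "k < j - ?r j" "y = ys ! (?r j + k)"
            using j \<open>length ys = n\<close> by (auto simp: in_set_conv_nth)
          then show "y \<in> ?R" by (auto intro!: exI[of _ "?r j + k"])
        next
          fix y assume "y \<in> ?R"
          then obtain i where "?r j \<le> i" "i < j" "y = ys ! i" by blast
          then show "y \<in> ?L"
            using j \<open>length ys = n\<close> by (auto simp: in_set_conv_nth intro!: exI[of _ "i - ?r j"])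
        qed
        then show ?thesis by auto
      qed
      note 1 = this
      have 2: "?r j \<le> i \<longleftrightarrow> j < f (Suc i)" if "i < j" "j < n" for i j
        using hess_bound_le_iff[OF assms(1), of i j] that by simp
      have "ys ! j \<notin> set (drop (?r j) (take j ys)) \<longleftrightarrow>
          (\<forall>i<j. j < f (Suc i) \<longrightarrow> ys ! i \<noteq> ys ! j)" if "j < n" for j
        unfolding 1[OF that] using 2[OF _ that] by blast
      then show ?thesis by blast
    qed
    have proper_iff: "(\<forall>u\<in>{1..n}. \<forall>v\<in>{1..n}. {u, v} \<in> hess_edges n f \<longrightarrow> \<kappa> u \<noteq> \<kappa> v) \<longleftrightarrow>
        (\<forall>i j. i < j \<longrightarrow> j < n \<longrightarrow> j < f (Suc i) \<longrightarrow> \<kappa> (Suc i) \<noteq> \<kappa> (Suc j))" (is "?L \<longleftrightarrow> ?R") for \<kappa> :: "nat \<Rightarrow> nat"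
    proof
      assume L: ?L
      show ?R
      proof (intro allI impI)
        fix i j assume ij: "i < j" "j < n" "j < f (Suc i)"
        have "{Suc i, Suc j} \<in> hess_edges n f"
          unfolding hess_edges_def mem_Collect_eq
          by (rule exI[of _ "Suc i"], rule exI[of _ "Suc j"]) (use ij in simp)
        with L ij show "\<kappa> (Suc i) \<noteq> \<kappa> (Suc j)" by auto
      qed
    next
      assume R: ?R
      have key: "\<kappa> i \<noteq> \<kappa> j" if "i \<in> {1..n}" "j \<in> {1..n}" "i < j" "j \<le> f i" for i j
        using R[rule_format, of "i - 1" "j - 1"] that by auto
      show ?L
      proof (intro ballI impI)
        fix u v assume "{u, v} \<in> hess_edges n f"
        then obtain i j where ij: "{u, v} = {i, j}" "i \<in> {1..n}" "j \<in> {1..n}" "i < j" "j \<le> f i"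
          by (auto simp: hess_edges_def)
        with key[of i j] show "\<kappa> u \<noteq> \<kappa> v" by (auto simp: doubleton_eq_iff)
      qed
    qed
    show ?thesis
    proof (rule sum.reindex_bij_witness[of _ "\<lambda>ys. \<lambda>v\<in>{1..n}. ys ! (v - 1)" "\<lambda>\<kappa>. map (\<lambda>i. \<kappa> (Suc i)) [0..<n]"], goal_cases)
      case (1 \<kappa>)
      show ?case
      proof
        fix v
        show "(\<lambda>v\<in>{1..n}. map (\<lambda>i. \<kappa> (Suc i)) [0..<n] ! (v - 1)) v = \<kappa> v"
          using 1 by (cases "v \<in> {1..n}") (auto simp: K_def PiE_def extensional_def)
      qed
    next
      case (2 \<kappa>)
      then have "\<forall>u\<in>{1..n}. \<forall>v\<in>{1..n}. {u, v} \<in> hess_edges n f \<longrightarrow> \<kappa> u \<noteq> \<kappa> v"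
        and "\<kappa> \<in> {1..n} \<rightarrow> A" by (auto simp: K_def proper_colorings_def)
      then have "\<forall>j<n. map (\<lambda>i. \<kappa> (Suc i)) [0..<n] ! j \<notin>
          set (drop (?r j) (take j (map (\<lambda>i. \<kappa> (Suc i)) [0..<n])))"
        unfolding proper_iff by (subst drop_iff) auto
      with \<open>\<kappa> \<in> {1..n} \<rightarrow> A\<close> show ?case by auto
    next
      case (3 ys)
      then show ?case by (intro nth_equalityI) auto
    next
      case (4 ys)
      let ?\<kappa> = "\<lambda>v\<in>{1..n}. ys ! (v - 1)"
      have "\<forall>u\<in>{1..n}. \<forall>v\<in>{1..n}. {u, v} \<in> hess_edges n f \<longrightarrow> ?\<kappa> u \<noteq> ?\<kappa> v"
        unfolding proper_iff using 4 drop_iff[of ys] by auto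
      moreover have "ys ! (v - 1) \<in> A" if "v \<in> {1..n}" for v
        using 4 that by (auto intro: subsetD[OF _ nth_mem])
      ultimately show ?case by (auto simp: K_def proper_colorings_def)
    next
      case (5 \<kappa>)
      show ?case by (simp add: nth_append)
    qed
  qed
  finally show ?thesis by (simp add: color_sum_lists[OF assms(2)])
qed

lemma homogeneous_chromatic: "homogeneous (card V) (chromatic_sf V E :: 'b::comm_ring_1 mfps)"
  unfolding homogeneous_def
proof (intro allI impI)
  fix m assume "mcoeff (chromatic_sf V E :: 'b mfps) m \<noteq> 0"
  then have "{\<kappa> \<in> proper_colorings V E. image_mset \<kappa> (mset_set V) = m} \<noteq> {}"
    by (auto simp: chromatic_sf_def monomial_sum_def simp del: Collect_empty_eq)
  then show "size m = card V" by auto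
qed

text \<open>Two expansions are compared: a nonnegative rational one from the column probabilities
  and an integral one from elimination. Independence identifies them.\<close>

lemma chromatic_e_positive:
  assumes "hessenberg n f"
  obtains C where "\<And>\<mu>. \<mu> \<in> partitions_of n \<Longrightarrow> C \<mu> \<in> \<nat>"
    "(chromatic_sf {1..n} (hess_edges n f) :: rat mfps) =
      (\<Sum>\<mu>\<in>partitions_of n. mconst (C \<mu>) * elementary_prod \<mu>)"
proof -
  let ?X = "chromatic_sf {1..n} (hess_edges n f) :: rat mfps"
  obtain C where C: "\<And>\<mu>. C \<mu> \<ge> 0"
    "\<And>x A. finite A \<Longrightarrow> (\<And>i. i \<in> A \<Longrightarrow> x i > 0) \<Longrightarrow> card A \<ge> n \<Longrightarrow>
      color_sum x A (hess_bound n f) n (\<lambda>_. 1) =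
      (\<Sum>\<mu>\<in>partitions_of n. C \<mu> * (\<Prod>k\<in>#\<mu>. esym x A k))"
    using color_sum_e_positive[of "hess_bound n f" n, OF mono_hess_bound hess_bound_le[OF assms]] by metis
  let ?Y = "\<Sum>\<mu>\<in>partitions_of n. mconst (C \<mu>) * elementary_prod \<mu>"
  have hX: "homogeneous n ?X" using homogeneous_chromatic[of "{1..n}"] by simp
  have hE: "homogeneous n (elementary_prod \<mu> :: rat mfps)" if "\<mu> \<in> partitions_of n" for \<mu>
    using homogeneous_elementary_prod[of \<mu>] that by (simp add: partitions_of_def)
  have XY: "?X = ?Y"
    unfolding mfps_eq_iff
  proof
    fix m
    show "mcoeff ?X m = mcoeff ?Y m"
    proof (cases "size m = n")
      case False
      then have "mcoeff ?X m = 0" using hX by (auto simp: homogeneous_def)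
      moreover have "mcoeff ?Y m = 0" using hE False by (auto simp: homogeneous_def intro!: sum.neutral)
      ultimately show ?thesis by simp
    next
      case True
      \<comment> \<open>Large enough to contain the variables of m and to supply the n variables
        that the expansion requires.\<close>
      define N where "N = n + Suc (Max (insert 0 (set_mset m)))"
      have "i < N" if "i \<in># m" for i
      proof -
        have "i \<le> Max (insert 0 (set_mset m))" using that by (intro Max_ge) auto
        then show ?thesis by (simp add: N_def)
      qed
      then have m: "m \<in> monomials n {..<N}" using True by (auto simp: monomials_def)
      show ?thesis
      proof (rule mcoeff_eq_if_mon_eval_eq[OF _ m])
        fix x :: "nat \<Rightarrow> rat" assume x: "\<And>i. x i > 0"
        have "mon_eval x {..<N} n ?Y =
            (\<Sum>\<mu>\<in>partitions_of n. C \<mu> * mon_eval x {..<N} n (elementary_prod \<mu>))"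
          by (rule mon_eval_sum[OF finite_partitions_of])
        also have "\<dots> = (\<Sum>\<mu>\<in>partitions_of n. C \<mu> * (\<Prod>k\<in>#\<mu>. esym x {..<N} k))"
          using mon_eval_elementary_prod[of "{..<N}" x] by (intro sum.cong) (auto simp: partitions_of_def)
        also have "\<dots> = mon_eval x {..<N} n ?X"
          unfolding mon_eval_chromatic[OF assms finite_lessThan]
          using x by (intro C(2)[symmetric]) (auto simp: N_def)
        finally show "mon_eval x {..<N} n ?X = mon_eval x {..<N} n ?Y" ..
      qed
    qed
  qed
  have "perm_invariant ?Y"
    using perm_invariant_elementary_prod[where 'a = rat] by (simp add: perm_invariant_def)
  then have inv: "perm_invariant ?X" by (simp only: XY)
  have int: "mcoeff ?X m \<in> \<int>" for m by (simp add: chromatic_sf_def monomial_sum_def)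
  obtain c where c: "\<And>\<mu>. c \<mu> \<in> \<int>" "?X = (\<Sum>\<mu>\<in>partitions_of n. mconst (c \<mu>) * elementary_prod \<mu>)"
    by (rule elementary_span[of "\<int>" ?X n]) (use hX inv int in auto)
  have "C \<mu> \<in> \<nat>" if "\<mu> \<in> partitions_of n" for \<mu>
  proof -
    have "(\<Sum>\<mu>\<in>partitions_of n. mconst (C \<mu> - c \<mu>) * elementary_prod \<mu>) = (0 :: rat mfps)"
      using c(2) XY by (simp add: mfps_eq_iff left_diff_distrib sum_subtractf)
    from elementary_independent[OF finite_partitions_of _ this that]
    have "C \<mu> = c \<mu>" by (simp add: partitions_of_def)
    with c(1)[of \<mu>] C(1)[of \<mu>] show ?thesis by (simp add: Nats_altdef2)
  qed
  with XY that show ?thesis by blast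
qed

theorem theorem1p8:
  fixes n :: nat and f :: "nat \<Rightarrow> nat"
  assumes "n > 0"
    and "hessenberg n f"
    and "longest_chain n f = 3"
  shows "(\<exists>c. (omega (chromatic_sf {1..n} (hess_edges n f)) :: rat mfps) = h_expansion n c) \<and>
    (\<forall>c. (omega (chromatic_sf {1..n} (hess_edges n f)) :: rat mfps) = h_expansion n c \<longrightarrow>
      (\<forall>\<mu>\<in>partitions_of n. c \<mu> \<in> \<nat>))"
proof -
  obtain C where C: "\<And>\<mu>. \<mu> \<in> partitions_of n \<Longrightarrow> C \<mu> \<in> \<nat>"
    and X: "(chromatic_sf {1..n} (hess_edges n f) :: rat mfps) =
      (\<Sum>\<mu>\<in>partitions_of n. mconst (C \<mu>) * elementary_prod \<mu>)"
    using chromatic_e_positive[OF assms(2)] by blast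
  have "omega (chromatic_sf {1..n} (hess_edges n f)) = h_expansion n C"
    unfolding X by (rule omega_elementary_sum)
  \<comment> \<open>Any other coefficient family agrees with C on partitions of n by independence of
    the homogeneous products.\<close>
  with C show ?thesis by (metis homogeneous_independent)
qed

end
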